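(* Consider the control-affine system $\dot{x}=f(x)+g(x)u$ with $x\in\mathbb{R}^n$, unconstrained input $u\in\mathbb{R}^m$, $f\in\mathbb{R}^n[x]$, $g\in\mathbb{R}^{n\times m}[x]$. Let $S=\{b_1,\dots,b_L\}$ be a collection of candidate control barrier functions (CBFs), $b_i\in\mathbb{R}[x]$ for $i=1,\dots,L$, regarded as inequality constraints, and let $\mathcal{B}=\{x\in\mathbb{R}^n\mid b_1(x)\geq 0,\dots,b_L(x)\geq 0\}$. Assume that the quadratic module $M_S$ is Archimedean. Then $b_i$ is a CBF for every $i\in\{1,\dots,L\}$ and $\mathcal{B}\neq\emptyset$ if and only if both of the following conditions are satisfied: (1) For each $i\in\{1,\dots,L\}$ there exist an integer $a\geq 0$, sums-of-squares polynomials $s_1,s_2\in\Sigma[x]$, polynomials $p_{10},p_{20}\in\mathbb{R}[x]$ and polynomial vectors $p_1,p_2\in\mathbb{R}^m[x]$ (all depending on $i$) such that, with $h_j(x)=s_j(x)+b_i(x)p_{j0}(x)+L_gb_i(x)p_j(x)$ for $j=1,2$, the polynomial identity $$h_1(x)L_fb_i(x)-h_2(x)-(L_fb_i(x))^{2a}=0$$ holds. (2) There do not exist sums-of-squares polynomials $s_0,s_1,\dots,s_L\in\Sigma[x]$ such that the polynomial identity $$1+s_0(x)+\sum_{i=1}^L s_i(x)b_i(x)=0$$ holds.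
   Context: $\mathbb{R}[x]$ is the ring of real polynomials in $x=(x_1,\dots,x_n)$; $\mathbb{R}^{m\times n}[x]$ denotes $m\times n$ matrices with entries in $\mathbb{R}[x]$, and $\mathbb{R}^m[x]=\mathbb{R}^{m\times 1}[x]$. $\Sigma[x]\subseteq\mathbb{R}[x]$ is the set of finite sums $\sum_i p_i^2$ with $p_i\in\mathbb{R}[x]$. Lie derivatives: $L_fb(x)=\frac{\partial b(x)}{\partial x}f(x)\in\mathbb{R}[x]$ and $L_gb(x)=\frac{\partial b(x)}{\partial x}g(x)$, a vector of $m$ polynomials, treated as a row in products $L_gb(x)u$ and $L_gb(x)p_j(x)$. Quadratic module: $M_S=\{s_0+\sum_{i=1}^L s_ib_i\mid s_0,\dots,s_L\in\Sigma[x]\}$. It is Archimedean if there is $C\in\mathbb{N}\setminus\{0\}$ with $C-\sum_{i=1}^n x_i^2\in M_S$. CBF: $b\in\mathbb{R}[x]$ is a CBF if there is an extended class-$\mathcal{K}$ function $\kappa$ such that $\sup_u\{L_fb(x)+L_gb(x)u+\kappa(b(x))\}\geq 0$ for all $x\in\mathbb{R}^n$; the corresponding constraint on the input is $L_gb(x)u\geq-\kappa(b(x))-L_fb(x)$. Inputs are unbounded throughout, and the following criterion from the literature is adopted as the standing characterization: a candidate $b$ satisfies the CBF input constraint (i.e. is a CBF) if and only if there is no $x\in\mathbb{R}^n$ with $b(x)=0$, $L_gb(x)=0$ and $L_fb(x)<0$. *)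

theory Defs
  imports "HOL-Analysis.Analysis" "HOL-Library.Poly_Mapping"
begin

text \<open>Polynomials in the variables \<open>x\<^sub>i\<close>, \<open>i :: 'n\<close>: a finitely supported map from exponent
  vectors to coefficients. The ring operations are those of \<^theory>\<open>HOL-Library.Poly_Mapping\<close>.\<close>

type_synonym 'n rpoly = "('n \<Rightarrow>\<^sub>0 nat) \<Rightarrow>\<^sub>0 real"

definition rvar :: "'n \<Rightarrow> 'n rpoly" where
  "rvar i = Poly_Mapping.single (Poly_Mapping.single i 1) 1"

definition reval :: "('n::finite) rpoly \<Rightarrow> real ^ 'n \<Rightarrow> real" where
  "reval p x = (\<Sum>\<alpha>\<in>Poly_Mapping.keys p.
     Poly_Mapping.lookup p \<alpha> * (\<Prod>i\<in>UNIV. (x $ i) ^ Poly_Mapping.lookup \<alpha> i))"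

text \<open>Exponent subtraction truncates, but only where the coefficient \<open>\<alpha>\<^sub>i\<close> vanishes.\<close>

definition rpderiv :: "'n \<Rightarrow> 'n rpoly \<Rightarrow> 'n rpoly" where
  "rpderiv i p = (\<Sum>\<alpha>\<in>Poly_Mapping.keys p.
     Poly_Mapping.single (\<alpha> - Poly_Mapping.single i 1)
       (of_nat (Poly_Mapping.lookup \<alpha> i) * Poly_Mapping.lookup p \<alpha>))"

definition sos :: "'n rpoly set" where
  "sos = {p. \<exists>qs. p = (\<Sum>q\<leftarrow>qs. q ^ 2)}"

definition gradient :: "('n::finite) rpoly \<Rightarrow> 'n rpoly ^ 'n" where
  "gradient b = (\<chi> i. rpderiv i b)"

definition rowmult :: "('a::semiring_1) ^ 'k \<Rightarrow> 'a ^ 'k \<Rightarrow> 'a" where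
  "rowmult v w = (\<Sum>k\<in>UNIV. v $ k * w $ k)"

definition Lie_f :: "('n::finite) rpoly ^ 'n \<Rightarrow> 'n rpoly \<Rightarrow> 'n rpoly" where
  "Lie_f f b = rowmult (gradient b) f"

definition Lie_g :: "('n::finite) rpoly ^ ('m::finite) ^ 'n \<Rightarrow> 'n rpoly \<Rightarrow> 'n rpoly ^ 'm" where
  "Lie_g g b = gradient b v* g"

definition reval_vec :: "('n::finite) rpoly ^ 'm \<Rightarrow> real ^ 'n \<Rightarrow> real ^ 'm" where
  "reval_vec v x = (\<chi> k. reval (v $ k) x)"

definition quad_module :: "nat \<Rightarrow> (nat \<Rightarrow> 'n rpoly) \<Rightarrow> 'n rpoly set" where
  "quad_module L b = {s 0 + (\<Sum>i=1..L. s i * b i) | s. \<forall>i\<le>L. s i \<in> sos}"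

definition archimedean :: "('n::finite) rpoly set \<Rightarrow> bool" where
  "archimedean M \<longleftrightarrow> (\<exists>C::nat. C > 0 \<and> of_nat C - (\<Sum>i\<in>UNIV. rvar i ^ 2) \<in> M)"

definition safe_set :: "nat \<Rightarrow> (nat \<Rightarrow> ('n::finite) rpoly) \<Rightarrow> (real ^ 'n) set" where
  "safe_set L b = {x. \<forall>i\<in>{1..L}. reval (b i) x \<ge> 0}"

text \<open>A candidate is a CBF, for unbounded inputs, in the sense of the pointwise criterion that the
  literature uses as its characterization. The formulation with an extended class-\<open>\<K>\<close>
  function, \<open>is_cbf_kappa\<close> below, implies it but is not equivalent to it: with
  \<open>f = 0\<close> and \<open>g = 0\<close> every polynomial satisfies the criterion, whereas \<open>is_cbf_kappa\<close> fails
  as soon as the polynomial takes a negative value. Hence the criterion, not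
  \<open>is_cbf_kappa\<close>, is the definition of a CBF.\<close>

definition is_cbf ::
  "('n::finite) rpoly ^ 'n \<Rightarrow> 'n rpoly ^ ('m::finite) ^ 'n \<Rightarrow> 'n rpoly \<Rightarrow> bool" where
  "is_cbf f g b \<longleftrightarrow>
     \<not> (\<exists>x. reval b x = 0 \<and> reval_vec (Lie_g g b) x = 0 \<and> reval (Lie_f f b) x < 0)"

definition ext_class_K :: "(real \<Rightarrow> real) \<Rightarrow> bool" where
  "ext_class_K \<kappa> \<longleftrightarrow> continuous_on UNIV \<kappa> \<and> strict_mono \<kappa> \<and> \<kappa> 0 = 0"

definition is_cbf_kappa ::
  "('n::finite) rpoly ^ 'n \<Rightarrow> 'n rpoly ^ ('m::finite) ^ 'n \<Rightarrow> 'n rpoly \<Rightarrow> bool" where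
  "is_cbf_kappa f g b \<longleftrightarrow> (\<exists>\<kappa>. ext_class_K \<kappa> \<and>
     (\<forall>x. (SUP u. ereal (reval (Lie_f f b) x + rowmult (reval_vec (Lie_g g b) x) u
                     + \<kappa> (reval b x))) \<ge> 0))"

lemma is_cbf_kappa_imp_is_cbf:
  assumes "is_cbf_kappa f g b"
  shows "is_cbf f g b"
proof -
  obtain \<kappa> where k: "ext_class_K \<kappa>"
    and sup: "\<And>x. (SUP u. ereal (reval (Lie_f f b) x + rowmult (reval_vec (Lie_g g b) x) u
                     + \<kappa> (reval b x))) \<ge> 0"
    using assms by (auto simp: is_cbf_kappa_def)
  have "reval (Lie_f f b) x \<ge> 0" if "reval b x = 0" "reval_vec (Lie_g g b) x = 0" for x
    using sup[of x] that k by (simp add: rowmult_def ext_class_K_def)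
  then show ?thesis
    unfolding is_cbf_def by (meson not_le)
qed

lemma zero_dynamics:
  fixes b :: "('n::finite) rpoly"
  shows "is_cbf 0 (0 :: 'n rpoly ^ ('m::finite) ^ 'n) b"
    and "reval b x < 0 \<Longrightarrow> \<not> is_cbf_kappa 0 (0 :: 'n rpoly ^ 'm ^ 'n) b"
proof -
  have f0: "reval (Lie_f 0 b) y = 0" for y
    by (simp add: Lie_f_def rowmult_def reval_def)
  have g0: "reval_vec (Lie_g (0 :: 'n rpoly ^ 'm ^ 'n) b) y = 0" for y
    by (simp add: Lie_g_def reval_vec_def reval_def vector_matrix_mult_def vec_eq_iff)
  show "is_cbf 0 (0 :: 'n rpoly ^ 'm ^ 'n) b"
    by (simp add: is_cbf_def f0)
  assume neg: "reval b x < 0"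
  show "\<not> is_cbf_kappa 0 (0 :: 'n rpoly ^ 'm ^ 'n) b"
  proof
    assume "is_cbf_kappa 0 (0 :: 'n rpoly ^ 'm ^ 'n) b"
    then obtain \<kappa> where k: "ext_class_K \<kappa>" and "\<kappa> (reval b x) \<ge> 0"
      by (auto simp: is_cbf_kappa_def f0 g0 rowmult_def)
    with neg show False
      by (metis ext_class_K_def not_le strict_monoD)
  qed
qed

end

theory Submission
  imports Defs "HOL-Algebra.Algebraic_Closure_Type"
begin

text \<open>Condition (1) for a single \<open>b\<^sub>i\<close> is a Positivstellensatz certificate for the emptiness of
  \<open>{b\<^sub>i = 0, L\<^sub>g b\<^sub>i = 0, L\<^sub>f b\<^sub>i < 0}\<close>; no compactness is available here, so the theorem of
  Krivine and Stengle is needed in full. If there is no certificate, Zorn's lemma yields a prime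
  cone \<open>T\<close> of the polynomial ring in which the sign conditions hold. The residue ring of \<open>T\<close> is an
  ordered domain; its field of fractions has a real closure \<open>K\<close>, and the classes of the variables form
  a point of \<open>K\<^sup>n\<close> satisfying the sign conditions. Eliminating one variable after the other by the
  method of Cohen and Hoermander transfers them to a point of \<open>\<real>\<^sup>n\<close>.

  Condition (2) says \<open>- 1 \<notin> M\<^sub>S\<close>. A maximal proper quadratic module containing \<open>M\<^sub>S\<close> is total, and as
  \<open>M\<^sub>S\<close> is Archimedean every polynomial has a unique real value modulo it. This gives a ring
  homomorphism to \<open>\<real>\<close>, that is, a point, at which all \<open>b\<^sub>i\<close> are nonnegative.\<close>

text \<open>The abstract field \<open>K\<close> has neither completeness nor a usable topology, so
  whatever the transfer needs there must follow from the intermediate value property of polynomials;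
  this is why Rolle's theorem is proved algebraically. The transfer manipulates no logical formulas:
  it compares two specialisations of one coefficient ring. A finite family of polynomials is
  enlarged until the signs of its coefficients determine its sign pattern on the line, and a
  matching of the two lines is refined one polynomial at a time.

  The condition \<open>L_f b < 0\<close> is split: \<open>- L_f b\<close> is put into the cone, and
  all negated even powers of \<open>L_f b\<close> are kept out of it. The second half stands for
  \<open>L_f b \<noteq> 0\<close> and is the origin of the term \<open>(L_f b)^(2a)\<close> in the
  certificate.

  The real closure is sought inside the algebraic closure: there all roots exist already, and it
  remains to choose an order on a subfield that extends no further. Whether an order extends to a
  simple extension is decided by the sums of squares modulo a minimal polynomial.\<close>

hide_const (open) up_ring.coeff up_ring.monom Polynomials.lead_coeff Polynomials.degree
  Coset.order module.smult

section \<open>Real closed fields\<close>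

text \<open>The intermediate value property for polynomials characterises real closed fields among the
  ordered fields. As in \<^class>\<open>alg_closed_field\<close>, polynomials cannot be mentioned inside the class.\<close>

class real_closed = linordered_field +
  assumes sum_IVT: "\<lbrakk>a < b; (\<Sum>k\<le>n. f k * a ^ k) < 0; 0 < (\<Sum>k\<le>n. f k * b ^ k)\<rbrakk>
    \<Longrightarrow> \<exists>x. a < x \<and> x < b \<and> (\<Sum>k\<le>n. f k * x ^ k) = 0"

lemma rc_poly_IVT:
  fixes p :: "'a::real_closed poly"
  assumes "a < b" and "poly p a * poly p b < 0"
  obtains x where "a < x" "x < b" "poly p x = 0"
proof -
  have *: "\<exists>x. a < x \<and> x < b \<and> poly q x = 0" if "poly q a < 0" "0 < poly q b" for q
    using sum_IVT[of a b "coeff q" "degree q"] that assms(1) by (simp add: poly_altdef)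
  from assms(2) consider "poly p a < 0" "0 < poly p b" | "0 < poly p a" "poly p b < 0"
    by (auto simp: mult_less_0_iff)
  then show ?thesis
    using *[of p] *[of "- p"] that by cases auto
qed

instance real :: real_closed
proof
  fix a b :: real and n :: nat and f :: "nat \<Rightarrow> real"
  assume "a < b" and a: "(\<Sum>k\<le>n. f k * a ^ k) < 0" and b: "0 < (\<Sum>k\<le>n. f k * b ^ k)"
  moreover have "continuous_on {a..b} (\<lambda>x. \<Sum>k\<le>n. f k * x ^ k)"
    by (intro continuous_intros)
  ultimately obtain x where x: "a \<le> x" "x \<le> b" "(\<Sum>k\<le>n. f k * x ^ k) = 0"
    using IVT'[of "\<lambda>x. \<Sum>k\<le>n. f k * x ^ k" a 0 b] by auto
  with a b show "\<exists>x. a < x \<and> x < b \<and> (\<Sum>k\<le>n. f k * x ^ k) = 0"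
    by (intro exI[of _ x]) (auto simp: less_le)
qed

lemma rc_rolle:
  fixes p :: "'a::real_closed poly"
  assumes "a < b" "poly p a = 0" "poly p b = 0"
  obtains x where "a < x" "x < b" "poly (pderiv p) x = 0"
proof (cases "p = 0")
  case True
  then show ?thesis using dense[OF assms(1)] that by auto
next
  case False
  define R where "R = {x. poly p x = 0 \<and> a < x \<and> x \<le> b}"
  have R: "finite R" "b \<in> R"
    using poly_roots_finite[OF False] assms by (auto simp: R_def intro: finite_subset)
  define c where "c = Min R"
  have c: "a < c" "c \<le> b" "poly p c = 0"
    using Min_in[OF R(1)] R(2) unfolding c_def R_def by auto
  have nr: "poly p x \<noteq> 0" if "a < x" "x < c" for x
  proof
    assume "poly p x = 0"
    with that c have "x \<in> R" by (auto simp: R_def)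
    then show False using Min_le[OF R(1), of x] that unfolding c_def by auto
  qed
  define A where "A = [:-a, 1:]"
  define C where "C = [:-c, 1:]"
  obtain q where q: "p = A ^ order a p * q" "\<not> A dvd q"
    using order_decomp[OF False, of a] unfolding A_def by auto
  have "q \<noteq> 0" using q(2) by auto
  obtain g where g: "q = C ^ order c q * g" "\<not> C dvd g"
    using order_decomp[OF \<open>q \<noteq> 0\<close>, of c] unfolding C_def by auto
  have "order a p \<noteq> 0" using assms(2) False by (simp add: order_root)
  then obtain m where m: "order a p = Suc m" using not0_implies_Suc by blast
  have "poly (A ^ order a p * q) c = 0" using c(3) q(1) by simp
  then have "poly q c = 0" using c(1) by (simp add: A_def)
  then have "order c q \<noteq> 0" using \<open>q \<noteq> 0\<close> by (simp add: order_root)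
  then obtain k where k: "order c q = Suc k" using not0_implies_Suc by blast
  have p: "p = A ^ Suc m * (C ^ Suc k * g)" using q(1) g(1) m k by simp
  have gc: "poly g c \<noteq> 0" using g(2) by (simp add: C_def poly_eq_0_iff_dvd)
  have "poly q a \<noteq> 0" using q(2) by (simp add: A_def poly_eq_0_iff_dvd)
  then have "poly (C ^ order c q * g) a \<noteq> 0" using g(1) by simp
  then have ga: "poly g a \<noteq> 0" by auto
  have gpos: "poly g a * poly g c > 0"
  proof (rule ccontr)
    assume "\<not> ?thesis"
    then have "poly g a * poly g c < 0" using ga gc by (auto simp: not_less le_less)
    then obtain x where "a < x" "x < c" "poly g x = 0" using rc_poly_IVT[OF c(1)] by blast
    then show False using nr[of x] by (simp add: p)
  qed
  define r where "r = smult (of_nat (Suc m)) (C * g) + smult (of_nat (Suc k)) (A * g) + A * C * pderiv g"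
  have pd: "pderiv A = 1" "pderiv C = 1" by (simp_all add: A_def C_def pderiv_pCons)
  have eq: "pderiv p = A ^ m * C ^ k * r"
    unfolding p pderiv_mult pderiv_power_Suc r_def pd by (simp add: algebra_simps)
  have "poly r a * poly r c = - (of_nat (Suc m) * of_nat (Suc k) * (c - a)^2 * (poly g a * poly g c))"
    by (simp add: r_def A_def C_def algebra_simps power2_eq_square)
  also have "\<dots> < 0" using gpos c(1) by (simp del: of_nat_Suc)
  finally obtain x where "a < x" "x < c" "poly r x = 0" using rc_poly_IVT[OF c(1)] by blast
  then show ?thesis using that[of x] c(2) by (simp add: eq)
qed

lemma rc_mvt:
  fixes p :: "'a::real_closed poly"
  assumes "a < b"
  obtains x where "a < x" "x < b" "poly p b - poly p a = (b - a) * poly (pderiv p) x"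
proof -
  define s where "s = (poly p b - poly p a) / (b - a)"
  define q where "q = p - [:poly p a - s * a, s:]"
  have s: "s * (b - a) = poly p b - poly p a" using assms by (simp add: s_def)
  have "poly q a = 0" "poly q b = 0" using s by (auto simp: q_def algebra_simps)
  then obtain x where "a < x" "x < b" "poly (pderiv q) x = 0" using rc_rolle[OF assms] by metis
  then show ?thesis using that[of x] s by (auto simp: q_def pderiv_diff pderiv_pCons algebra_simps)
qed

text \<open>A lower bound \<open>e\<close> instead of mere positivity makes the induction over
  Horner's scheme work: for large \<open>x\<close> the product \<open>x * e\<close> outweighs the
  constant coefficient.\<close>

lemma poly_eventually_ge:
  fixes p :: "'a::linordered_field poly"
  assumes "lead_coeff p > 0"
  shows "\<exists>e>0. \<exists>B. \<forall>x\<ge>B. e \<le> poly p x"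
  using assms
proof (induction p)
  case 0
  then show ?case by simp
next
  case (pCons a p)
  show ?case
  proof (cases "p = 0")
    case True
    then show ?thesis using pCons.prems by auto
  next
    case False
    then obtain e B where e: "e > 0" "\<forall>x\<ge>B. e \<le> poly p x" using pCons by auto
    have "e \<le> poly (pCons a p) x" if x: "x \<ge> max B (max 0 ((e - a) / e))" for x
    proof -
      have "x * e \<le> x * poly p x" using x e by (intro mult_left_mono) auto
      moreover have "e - a \<le> x * e" using x e(1) by (simp add: pos_divide_le_eq)
      ultimately show ?thesis by simp
    qed
    then show ?thesis using e(1) by blast
  qed
qed

lemma poly_eventually_sgn_at_top:
  fixes p :: "'a::linordered_field poly"
  shows "\<exists>B. \<forall>x\<ge>B. sgn (poly p x) = sgn (lead_coeff p)"
proof -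
  consider "p = 0" | "lead_coeff p > 0" | "lead_coeff (- p) > 0"
    by (cases "lead_coeff p" "0::'a" rule: linorder_cases) auto
  then show ?thesis
  proof cases
    case 2
    then show ?thesis using poly_eventually_ge[OF 2] by (metis less_le_trans sgn_pos)
  next
    case 3
    then obtain e B where "e > 0" "\<forall>x\<ge>B. e \<le> poly (- p) x" using poly_eventually_ge by blast
    then have "\<forall>x\<ge>B. poly p x < 0" by (metis less_le_trans neg_0_less_iff_less poly_minus)
    moreover have "lead_coeff p < 0" using 3 by simp
    ultimately show ?thesis by (metis sgn_neg)
  qed auto
qed

lemma poly_eventually_sgn_at_bot:
  fixes p :: "'a::linordered_field poly"
  shows "\<exists>B. \<forall>x\<le>-B. sgn (poly p x) = sgn (lead_coeff p) * (-1) ^ degree p"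
proof -
  obtain B where B: "\<forall>x\<ge>B. sgn (poly (pcompose p [:0, -1:]) x) = sgn (lead_coeff (pcompose p [:0, -1:]))"
    using poly_eventually_sgn_at_top by blast
  have "lead_coeff (pcompose p [:0, -1:]) = lead_coeff p * (-1) ^ degree p"
    by (subst lead_coeff_comp) auto
  moreover have "sgn ((-1::'a) ^ degree p) = (-1) ^ degree p"
    by (cases "even (degree p)") auto
  ultimately have "sgn (poly p x) = sgn (lead_coeff p) * (-1) ^ degree p" if "x \<le> - B" for x
    using B[rule_format, of "- x"] that by (simp add: poly_pcompose sgn_mult)
  then show ?thesis by blast
qed

lemma poly_eventually_sgn:
  fixes P :: "'a::linordered_field poly set"
  assumes "finite P"
  shows "\<exists>B\<ge>C. \<forall>b\<ge>B. \<forall>p\<in>P. sgn (poly p b) = sgn (lead_coeff p)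
    \<and> sgn (poly p (- b)) = sgn (lead_coeff p) * (-1) ^ degree p"
  using assms
proof (induction P)
  case (insert p P)
  then obtain B where B: "B \<ge> C" "\<forall>b\<ge>B. \<forall>p\<in>P. sgn (poly p b) = sgn (lead_coeff p)
    \<and> sgn (poly p (- b)) = sgn (lead_coeff p) * (-1) ^ degree p" by blast
  obtain B1 where B1: "\<forall>x\<ge>B1. sgn (poly p x) = sgn (lead_coeff p)"
    using poly_eventually_sgn_at_top by blast
  obtain B2 where B2: "\<forall>x\<le>-B2. sgn (poly p x) = sgn (lead_coeff p) * (-1) ^ degree p"
    using poly_eventually_sgn_at_bot by blast
  show ?case
    using B B1 B2 by (intro exI[of _ "max B (max B1 B2)"]) auto
qed auto

section \<open>Transfer of sign conditions between real closed fields\<close>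

locale ring_morphism =
  fixes h :: "'a::comm_ring_1 \<Rightarrow> 'b::comm_ring_1"
  assumes one: "h 1 = 1"
    and add: "h (x + y) = h x + h y"
    and mult: "h (x * y) = h x * h y"
begin

lemma zero: "h 0 = 0"
  using add[of 0 0] by simp

lemma uminus: "h (- x) = - h x"
  using add[of x "- x"] by (simp add: zero eq_neg_iff_add_eq_0 add.commute)

lemma diff: "h (x - y) = h x - h y"
  using add[of x "- y"] by (simp add: uminus)

lemma sum: "h (\<Sum>i\<in>A. f i) = (\<Sum>i\<in>A. h (f i))"
  by (induction A rule: infinite_finite_induct) (simp_all add: zero add)

lemma prod: "h (\<Prod>i\<in>A. f i) = (\<Prod>i\<in>A. h (f i))"
  by (induction A rule: infinite_finite_induct) (simp_all add: one mult)

lemma power: "h (x ^ n) = h x ^ n"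
  by (induction n) (simp_all add: one mult)

lemma of_nat: "h (of_nat n) = of_nat n"
  by (induction n) (simp_all add: one add zero)

lemma map_poly: "ring_morphism (map_poly h)"
proof
  show "map_poly h 1 = 1"
    by (simp add: map_poly_1 one)
  show "map_poly h (p + q) = map_poly h p + map_poly h q" for p q
    by (intro poly_eqI) (simp add: coeff_map_poly zero add)
  show "map_poly h (p * q) = map_poly h p * map_poly h q" for p q
    by (intro poly_eqI) (simp add: coeff_map_poly zero mult coeff_mult sum)
qed

lemma map_poly_smult: "map_poly h (smult c p) = smult (h c) (map_poly h p)"
  by (intro poly_eqI) (simp add: coeff_map_poly zero mult)

end

text \<open>The constant \<^const>\<open>pderiv\<close> is restricted to rings without zero divisors.\<close>

definition formal_deriv :: "'a::comm_ring_1 poly \<Rightarrow> 'a poly" where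
  "formal_deriv p = (\<Sum>k<degree p. monom (of_nat (Suc k) * coeff p (Suc k)) k)"

lemma coeff_formal_deriv: "coeff (formal_deriv p) n = of_nat (Suc n) * coeff p (Suc n)"
proof -
  have "coeff (formal_deriv p) n = (\<Sum>k<degree p. if k = n then of_nat (Suc k) * coeff p (Suc k) else 0)"
    by (simp add: formal_deriv_def coeff_sum coeff_monom del: of_nat_Suc)
  also have "\<dots> = of_nat (Suc n) * coeff p (Suc n)"
    by (auto simp: coeff_eq_0 simp del: of_nat_Suc)
  finally show ?thesis .
qed

lemma degree_formal_deriv: "0 < degree p \<Longrightarrow> degree (formal_deriv p) < degree p"
  using degree_le[of "degree p - 1" "formal_deriv p"]
  by (auto simp: coeff_formal_deriv coeff_eq_0 simp del: of_nat_Suc)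

lemma map_poly_formal_deriv:
  fixes h :: "'a::comm_ring_1 \<Rightarrow> 'b::idom"
  assumes "ring_morphism h"
  shows "map_poly h (formal_deriv p) = pderiv (map_poly h p)"
proof -
  interpret ring_morphism h by fact
  show ?thesis
    by (intro poly_eqI)
      (simp add: coeff_map_poly zero mult coeff_pderiv coeff_formal_deriv of_nat del: of_nat_Suc)
qed

text \<open>The values of \<open>sgn\<close> lie in the ring itself, so an equation between them
  could not compare signs in two different rings.\<close>

definition sign_eq :: "'a::linordered_idom \<Rightarrow> 'b::linordered_idom \<Rightarrow> bool" where
  "sign_eq x y \<longleftrightarrow> (x < 0 \<longleftrightarrow> y < 0) \<and> (0 < x \<longleftrightarrow> 0 < y)"

lemma sign_eq_zero: "sign_eq x y \<Longrightarrow> x = 0 \<longleftrightarrow> y = 0"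
  unfolding sign_eq_def by (metis less_irrefl linorder_neqE_linordered_idom)

lemma sign_eq_uminus: "sign_eq (- x) (- y) \<longleftrightarrow> sign_eq x y"
  by (auto simp: sign_eq_def)

lemma sign_eq_mult_pos: "0 < c \<Longrightarrow> 0 < d \<Longrightarrow> sign_eq (c * x) (d * y) \<longleftrightarrow> sign_eq x y"
  by (auto simp: sign_eq_def zero_less_mult_iff mult_less_0_iff)

lemma sign_eq_minus_one_power:
  "sign_eq x y \<Longrightarrow> sign_eq (x * (-1) ^ n) (y * (-1) ^ n)"
  by (cases "even n") (auto simp: sign_eq_def)

lemma sign_eq_sgn: "sgn x = sgn x' \<Longrightarrow> sgn y = sgn y' \<Longrightarrow> sign_eq x' y' \<Longrightarrow> sign_eq x y"
  unfolding sign_eq_def by (metis sgn_greater sgn_less)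

subsection \<open>Closed families of polynomials\<close>

text \<open>The coefficients will be polynomials in the other variables, used only as a commutative
  ring; multiplying by the leading coefficient takes the place of dividing by it. Degrees of
  products are only bounded from above, so the descent comes from inspecting the cancelled
  coefficient.\<close>

lemma pseudo_division:
  fixes p q :: "'a::comm_ring_1 poly"
  assumes "0 < degree q"
  shows "\<exists>k u r. smult (lead_coeff q ^ k) p = q * u + r \<and> degree r < degree q"
proof (induction "degree p" arbitrary: p rule: less_induct)
  case less
  show ?case
  proof (cases "degree p < degree q")
    case True
    then show ?thesis by (intro exI[of _ 0] exI[of _ p]) simp
  next
    case False
    define m where "m = monom (lead_coeff p) (degree p - degree q)"
    define p1 where "p1 = smult (lead_coeff q) p - m * q"
    have "degree (m * q) \<le> degree p"
      using degree_mult_le[of m q] degree_monom_le[of "lead_coeff p" "degree p - degree q"] False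
      unfolding m_def by linarith
    then have le: "degree p1 \<le> degree p"
      unfolding p1_def by (intro degree_diff_le) (auto intro: order_trans[OF degree_smult_le])
    have "coeff p1 (degree p) = 0"
      using False by (simp add: p1_def m_def coeff_monom_mult)
    then have "degree p1 < degree p"
      using le assms False by (metis degree_0 le_neq_implies_less leading_coeff_0_iff linorder_not_less order.strict_trans2)
    then obtain k u r where r: "smult (lead_coeff q ^ k) p1 = q * u + r" "degree r < degree q"
      using less by blast
    have "smult (lead_coeff q ^ Suc k) p = q * (u + smult (lead_coeff q ^ k) m) + r"
      using r(1) by (simp add: p1_def smult_diff_right algebra_simps)
    then show ?thesis using r(2) by blast
  qed
qed

definition is_prem :: "'a::comm_ring_1 poly \<Rightarrow> 'a poly \<Rightarrow> 'a poly \<Rightarrow> bool" where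
  "is_prem p q r \<longleftrightarrow> (\<exists>k u. smult (lead_coeff q ^ (2 * k)) p = q * u + r) \<and> degree r < degree q"

definition prem :: "'a::comm_ring_1 poly \<Rightarrow> 'a poly \<Rightarrow> 'a poly" where
  "prem p q = (SOME r. is_prem p q r)"

text \<open>The exponent is even, so that the scaling factor preserves signs.\<close>

lemma is_prem_prem:
  assumes "0 < degree q"
  shows "is_prem p q (prem p q)"
proof -
  obtain k u r where r: "smult (lead_coeff q ^ k) p = q * u + r" "degree r < degree q"
    using pseudo_division[OF assms] by blast
  let ?c = "lead_coeff q ^ k"
  have "smult (lead_coeff q ^ (2 * k)) p = smult ?c (smult ?c p)"
    by (simp add: power_add mult_2)
  also have "\<dots> = q * smult ?c u + smult ?c r"
    unfolding r(1) by (simp add: smult_add_right)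
  finally have "is_prem p q (smult ?c r)"
    using r(2) degree_smult_le[of ?c r] unfolding is_prem_def by (meson le_less_trans)
  then show ?thesis unfolding prem_def by (rule someI)
qed

text \<open>Where a morphism kills the leading coefficient, \<open>p\<close> and
  \<open>drop_lead p\<close> have the same image. This covers the specialisations under which the
  degree falls.\<close>

definition drop_lead :: "'a::comm_ring_1 poly \<Rightarrow> 'a poly" where
  "drop_lead p = p - monom (lead_coeff p) (degree p)"

lemma degree_drop_lead: "0 < degree p \<Longrightarrow> degree (drop_lead p) < degree p"
proof -
  assume p: "0 < degree p"
  have le: "degree (drop_lead p) \<le> degree p"
    unfolding drop_lead_def by (intro degree_diff_le) (auto simp: degree_monom_le)
  have "coeff (drop_lead p) (degree p) = 0" by (simp add: drop_lead_def)
  then show ?thesis using le p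
    by (metis degree_0 le_neq_implies_less leading_coeff_0_iff)
qed

text \<open>The rules fix an order of treatment. When \<open>p\<close> is inserted, three things are
  at hand: its derivative, for monotonicity between matched points; its pseudo-remainders by earlier
  polynomials, for its signs at their zeros; and its truncation, for a vanishing leading
  coefficient.\<close>

inductive sign_closed :: "'a::comm_ring_1 poly set \<Rightarrow> bool" where
  empty: "sign_closed {}"
| const: "sign_closed Q \<Longrightarrow> degree p = 0 \<Longrightarrow> sign_closed (insert p Q)"
| insert: "sign_closed Q \<Longrightarrow> 0 < degree p \<Longrightarrow> formal_deriv p \<in> Q \<Longrightarrow> drop_lead p \<in> Q \<Longrightarrow>
    (\<And>q. q \<in> Q \<Longrightarrow> 0 < degree q \<Longrightarrow> prem p q \<in> Q) \<Longrightarrow> sign_closed (insert p Q)"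

lemma sign_closed_drop_lead:
  "sign_closed Q \<Longrightarrow> q \<in> Q \<Longrightarrow> 0 < degree q \<Longrightarrow> drop_lead q \<in> Q"
  by (induction rule: sign_closed.induct) auto

text \<open>The degrees are treated from the top downwards: remainders by polynomials of degree \<open>d\<close>
  have degree less than \<open>d\<close>. The set \<open>D\<close> collects the polynomials treated before.\<close>

lemma sign_closed_superset_aux:
  fixes P D :: "'a::comm_ring_1 poly set"
  assumes "finite P" "finite D" "\<And>p. p \<in> P \<Longrightarrow> degree p < d"
  shows "\<exists>G. finite G \<and> P \<subseteq> G \<and> sign_closed G \<and> (\<forall>p\<in>G. degree p < d)
    \<and> (\<forall>p\<in>D. \<forall>q\<in>G. 0 < degree q \<longrightarrow> prem p q \<in> G)"
  using assms
proof (induction d arbitrary: P D)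
  case 0
  then show ?case by (intro exI[of _ "{}"]) (auto intro: sign_closed.empty)
next
  case (Suc d)
  show ?case
  proof (cases "d = 0")
    case True
    have "sign_closed P" using Suc.prems(1,3)
      by (induction P rule: finite_induct) (auto intro!: sign_closed.empty sign_closed.const simp: True)
    then show ?thesis using Suc.prems True by (intro exI[of _ P]) auto
  next
    case False
    define Pd where "Pd = {p \<in> P. degree p = d}"
    \<comment> \<open>Whatever the polynomials of degree \<open>d\<close> demand in smaller degree
      is handed to the induction hypothesis. Adding \<open>Pd\<close> to \<open>D\<close> makes it
      supply their remainders by the lower polynomials as well.\<close>
    define P' where "P' = {p \<in> P. degree p < d} \<union> formal_deriv ` Pd \<union> drop_lead ` Pd
      \<union> (\<lambda>(p, q). prem p q) ` ((D \<union> Pd) \<times> Pd)"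
    have Pd: "finite Pd" "\<And>p. p \<in> Pd \<Longrightarrow> degree p = d"
      using Suc.prems(1) by (auto simp: Pd_def)
    have fin: "finite P'" "finite (D \<union> Pd)"
      using Suc.prems Pd by (auto simp: P'_def)
    have prem_deg: "degree (prem p q) < d" if "q \<in> Pd" for p q
      using is_prem_prem[of q p] Pd(2)[OF that] False by (auto simp: is_prem_def)
    have pd_deg: "degree (formal_deriv p) < d" if "p \<in> Pd" for p
      using degree_formal_deriv[of p] Pd(2)[OF that] False by auto
    have dl_deg: "degree (drop_lead p) < d" if "p \<in> Pd" for p
      using degree_drop_lead[of p] Pd(2)[OF that] False by auto
    have "degree p < d" if "p \<in> P'" for p
      using that unfolding P'_def by (elim UnE imageE) (auto simp: prem_deg pd_deg dl_deg)
    from Suc.IH[OF fin this] obtain G where G: "finite G" "P' \<subseteq> G" "sign_closed G"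
        "\<And>p. p \<in> G \<Longrightarrow> degree p < d"
        "\<And>p q. p \<in> D \<union> Pd \<Longrightarrow> q \<in> G \<Longrightarrow> 0 < degree q \<Longrightarrow> prem p q \<in> G"
      by auto
    have inG: "formal_deriv p \<in> G" "drop_lead p \<in> G" if "p \<in> Pd" for p
      using that G(2) by (auto simp: P'_def)
    have premG: "prem p q \<in> G" if "p \<in> D \<union> Pd" "q \<in> Pd" for p q
      using that G(2) unfolding P'_def by blast
    \<comment> \<open>The polynomials of degree \<open>d\<close> may be inserted in any order,
      because their remainders by one another already lie in \<open>G\<close>.\<close>
    have "sign_closed (G \<union> S)" if "finite S" "S \<subseteq> Pd" for S
      using that
    proof (induction S rule: finite_induct)
      case empty
      then show ?case using G(3) by simp
    next
      case (insert p S)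
      then have p: "p \<in> Pd" and IH: "sign_closed (G \<union> S)" by auto
      have "sign_closed (insert p (G \<union> S))"
        using IH
      proof (rule sign_closed.insert)
        show "0 < degree p" using Pd(2)[OF p] False by simp
        show "formal_deriv p \<in> G \<union> S" "drop_lead p \<in> G \<union> S" using inG[OF p] by auto
        show "prem p q \<in> G \<union> S" if "q \<in> G \<union> S" "0 < degree q" for q
          using that p insert.prems G(5)[of p q] premG[of p q] by auto
      qed
      then show ?case by simp
    qed
    then have "sign_closed (G \<union> Pd)" using Pd(1) by blast
    moreover have "P \<subseteq> G \<union> Pd"
    proof
      fix p assume "p \<in> P"
      then show "p \<in> G \<union> Pd" using Suc.prems(3)[of p] G(2) by (auto simp: Pd_def P'_def less_Suc_eq)
    qed
    moreover have "\<forall>p\<in>G \<union> Pd. degree p < Suc d" using G(4) Pd(2) by (auto simp: less_Suc_eq)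
    moreover have "\<forall>p\<in>D. \<forall>q\<in>G \<union> Pd. 0 < degree q \<longrightarrow> prem p q \<in> G \<union> Pd"
      using G(5) premG by auto
    ultimately show ?thesis using G(1) Pd(1) by (intro exI[of _ "G \<union> Pd"]) auto
  qed
qed

lemma sign_closed_superset:
  fixes P :: "'a::comm_ring_1 poly set"
  assumes "finite P"
  obtains G where "finite G" "P \<subseteq> G" "sign_closed G"
proof -
  have "degree p < Suc (Max (degree ` P))" if "p \<in> P" for p
    using that assms by (simp add: less_Suc_eq_le)
  then show ?thesis
    using sign_closed_superset_aux[OF assms finite.emptyI] that by metis
qed

subsection \<open>Matchings of cell decompositions\<close>

lemma rc_strict_mono:
  fixes p :: "'a::real_closed poly"
  assumes "\<And>z. a < z \<Longrightarrow> z < c \<Longrightarrow> 0 < poly (pderiv p) z" "a \<le> x" "x < y" "y \<le> c"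
  shows "poly p x < poly p y"
proof -
  obtain z where "x < z" "z < y" "poly p y - poly p x = (y - x) * poly (pderiv p) z"
    using rc_mvt[OF assms(3)] by metis
  moreover from this have "0 < poly (pderiv p) z" using assms by (meson le_less_trans less_le_trans)
  ultimately show ?thesis using assms(3) by (metis diff_gt_0_iff_gt zero_less_mult_iff)
qed

text \<open>A finite order isomorphism between points of two lines. It cuts both lines into matched
  cells, namely points and open intervals; \<open>same_position\<close> relates points of
  corresponding cells, and a \<open>gap\<close> is a bounded open cell.\<close>

definition order_matching :: "('a::linorder \<times> 'b::linorder) set \<Rightarrow> bool" where
  "order_matching H \<longleftrightarrow> finite H \<and> (\<forall>(a, b)\<in>H. \<forall>(c, d)\<in>H. (a < c \<longleftrightarrow> b < d))"

definition same_position :: "('a::linorder \<times> 'b::linorder) set \<Rightarrow> 'a \<Rightarrow> 'b \<Rightarrow> bool" where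
  "same_position H y z \<longleftrightarrow> (\<forall>(a, b)\<in>H. (y < a \<longleftrightarrow> z < b) \<and> (a < y \<longleftrightarrow> b < z))"

definition gap :: "('a::linorder \<times> 'b::linorder) set \<Rightarrow> 'a \<Rightarrow> 'b \<Rightarrow> 'a \<Rightarrow> 'b \<Rightarrow> bool" where
  "gap H a b c d \<longleftrightarrow> (a, b) \<in> H \<and> (c, d) \<in> H \<and> a < c \<and> (\<forall>(e, f)\<in>H. e \<le> a \<or> c \<le> e)"

lemma order_matchingD:
  assumes "order_matching H" "(a, b) \<in> H" "(c, d) \<in> H"
  shows "a < c \<longleftrightarrow> b < d" "a \<le> c \<longleftrightarrow> b \<le> d" "a = c \<longleftrightarrow> b = d"
proof -
  have 1: "a < c \<longleftrightarrow> b < d" and 2: "c < a \<longleftrightarrow> d < b"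
    using assms unfolding order_matching_def by fast+
  show "a < c \<longleftrightarrow> b < d" by (fact 1)
  show "a \<le> c \<longleftrightarrow> b \<le> d" using 2 by (metis not_less)
  show "a = c \<longleftrightarrow> b = d" using 1 2 by (metis less_irrefl linorder_less_linear)
qed

lemma same_positionD:
  assumes "same_position H y z" "(a, b) \<in> H"
  shows "y < a \<longleftrightarrow> z < b" "a < y \<longleftrightarrow> b < z" "y \<le> a \<longleftrightarrow> z \<le> b" "a \<le> y \<longleftrightarrow> b \<le> z" "y = a \<longleftrightarrow> z = b"
proof -
  have 1: "y < a \<longleftrightarrow> z < b" and 2: "a < y \<longleftrightarrow> b < z"
    using assms unfolding same_position_def by fast+
  show "y < a \<longleftrightarrow> z < b" "a < y \<longleftrightarrow> b < z" by (fact 1, fact 2)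
  show "y \<le> a \<longleftrightarrow> z \<le> b" "a \<le> y \<longleftrightarrow> b \<le> z" using 1 2 by (metis not_less)+
  show "y = a \<longleftrightarrow> z = b" using 1 2 by (metis less_irrefl linorder_less_linear)
qed

lemma same_position_self: "order_matching H \<Longrightarrow> (a, b) \<in> H \<Longrightarrow> same_position H a b"
  unfolding same_position_def using order_matchingD(1) by fast

lemma same_position_gap:
  fixes H :: "('a::linorder \<times> 'b::linorder) set"
  assumes H: "order_matching H" and g: "gap H a b c d" and y: "a < y" "y < c"
  shows "same_position H y z \<longleftrightarrow> b < z \<and> z < d"
proof
  assume "same_position H y z"
  then show "b < z \<and> z < d" using g y same_positionD(1,2)[of H y z] unfolding gap_def by blast
next
  assume z: "b < z \<and> z < d"
  have "(y < e \<longleftrightarrow> z < f) \<and> (e < y \<longleftrightarrow> f < z)" if ef: "(e, f) \<in> H" for e f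
  proof -
    from ef g consider "e \<le> a" | "c \<le> e" unfolding gap_def by fast
    then show ?thesis
    proof cases
      case 1
      moreover have "f \<le> b" using order_matchingD(2)[OF H ef, of a b] 1 g unfolding gap_def by blast
      ultimately show ?thesis using y z by fastforce
    next
      case 2
      moreover have "d \<le> f" using order_matchingD(2)[OF H _ ef, of c d] 2 g unfolding gap_def by blast
      ultimately show ?thesis using y z by fastforce
    qed
  qed
  then show "same_position H y z" unfolding same_position_def by blast
qed

lemma gap_exists:
  assumes H: "order_matching H" "(l, l') \<in> H" "(u, u') \<in> H" and y: "l < y" "y < u" "y \<notin> fst ` H"
  obtains a b c d where "gap H a b c d" "a < y" "y < c"
proof -
  define A where "A = {x \<in> fst ` H. x < y}"
  define C where "C = {x \<in> fst ` H. y < x}"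
  have fin: "finite A" "finite C" using H(1) by (auto simp: A_def C_def order_matching_def)
  have "l \<in> A" "u \<in> C" using H y by (force simp: A_def C_def)+
  then have in': "Max A \<in> A" "Min C \<in> C" using fin by (metis Max_in Min_in empty_iff)+
  then obtain b d where bd: "(Max A, b) \<in> H" "(Min C, d) \<in> H" "Max A < y" "y < Min C"
    by (auto simp: A_def C_def)
  have "e \<le> Max A \<or> Min C \<le> e" if ef: "(e, f) \<in> H" for e f
  proof -
    have "e \<in> A \<or> e \<in> C" using ef y(3) unfolding A_def C_def by force
    then show ?thesis using fin by auto
  qed
  then have "gap H (Max A) b (Min C) d"
    using bd unfolding gap_def by auto
  then show ?thesis using that bd by blast
qed

text \<open>Both polynomials increase strictly on the closed cells. Hence the signs at the two ends
  decide whether there is a zero inside, and such a zero is unique and separates negative from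
  positive values.\<close>

lemma pos_gap:
  fixes p :: "'a::real_closed poly" and q :: "'b::real_closed poly"
  assumes p: "\<And>z. a < z \<Longrightarrow> z < c \<Longrightarrow> 0 < poly (pderiv p) z"
    and q: "\<And>z. b < z \<Longrightarrow> z < d \<Longrightarrow> 0 < poly (pderiv q) z"
    and ac: "a < c" "b < d"
    and sgn: "sign_eq (poly p a) (poly q b)" "sign_eq (poly p c) (poly q d)"
  shows "\<And>w. a < w \<Longrightarrow> w < c \<Longrightarrow> poly p w = 0 \<Longrightarrow> \<exists>w'. b < w' \<and> w' < d \<and> poly q w' = 0"
    and "\<And>y z w w'. \<lbrakk>a < y; y < c; a < w; w < c; b < z; z < d; b < w'; w' < d;
      poly p w = 0; poly q w' = 0; y < w \<longleftrightarrow> z < w'; w < y \<longleftrightarrow> w' < z\<rbrakk> \<Longrightarrow> sign_eq (poly p y) (poly q z)"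
    and "\<And>y z. \<lbrakk>a < y; y < c; b < z; z < d; \<nexists>w. a < w \<and> w < c \<and> poly p w = 0\<rbrakk>
      \<Longrightarrow> sign_eq (poly p y) (poly q z)"
    and "\<And>w w'. \<lbrakk>a < w; w < c; a < w'; w' < c; poly p w = 0; poly p w' = 0\<rbrakk> \<Longrightarrow> w = w'"
proof -
  note mp = rc_strict_mono[of a c p, OF p]
  note mq = rc_strict_mono[of b d q, OF q]
  show "\<exists>w'. b < w' \<and> w' < d \<and> poly q w' = 0" if w: "a < w" "w < c" "poly p w = 0" for w
  proof -
    have "poly p a < 0" "0 < poly p c" using mp[of a w] mp[of w c] w by auto
    then have "poly q b * poly q d < 0" using sgn by (simp add: sign_eq_def mult_less_0_iff)
    then show ?thesis using rc_poly_IVT[OF ac(2)] by metis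
  qed
  show "sign_eq (poly p y) (poly q z)"
    if as: "a < y" "y < c" "a < w" "w < c" "b < z" "z < d" "b < w'" "w' < d"
      "poly p w = 0" "poly q w' = 0" "y < w \<longleftrightarrow> z < w'" "w < y \<longleftrightarrow> w' < z" for y z w w'
  proof (cases y w rule: linorder_cases)
    case less
    then show ?thesis using mp[of y w] mq[of z w'] as by (simp add: sign_eq_def)
  next
    case equal
    then have "\<not> z < w'" "\<not> w' < z" using as(11,12) by auto
    then have "z = w'" by simp
    then show ?thesis using equal as by (simp add: sign_eq_def)
  next
    case greater
    then show ?thesis using mp[of w y] mq[of w' z] as by (simp add: sign_eq_def)
  qed
  show "sign_eq (poly p y) (poly q z)"
    if as: "a < y" "y < c" "b < z" "z < d" "\<nexists>w. a < w \<and> w < c \<and> poly p w = 0" for y z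
  \<comment> \<open>Without a zero inside, a nonnegative value at \<open>a\<close> makes
    \<open>p\<close> positive in the cell; otherwise \<open>p\<close> is still nonpositive at
    \<open>c\<close> and thus negative inside.\<close>
  proof (cases "0 \<le> poly p a")
    case True
    then have "0 \<le> poly q b" using sgn by (metis sign_eq_def not_less)
    then show ?thesis using True mp[of a y] mq[of b z] as by (simp add: sign_eq_def)
  next
    case False
    then have "\<not> 0 < poly p c"
      using rc_poly_IVT[OF ac(1), of p] as(5) by (metis mult_neg_pos not_le)
    then have "poly p c \<le> 0" "poly q d \<le> 0" using sgn by (auto simp: sign_eq_def not_less)
    then show ?thesis using mp[of y c] mq[of z d] as by (simp add: sign_eq_def)
  qed
  show "w = w'" if "a < w" "w < c" "a < w'" "w' < c" "poly p w = 0" "poly p w' = 0" for w w'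
    using mp[of w w'] mp[of w' w] that by (metis less_imp_le less_irrefl linorder_less_linear)
qed

definition matches :: "('a::linordered_field \<times> 'b::linordered_field) set \<Rightarrow> 'a \<Rightarrow> 'a \<Rightarrow> 'b \<Rightarrow> 'b
    \<Rightarrow> 'a poly \<Rightarrow> 'b poly \<Rightarrow> bool" where
  "matches H l u l' u' p q \<longleftrightarrow> (\<forall>y z. l \<le> y \<longrightarrow> y \<le> u \<longrightarrow> l' \<le> z \<longrightarrow> z \<le> u' \<longrightarrow> same_position H y z
     \<longrightarrow> sign_eq (poly p y) (poly q z))"

lemma matchesD:
  "matches H l u l' u' p q \<Longrightarrow> l \<le> y \<Longrightarrow> y \<le> u \<Longrightarrow> l' \<le> z \<Longrightarrow> z \<le> u' \<Longrightarrow> same_position H y z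
    \<Longrightarrow> sign_eq (poly p y) (poly q z)"
  unfolding matches_def by blast

lemma matches_mono: "matches H l u l' u' p q \<Longrightarrow> H \<subseteq> H' \<Longrightarrow> matches H' l u l' u' p q"
  unfolding matches_def same_position_def by blast

lemma poly_nonzero_between:
  fixes p :: "'a::linordered_field poly"
  assumes "p \<noteq> 0" "a < c"
  obtains x where "a < x" "x < c" "poly p x \<noteq> 0"
proof -
  have "\<not> {a<..<c} \<subseteq> {x. poly p x = 0}"
    using poly_roots_finite[OF assms(1)] infinite_Ioo[OF assms(2)] finite_subset by blast
  then obtain x where "x \<in> {a<..<c}" "poly p x \<noteq> 0" by blast
  then show ?thesis using that by auto
qed

text \<open>The derivative has constant sign on a gap, so up to a common change of sign we are in the
  situation of \<open>pos_gap\<close>.\<close>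

lemma gap_cases:
  fixes p :: "'a::real_closed poly" and q :: "'b::real_closed poly"
  assumes H: "order_matching H" and g: "gap H a b c d" and bounds: "l \<le> a" "c \<le> u" "l' \<le> b" "d \<le> u'"
    and nz: "pderiv p \<noteq> 0" "pderiv q \<noteq> 0"
    and m: "matches H l u l' u' (pderiv p) (pderiv q)"
  shows "(\<forall>z. a < z \<and> z < c \<longrightarrow> 0 < poly (pderiv p) z) \<and> (\<forall>z. b < z \<and> z < d \<longrightarrow> 0 < poly (pderiv q) z)
    \<or> (\<forall>z. a < z \<and> z < c \<longrightarrow> 0 < poly (pderiv (- p)) z) \<and> (\<forall>z. b < z \<and> z < d \<longrightarrow> 0 < poly (pderiv (- q)) z)"
proof -
  have ac: "a < c" "b < d" using g order_matchingD(1)[OF H, of a b c d] by (auto simp: gap_def)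
  have eq: "sign_eq (poly (pderiv p) y) (poly (pderiv q) z)"
    if "a < y" "y < c" "b < z" "z < d" for y z
    using matchesD[OF m, of y z] same_position_gap[OF H g that(1,2)] that bounds by auto
  \<comment> \<open>All points of a gap share one position, so a single point with nonzero
    derivative decides the sign on both intervals.\<close>
  obtain y where y: "a < y" "y < c" "poly (pderiv p) y \<noteq> 0"
    using poly_nonzero_between[OF nz(1) ac(1)] .
  obtain z where z: "b < z" "z < d" using dense[OF ac(2)] by blast
  from y(3) consider "0 < poly (pderiv p) y" | "poly (pderiv p) y < 0" by force
  then show ?thesis
  proof cases
    case 1
    have "0 < poly (pderiv p) x" if "a < x" "x < c" for x
      using eq[OF y(1,2) z] eq[OF that z] 1 by (simp add: sign_eq_def)
    moreover have "0 < poly (pderiv q) x" if "b < x" "x < d" for x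
      using eq[OF y(1,2) that] 1 by (simp add: sign_eq_def)
    ultimately show ?thesis by blast
  next
    case 2
    have "0 < poly (pderiv (- p)) x" if "a < x" "x < c" for x
      using eq[OF y(1,2) z] eq[OF that z] 2 by (simp add: pderiv_minus sign_eq_def)
    moreover have "0 < poly (pderiv (- q)) x" if "b < x" "x < d" for x
      using eq[OF y(1,2) that] 2 by (simp add: pderiv_minus sign_eq_def)
    ultimately show ?thesis by blast
  qed
qed

lemma gap_signs:
  fixes p :: "'a::real_closed poly" and q :: "'b::real_closed poly"
  assumes H: "order_matching H" and g: "gap H a b c d" and bounds: "l \<le> a" "c \<le> u" "l' \<le> b" "d \<le> u'"
    and nz: "pderiv p \<noteq> 0" "pderiv q \<noteq> 0"
    and m: "matches H l u l' u' (pderiv p) (pderiv q)"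
    and ends: "\<And>a b. (a, b) \<in> H \<Longrightarrow> sign_eq (poly p a) (poly q b)"
  shows "\<And>w. a < w \<Longrightarrow> w < c \<Longrightarrow> poly p w = 0 \<Longrightarrow> \<exists>w'. b < w' \<and> w' < d \<and> poly q w' = 0"
    and "\<And>y z w w'. \<lbrakk>a < y; y < c; a < w; w < c; b < z; z < d; b < w'; w' < d;
      poly p w = 0; poly q w' = 0; y < w \<longleftrightarrow> z < w'; w < y \<longleftrightarrow> w' < z\<rbrakk> \<Longrightarrow> sign_eq (poly p y) (poly q z)"
    and "\<And>y z. \<lbrakk>a < y; y < c; b < z; z < d; \<nexists>w. a < w \<and> w < c \<and> poly p w = 0\<rbrakk>
      \<Longrightarrow> sign_eq (poly p y) (poly q z)"
    and "\<And>w w'. \<lbrakk>a < w; w < c; a < w'; w' < c; poly p w = 0; poly p w' = 0\<rbrakk> \<Longrightarrow> w = w'"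
    and "\<And>w w'. \<lbrakk>b < w; w < d; b < w'; w' < d; poly q w = 0; poly q w' = 0\<rbrakk> \<Longrightarrow> w = w'"
proof -
  have ac: "a < c" "b < d" using g order_matchingD(1)[OF H, of a b c d] by (auto simp: gap_def)
  have sgn: "sign_eq (poly p a) (poly q b)" "sign_eq (poly p c) (poly q d)"
    using g ends by (auto simp: gap_def)
  have sgn': "sign_eq (poly q b) (poly p a)" "sign_eq (poly q d) (poly p c)"
    using sgn by (auto simp: sign_eq_def)
  consider (pos) "\<And>z. a < z \<Longrightarrow> z < c \<Longrightarrow> 0 < poly (pderiv p) z"
      "\<And>z. b < z \<Longrightarrow> z < d \<Longrightarrow> 0 < poly (pderiv q) z"
    | (neg) "\<And>z. a < z \<Longrightarrow> z < c \<Longrightarrow> 0 < poly (pderiv (- p)) z"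
      "\<And>z. b < z \<Longrightarrow> z < d \<Longrightarrow> 0 < poly (pderiv (- q)) z"
    using gap_cases[OF H g bounds nz m] by blast
  note cases = this
  have neg_sgn: "sign_eq (poly (- p) a) (poly (- q) b)" "sign_eq (poly (- p) c) (poly (- q) d)"
    "sign_eq (poly (- q) b) (poly (- p) a)" "sign_eq (poly (- q) d) (poly (- p) c)"
    using sgn sgn' by (simp_all add: sign_eq_uminus)
  note P = pos_gap[OF _ _ ac sgn]
  note N = pos_gap[of a c "- p" b d "- q", OF _ _ ac neg_sgn(1,2)]
  \<comment> \<open>Uniqueness of the zero on the second line is uniqueness on the first with the
    two lines exchanged.\<close>
  note P' = pos_gap(4)[OF _ _ ac(2,1) sgn']
  note N' = pos_gap(4)[of b d "- q" a c "- p", OF _ _ ac(2,1) neg_sgn(3,4)]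
  show "\<exists>w'. b < w' \<and> w' < d \<and> poly q w' = 0" if w: "a < w" "w < c" "poly p w = 0" for w
    using cases
  proof cases
    case pos
    then show ?thesis using P(1)[OF pos w] by blast
  next
    case neg
    then show ?thesis using N(1)[OF neg w(1,2)] w(3) by simp
  qed
  show "sign_eq (poly p y) (poly q z)"
    if as: "a < y" "y < c" "a < w" "w < c" "b < z" "z < d" "b < w'" "w' < d"
      "poly p w = 0" "poly q w' = 0" "y < w \<longleftrightarrow> z < w'" "w < y \<longleftrightarrow> w' < z" for y z w w'
    using cases
  proof cases
    case pos
    then show ?thesis using P(2)[OF pos as] by blast
  next
    case neg
    have "sign_eq (poly (- p) y) (poly (- q) z)"
      using N(2)[OF neg as(1-8) _ _ as(11,12)] as(9,10) by simp
    then show ?thesis by (simp add: sign_eq_uminus)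
  qed
  show "sign_eq (poly p y) (poly q z)"
    if as: "a < y" "y < c" "b < z" "z < d" "\<nexists>w. a < w \<and> w < c \<and> poly p w = 0" for y z
    using cases
  proof cases
    case pos
    then show ?thesis using P(3)[OF pos as] by blast
  next
    case neg
    have "sign_eq (poly (- p) y) (poly (- q) z)"
      using N(3)[OF neg as(1-4)] as(5) by simp
    then show ?thesis by (simp add: sign_eq_uminus)
  qed
  show "w = w'" if as: "a < w" "w < c" "a < w'" "w' < c" "poly p w = 0" "poly p w' = 0" for w w'
    using cases
  proof cases
    case pos
    then show ?thesis using P(4)[OF pos as] by blast
  next
    case neg
    then show ?thesis using N(4)[OF neg as(1-4)] as(5,6) by simp
  qed
  show "w = w'" if as: "b < w" "w < d" "b < w'" "w' < d" "poly q w = 0" "poly q w' = 0" for w w'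
    using cases
  proof cases
    case pos
    then show ?thesis using P'[OF pos(2,1) as] by blast
  next
    case neg
    then show ?thesis using N'[OF neg(2,1) as(1-4)] as(5,6) by simp
  qed
qed

text \<open>On a gap both derivatives have the same constant sign, so each line has at most one zero
  there, and both lines have one or neither has. The zeros can therefore be paired, and on the
  refined cells the signs of \<open>p\<close> and \<open>q\<close> agree.\<close>

lemma matching_insert:
  fixes p :: "'a::real_closed poly" and q :: "'b::real_closed poly"
  assumes H: "order_matching H" "(l, l') \<in> H" "(u, u') \<in> H"
    and bounds: "\<And>a b. (a, b) \<in> H \<Longrightarrow> l \<le> a \<and> a \<le> u"
    and nz: "pderiv p \<noteq> 0" "pderiv q \<noteq> 0"
    and m: "matches H l u l' u' (pderiv p) (pderiv q)"
    and ends: "\<And>a b. (a, b) \<in> H \<Longrightarrow> sign_eq (poly p a) (poly q b)"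
  shows "\<exists>H'. H \<subseteq> H' \<and> order_matching H' \<and> (\<forall>(a, b)\<in>H' - H. l \<le> a \<and> a \<le> u \<and> poly p a = 0)
    \<and> matches H' l u l' u' p q"
proof -
  \<comment> \<open>At a point of \<open>H\<close> the condition \<open>same_position\<close> forces
    its partner in \<open>H\<close>, so new pairs arise only inside gaps.\<close>
  define W where "W = {(w, w'). l \<le> w \<and> w \<le> u \<and> l' \<le> w' \<and> w' \<le> u' \<and> same_position H w w'
    \<and> poly p w = 0 \<and> poly q w' = 0}"
  have bounds': "l' \<le> b \<and> b \<le> u'" if "(a, b) \<in> H" for a b
    using bounds[OF that] order_matchingD(2)[OF H(1)] H that by blast
  note G = gap_signs[OF H(1) _ _ _ _ _ nz m ends]
  have gb: "l \<le> a" "c \<le> u" "l' \<le> b" "d \<le> u'" if "gap H a b c d" for a b c d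
    using that bounds bounds' unfolding gap_def by blast+
  have no_gap: "y \<in> fst ` H \<or> (\<exists>a b c d. gap H a b c d \<and> a < y \<and> y < c)" if "l \<le> y" "y \<le> u" for y
  proof (rule disjCI)
    assume ng: "\<nexists>a b c d. gap H a b c d \<and> a < y \<and> y < c"
    show "y \<in> fst ` H"
    proof (rule ccontr)
      assume y: "y \<notin> fst ` H"
      then have "y \<noteq> l" "y \<noteq> u" using H by force+
      then have "l < y" "y < u" using that by auto
      then show False using gap_exists[OF H _ _ y] ng by blast
    qed
  qed
  have "W \<subseteq> {x. poly p x = 0} \<times> {x. poly q x = 0}" by (auto simp: W_def)
  moreover have "p \<noteq> 0" "q \<noteq> 0" using nz by auto
  ultimately have finW: "finite W"
    using poly_roots_finite[of p] poly_roots_finite[of q]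
    by (auto intro: finite_subset[OF _ finite_cartesian_product])
  \<comment> \<open>Either a matched point lies between \<open>w\<close> and \<open>v\<close>, and
    its partner between \<open>w'\<close> and \<open>v'\<close>, or both zeros are in one gap, which
    holds only one zero of \<open>p\<close>.\<close>
  have cmp: "w' < v'" if w: "(w, w') \<in> W" and v: "(v, v') \<in> W" and wv: "w < v" for w w' v v'
  proof (cases "\<exists>(e, f)\<in>H. w \<le> e \<and> e \<le> v")
    case True
    then obtain e f where ef: "(e, f) \<in> H" "w \<le> e" "e \<le> v" by auto
    have sp: "same_position H w w'" "same_position H v v'" using w v by (auto simp: W_def)
    have "w' \<le> f" "f \<le> v'"
      using same_positionD(3)[OF sp(1) ef(1)] same_positionD(4)[OF sp(2) ef(1)] ef by auto
    moreover have "w' \<noteq> f \<or> v' \<noteq> f"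
      using same_positionD(5)[OF sp(1) ef(1)] same_positionD(5)[OF sp(2) ef(1)] wv by auto
    ultimately show ?thesis by auto
  next
    case False
    then have "w \<notin> fst ` H" using wv by force
    moreover have "l \<le> w" "w \<le> u" using w by (auto simp: W_def)
    ultimately obtain a b c d where g: "gap H a b c d" "a < w" "w < c"
      using no_gap by blast
    have "v < c" using False g(1,3) by (force simp: gap_def)
    then have "w = v" using G(4)[OF g(1) gb[OF g(1)], of w v] g w v wv by (auto simp: W_def)
    then show ?thesis using wv by simp
  qed
  have cmp_eq: "w' = v'" if w: "(w, w') \<in> W" and v: "(w, v') \<in> W" for w w' v'
  proof -
    have sp: "same_position H w w'" "same_position H w v'" using w v by (auto simp: W_def)
    show ?thesis
    proof (cases "w \<in> fst ` H")
      case True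
      then obtain b where "(w, b) \<in> H" by auto
      then show ?thesis using same_positionD(5)[OF sp(1)] same_positionD(5)[OF sp(2)] by metis
    next
      case False
      moreover have "l \<le> w" "w \<le> u" using w by (auto simp: W_def)
      ultimately obtain a b c d where g: "gap H a b c d" "a < w" "w < c"
        using no_gap by blast
      have "b < w'" "w' < d" "b < v'" "v' < d"
        using same_position_gap[OF H(1) g] sp by auto
      then show ?thesis using G(5)[OF g(1) gb[OF g(1)], of w' v'] w v by (auto simp: W_def)
    qed
  qed
  have WW: "w < v \<longleftrightarrow> w' < v'" if w: "(w, w') \<in> W" and v: "(v, v') \<in> W" for w w' v v'
    using cmp[OF w v] cmp[OF v w] cmp_eq[of w w' v'] w v
    by (metis less_asym linorder_less_linear)
  have HW: "(e < w \<longleftrightarrow> f < w') \<and> (w < e \<longleftrightarrow> w' < f)" if "(e, f) \<in> H" "(w, w') \<in> W" for e f w w'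
    using that same_positionD(1,2)[of H w w' e f] by (auto simp: W_def)
  have "a < c \<longleftrightarrow> b < d" if "(a, b) \<in> H \<union> W" "(c, d) \<in> H \<union> W" for a b c d
    using that WW[of a b c d] HW[of a b c d] HW[of c d a b] order_matchingD(1)[OF H(1), of a b c d]
    by auto
  then have om: "order_matching (H \<union> W)"
    using H(1) finW unfolding order_matching_def by blast
  have "sign_eq (poly p y) (poly q z)"
    if yz: "l \<le> y" "y \<le> u" "l' \<le> z" "z \<le> u'" and spW: "same_position (H \<union> W) y z" for y z
  proof (cases "y \<in> fst ` H")
    case True
    then obtain b where b: "(y, b) \<in> H" by auto
    then have "z = b" using same_positionD(5)[OF spW, of y b] by blast
    then show ?thesis using ends b by blast
  next
    case False
    then obtain a b c d where g: "gap H a b c d" "a < y" "y < c"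
      using no_gap yz by blast
    have sp: "same_position H y z" using spW by (auto simp: same_position_def)
    then have z: "b < z" "z < d" using same_position_gap[OF H(1) g] by auto
    show ?thesis
    proof (cases "\<exists>w. a < w \<and> w < c \<and> poly p w = 0")
      case True
      then obtain w where w: "a < w" "w < c" "poly p w = 0" by blast
      then obtain w' where w': "b < w'" "w' < d" "poly q w' = 0" using G(1)[OF g(1) gb[OF g(1)]] by blast
      have "same_position H w w'" using same_position_gap[OF H(1) g(1) w(1,2)] w' by blast
      moreover have "l \<le> w" "w \<le> u" "l' \<le> w'" "w' \<le> u'"
        using gb[OF g(1)] w w' by auto
      ultimately have "(w, w') \<in> W" using w w' by (simp add: W_def)
      then have "y < w \<longleftrightarrow> z < w'" "w < y \<longleftrightarrow> w' < z"
        using same_positionD(1,2)[OF spW, of w w'] by auto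
      then show ?thesis using G(2)[OF g(1) gb[OF g(1)], of y w z w'] g z w w' by blast
    next
      case False
      then show ?thesis using G(3)[OF g(1) gb[OF g(1)] _ g(2,3) z] by blast
    qed
  qed
  then have "matches (H \<union> W) l u l' u' p q" unfolding matches_def by blast
  then show ?thesis using om by (intro exI[of _ "H \<union> W"]) (auto simp: W_def)
qed

subsection \<open>The transfer of one existential quantifier\<close>

text \<open>In the application the coefficients are polynomials in the other variables, which
  \<open>\<phi>\<close> evaluates at a point over the abstract field and \<open>\<psi>\<close> at a
  real point.\<close>

locale sign_equivalence = \<phi>: ring_morphism \<phi> + \<psi>: ring_morphism \<psi>
  for \<phi> :: "'a::comm_ring_1 \<Rightarrow> 'b::real_closed" and \<psi> :: "'a \<Rightarrow> 'c::real_closed" +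
  fixes G :: "'a poly set"
  assumes finite_G: "finite G"
    and closed: "sign_closed G"
    and coeff_sign: "p \<in> G \<Longrightarrow> sign_eq (\<phi> (coeff p i)) (\<psi> (coeff p i))"
begin

abbreviation (input) "\<Phi> \<equiv> map_poly \<phi>"
abbreviation (input) "\<Psi> \<equiv> map_poly \<psi>"

lemma coeff_map: "coeff (\<Phi> p) i = \<phi> (coeff p i)" "coeff (\<Psi> p) i = \<psi> (coeff p i)"
  by (simp_all add: coeff_map_poly \<phi>.zero \<psi>.zero)

lemma degree_eq:
  assumes "p \<in> G"
  shows "degree (\<Phi> p) = degree (\<Psi> p)"
proof -
  have eq: "coeff (\<Phi> p) i = 0 \<longleftrightarrow> coeff (\<Psi> p) i = 0" for i
    unfolding coeff_map using sign_eq_zero[OF coeff_sign[OF assms]] .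
  show ?thesis
  proof (rule antisym)
    show "degree (\<Phi> p) \<le> degree (\<Psi> p)" by (intro degree_le) (simp add: eq coeff_eq_0)
    show "degree (\<Psi> p) \<le> degree (\<Phi> p)" by (intro degree_le) (simp add: eq[symmetric] coeff_eq_0)
  qed
qed

text \<open>Far out the leading coefficients decide all signs. \<open>C\<close> will be the absolute
  value of the point to be transferred, which thus falls between \<open>- B\<close> and
  \<open>B\<close>.\<close>

lemma bounds_exist:
  "\<exists>B B'. C < B \<and> 0 < B' \<and> (\<forall>p\<in>G. sign_eq (poly (\<Phi> p) B) (poly (\<Psi> p) B')
    \<and> sign_eq (poly (\<Phi> p) (- B)) (poly (\<Psi> p) (- B')))"
proof -
  obtain B where B: "B \<ge> C + 1" "\<forall>p\<in>\<Phi> ` G. sgn (poly p B) = sgn (lead_coeff p)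
    \<and> sgn (poly p (- B)) = sgn (lead_coeff p) * (-1) ^ degree p"
    using poly_eventually_sgn[of "\<Phi> ` G" "C + 1"] finite_G by blast
  obtain B' where B': "B' \<ge> 1" "\<forall>p\<in>\<Psi> ` G. sgn (poly p B') = sgn (lead_coeff p)
    \<and> sgn (poly p (- B')) = sgn (lead_coeff p) * (-1) ^ degree p"
    using poly_eventually_sgn[of "\<Psi> ` G" 1] finite_G by blast
  have lc: "sign_eq (lead_coeff (\<Phi> p)) (lead_coeff (\<Psi> p))" if "p \<in> G" for p
    using coeff_sign[OF that] degree_eq[OF that] by (simp add: coeff_map)
  have sg: "sgn ((-1) ^ n :: 'b) = (-1) ^ n" "sgn ((-1) ^ n :: 'c) = (-1) ^ n" for n
    by (cases "even n"; simp)+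
  have 1: "sign_eq (poly (\<Phi> p) B) (poly (\<Psi> p) B')" if "p \<in> G" for p
    using sign_eq_sgn[of "poly (\<Phi> p) B" "lead_coeff (\<Phi> p)" "poly (\<Psi> p) B'" "lead_coeff (\<Psi> p)"]
      B(2) B'(2) lc that by blast
  have 2: "sign_eq (poly (\<Phi> p) (- B)) (poly (\<Psi> p) (- B'))" if "p \<in> G" for p
  proof (rule sign_eq_sgn)
    show "sgn (poly (\<Phi> p) (- B)) = sgn (lead_coeff (\<Phi> p) * (-1) ^ degree (\<Phi> p))"
      using B(2) that by (simp add: sgn_mult sg)
    show "sgn (poly (\<Psi> p) (- B')) = sgn (lead_coeff (\<Psi> p) * (-1) ^ degree (\<Phi> p))"
      using B'(2) that by (simp add: sgn_mult sg degree_eq)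
    show "sign_eq (lead_coeff (\<Phi> p) * (-1) ^ degree (\<Phi> p)) (lead_coeff (\<Psi> p) * (-1) ^ degree (\<Phi> p))"
      by (intro sign_eq_minus_one_power lc that)
  qed
  show ?thesis using 1 2 B(1) B'(1) by (intro exI[of _ B] exI[of _ B']) auto
qed

lemma map_drop_lead:
  shows "\<phi> (lead_coeff p) = 0 \<Longrightarrow> \<Phi> (drop_lead p) = \<Phi> p"
    and "\<psi> (lead_coeff p) = 0 \<Longrightarrow> \<Psi> (drop_lead p) = \<Psi> p"
proof -
  interpret \<Phi>: ring_morphism \<Phi> by (rule \<phi>.map_poly)
  interpret \<Psi>: ring_morphism \<Psi> by (rule \<psi>.map_poly)
  show "\<phi> (lead_coeff p) = 0 \<Longrightarrow> \<Phi> (drop_lead p) = \<Phi> p"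
    "\<psi> (lead_coeff p) = 0 \<Longrightarrow> \<Psi> (drop_lead p) = \<Psi> p"
    by (simp_all add: drop_lead_def \<Phi>.diff \<Psi>.diff map_poly_monom \<phi>.zero \<psi>.zero)
qed

text \<open>Division by \<open>q\<close> determines a sign only if the leading coefficient of
  \<open>q\<close> survives under \<open>\<phi>\<close>; if it does not, \<open>drop_lead q\<close>
  has the same image and is in the family too.\<close>

lemma root_with_lead_coeff:
  assumes "sign_closed Q" "q \<in> Q" "\<Phi> q \<noteq> 0" "poly (\<Phi> q) a = 0"
  shows "\<exists>q\<in>Q. 0 < degree q \<and> \<phi> (lead_coeff q) \<noteq> 0 \<and> poly (\<Phi> q) a = 0"
  using assms(2-)
proof (induction "degree q" arbitrary: q rule: less_induct)
  case less
  show ?case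
  proof (cases "degree q = 0")
    case True
    then obtain c where "q = [:c:]" by (metis degree_eq_zeroE)
    then show ?thesis using less.prems \<phi>.zero by (auto simp: map_poly_pCons split: if_splits)
  next
    case False
    show ?thesis
    proof (cases "\<phi> (lead_coeff q) = 0")
      case True
      then show ?thesis
        using less.hyps[of "drop_lead q"] degree_drop_lead[of q] False less.prems
          map_drop_lead(1)[OF True] sign_closed_drop_lead[OF assms(1) less.prems(1)] by auto
    qed (use False less.prems in auto)
  qed
qed

text \<open>At a zero of \<open>q\<close> the division identity becomes
  \<open>lc^(2k) * p = r\<close> with a positive factor, so the remainder has the sign of
  \<open>p\<close>.\<close>

lemma sign_at_root:
  assumes r: "is_prem p q r" and lc: "0 < \<phi> (lead_coeff q) ^ 2" "0 < \<psi> (lead_coeff q) ^ 2"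
    and roots: "poly (\<Phi> q) a = 0" "poly (\<Psi> q) b = 0"
    and sgn: "sign_eq (poly (\<Phi> r) a) (poly (\<Psi> r) b)"
  shows "sign_eq (poly (\<Phi> p) a) (poly (\<Psi> p) b)"
proof -
  interpret \<Phi>: ring_morphism \<Phi> by (rule \<phi>.map_poly)
  interpret \<Psi>: ring_morphism \<Psi> by (rule \<psi>.map_poly)
  obtain k u where ku: "smult (lead_coeff q ^ (2 * k)) p = q * u + r"
    using r unfolding is_prem_def by blast
  have "poly (\<Phi> (smult (lead_coeff q ^ (2 * k)) p)) a = poly (\<Phi> (q * u + r)) a"
    "poly (\<Psi> (smult (lead_coeff q ^ (2 * k)) p)) b = poly (\<Psi> (q * u + r)) b"
    unfolding ku by simp_all
  then have "(\<phi> (lead_coeff q) ^ 2) ^ k * poly (\<Phi> p) a = poly (\<Phi> r) a"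
    "(\<psi> (lead_coeff q) ^ 2) ^ k * poly (\<Psi> p) b = poly (\<Psi> r) b"
    using roots by (simp_all add: \<phi>.map_poly_smult \<psi>.map_poly_smult \<Phi>.add \<Psi>.add \<Phi>.mult \<Psi>.mult
        \<phi>.power \<psi>.power power_mult)
  then show ?thesis
    using sgn sign_eq_mult_pos[OF zero_less_power[OF lc(1)] zero_less_power[OF lc(2)]] by metis
qed

text \<open>The induction carries along that every matched point besides the bounds is a zero of an
  earlier polynomial \<open>q\<close>. The sign of a new \<open>p\<close> there is read off from
  \<open>prem p q\<close>, after which \<open>matching_insert\<close> adds the zeros of
  \<open>p\<close>.\<close>

lemma matching_exists:
  assumes B: "0 < B" "0 < B'"
    and sgn: "\<And>p. p \<in> G \<Longrightarrow> sign_eq (poly (\<Phi> p) B) (poly (\<Psi> p) B')"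
    "\<And>p. p \<in> G \<Longrightarrow> sign_eq (poly (\<Phi> p) (- B)) (poly (\<Psi> p) (- B'))"
  obtains H where "order_matching H" "(- B, - B') \<in> H" "(B, B') \<in> H"
    "\<And>p. p \<in> G \<Longrightarrow> matches H (- B) B (- B') B' (\<Phi> p) (\<Psi> p)"
proof -
  have "\<exists>H. order_matching H \<and> (- B, - B') \<in> H \<and> (B, B') \<in> H \<and>
      (\<forall>(a, b)\<in>H. - B \<le> a \<and> a \<le> B) \<and>
      (\<forall>(a, b)\<in>H. (a, b) = (- B, - B') \<or> (a, b) = (B, B') \<or> (\<exists>q\<in>Q. \<Phi> q \<noteq> 0 \<and> poly (\<Phi> q) a = 0)) \<and>
      (\<forall>q\<in>Q. matches H (- B) B (- B') B' (\<Phi> q) (\<Psi> q))"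
    if "sign_closed Q" "Q \<subseteq> G" for Q
    using that
  proof (induction rule: sign_closed.induct)
    case empty
    then show ?case using B
      by (intro exI[of _ "{(- B, - B'), (B, B')}"]) (auto simp: order_matching_def)
  next
    case (const Q p)
    then obtain H where H: "order_matching H" "(- B, - B') \<in> H" "(B, B') \<in> H"
      "\<forall>(a, b)\<in>H. - B \<le> a \<and> a \<le> B"
      "\<forall>(a, b)\<in>H. (a, b) = (- B, - B') \<or> (a, b) = (B, B') \<or> (\<exists>q\<in>Q. \<Phi> q \<noteq> 0 \<and> poly (\<Phi> q) a = 0)"
      "\<forall>q\<in>Q. matches H (- B) B (- B') B' (\<Phi> q) (\<Psi> q)" by auto
    obtain c where c: "p = [:c:]" using const.hyps(2) by (metis degree_eq_zeroE)
    have "p \<in> G" using const.prems by blast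
    from coeff_sign[OF this, of 0] have "matches H (- B) B (- B') B' (\<Phi> p) (\<Psi> p)"
      by (simp add: matches_def c map_poly_pCons \<phi>.zero \<psi>.zero)
    then have "\<forall>q\<in>insert p Q. matches H (- B) B (- B') B' (\<Phi> q) (\<Psi> q)" using H(6) by simp
    moreover have "\<forall>(a, b)\<in>H. (a, b) = (- B, - B') \<or> (a, b) = (B, B')
        \<or> (\<exists>q\<in>insert p Q. \<Phi> q \<noteq> 0 \<and> poly (\<Phi> q) a = 0)" using H(5) by fast
    ultimately show ?case using H(1-4) by (intro exI[of _ H] conjI)
  next
    case (insert Q p)
    then obtain H where H: "order_matching H" "(- B, - B') \<in> H" "(B, B') \<in> H"
      "\<forall>(a, b)\<in>H. - B \<le> a \<and> a \<le> B"
      "\<forall>(a, b)\<in>H. (a, b) = (- B, - B') \<or> (a, b) = (B, B') \<or> (\<exists>q\<in>Q. \<Phi> q \<noteq> 0 \<and> poly (\<Phi> q) a = 0)"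
      "\<forall>q\<in>Q. matches H (- B) B (- B') B' (\<Phi> q) (\<Psi> q)" by auto
    have pG: "p \<in> G" and QG: "Q \<subseteq> G" using insert.prems by auto
    have lc_iff: "\<phi> (lead_coeff q) = 0 \<longleftrightarrow> \<psi> (lead_coeff q) = 0" if "q \<in> G" for q
      using sign_eq_zero[OF coeff_sign[OF that]] .
    show ?case
    proof (cases "\<phi> (lead_coeff p) = 0")
      case True
      then have "\<Phi> (drop_lead p) = \<Phi> p" "\<Psi> (drop_lead p) = \<Psi> p"
        using map_drop_lead lc_iff[OF pG] by blast+
      then have "matches H (- B) B (- B') B' (\<Phi> p) (\<Psi> p)" using H(6) insert.hyps(4) by metis
      then have "\<forall>q\<in>insert p Q. matches H (- B) B (- B') B' (\<Phi> q) (\<Psi> q)" using H(6) by simp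
      moreover have "\<forall>(a, b)\<in>H. (a, b) = (- B, - B') \<or> (a, b) = (B, B')
          \<or> (\<exists>q\<in>insert p Q. \<Phi> q \<noteq> 0 \<and> poly (\<Phi> q) a = 0)" using H(5) by fast
      ultimately show ?thesis using H(1-4) by (intro exI[of _ H] conjI)
    next
      case False
      then have lcs: "\<phi> (lead_coeff p) \<noteq> 0" "\<psi> (lead_coeff p) \<noteq> 0" using lc_iff[OF pG] by auto
      then have "degree (\<Phi> p) > 0" "degree (\<Psi> p) > 0"
        using insert.hyps(2) le_degree[of "\<Phi> p" "degree p"] le_degree[of "\<Psi> p" "degree p"]
        by (auto simp: coeff_map)
      then have nz: "pderiv (\<Phi> p) \<noteq> 0" "pderiv (\<Psi> p) \<noteq> 0" by (auto simp: pderiv_eq_0_iff)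
      have md: "matches H (- B) B (- B') B' (pderiv (\<Phi> p)) (pderiv (\<Psi> p))"
        using H(6) insert.hyps(3) map_poly_formal_deriv[OF \<phi>.ring_morphism_axioms]
          map_poly_formal_deriv[OF \<psi>.ring_morphism_axioms] by metis
      have bnd: "- B \<le> a \<and> a \<le> B" if "(a, b) \<in> H" for a b using H(4) that by blast
      have bnd': "- B' \<le> b \<and> b \<le> B'" if "(a, b) \<in> H" for a b
        using bnd[OF that] order_matchingD(2)[OF H(1)] H(2,3) that by blast
      have ends: "sign_eq (poly (\<Phi> p) a) (poly (\<Psi> p) b)" if ab: "(a, b) \<in> H" for a b
      proof -
        have sp: "same_position H a b" using same_position_self[OF H(1) ab] .
        from bspec[OF H(5) ab] consider "(a, b) = (- B, - B')" | "(a, b) = (B, B')"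
          | q where "q \<in> Q" "\<Phi> q \<noteq> 0" "poly (\<Phi> q) a = 0" by auto
        then show ?thesis
        proof cases
          case 3
          then obtain q where q: "q \<in> Q" "0 < degree q" "\<phi> (lead_coeff q) \<noteq> 0" "poly (\<Phi> q) a = 0"
            using root_with_lead_coeff[OF insert.hyps(1)] by blast
          have m: "sign_eq (poly (\<Phi> r) a) (poly (\<Psi> r) b)" if "r \<in> Q" for r
            using matchesD[OF bspec[OF H(6) that], of a b] bnd[OF ab] bnd'[OF ab] sp by blast
          have "q \<in> G" using q QG by blast
          have prQ: "prem p q \<in> Q" using insert.hyps(5) q by blast
          have lcq: "0 < \<phi> (lead_coeff q) ^ 2" "0 < \<psi> (lead_coeff q) ^ 2"
            using q(3) lc_iff[OF \<open>q \<in> G\<close>] by simp_all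
          have "poly (\<Psi> q) b = 0" using sign_eq_zero[OF m[OF q(1)]] q(4) by simp
          then show ?thesis
            using sign_at_root[OF is_prem_prem[OF q(2)] lcq q(4) _ m[OF prQ]] by blast
        qed (use sgn pG in auto)
      qed
      have "\<exists>H'. H \<subseteq> H' \<and> order_matching H' \<and> (\<forall>(a, b)\<in>H' - H. - B \<le> a \<and> a \<le> B \<and> poly (\<Phi> p) a = 0)
          \<and> matches H' (- B) B (- B') B' (\<Phi> p) (\<Psi> p)"
        by (rule matching_insert[OF H(1-3) bnd nz md ends])
      then obtain H' where H': "H \<subseteq> H'" "order_matching H'"
        "\<forall>(a, b)\<in>H' - H. - B \<le> a \<and> a \<le> B \<and> poly (\<Phi> p) a = 0"
        "matches H' (- B) B (- B') B' (\<Phi> p) (\<Psi> p)"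
        by (elim exE conjE) (rule that)
      have "\<Phi> p \<noteq> 0" using nz by auto
      have new: "- B \<le> a \<and> a \<le> B \<and> poly (\<Phi> p) a = 0" if "(a, b) \<in> H'" "(a, b) \<notin> H" for a b
        using bspec[OF H'(3), of "(a, b)"] that by simp
      have 1: "- B \<le> a \<and> a \<le> B" if "(a, b) \<in> H'" for a b
        using bnd[of a b] new[OF that] by (cases "(a, b) \<in> H") auto
      have 2: "(a, b) = (- B, - B') \<or> (a, b) = (B, B') \<or> (\<exists>q\<in>insert p Q. \<Phi> q \<noteq> 0 \<and> poly (\<Phi> q) a = 0)"
        if "(a, b) \<in> H'" for a b
        using bspec[OF H(5), of "(a, b)"] new[OF that] \<open>\<Phi> p \<noteq> 0\<close> by (cases "(a, b) \<in> H") auto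
      have 3: "matches H' (- B) B (- B') B' (\<Phi> q) (\<Psi> q)" if "q \<in> insert p Q" for q
      proof (cases "q = p")
        case False
        then show ?thesis using H(6) that matches_mono[OF _ H'(1)] by simp
      qed (simp add: H'(4))
      have "\<forall>(a, b)\<in>H'. - B \<le> a \<and> a \<le> B" using 1 by fast
      moreover have "\<forall>(a, b)\<in>H'. (a, b) = (- B, - B') \<or> (a, b) = (B, B')
          \<or> (\<exists>q\<in>insert p Q. \<Phi> q \<noteq> 0 \<and> poly (\<Phi> q) a = 0)" using 2 by fast
      moreover have "\<forall>q\<in>insert p Q. matches H' (- B) B (- B') B' (\<Phi> q) (\<Psi> q)" using 3 by fast
      ultimately show ?thesis
        using H'(2) subsetD[OF H'(1) H(2)] subsetD[OF H'(1) H(3)] by (intro exI[of _ H'] conjI)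
    qed
  qed
  from this[OF closed order_refl] show ?thesis using that by blast
qed

lemma transfer_point:
  "\<exists>z. \<forall>p\<in>G. sign_eq (poly (\<Phi> p) y) (poly (\<Psi> p) z)"
proof -
  obtain B B' where B: "\<bar>y\<bar> < B" "0 < B'"
    "\<And>p. p \<in> G \<Longrightarrow> sign_eq (poly (\<Phi> p) B) (poly (\<Psi> p) B')"
    "\<And>p. p \<in> G \<Longrightarrow> sign_eq (poly (\<Phi> p) (- B)) (poly (\<Psi> p) (- B'))"
    using bounds_exist[of "\<bar>y\<bar>"] by blast
  have "0 < B" using B(1) by linarith
  then obtain H where H: "order_matching H" "(- B, - B') \<in> H" "(B, B') \<in> H"
    "\<And>p. p \<in> G \<Longrightarrow> matches H (- B) B (- B') B' (\<Phi> p) (\<Psi> p)"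
    using matching_exists[OF _ B(2-4)] by blast
  have y: "- B < y" "y < B" using B(1) by auto
  have "\<exists>z. same_position H y z"
  proof (cases "y \<in> fst ` H")
    case True
    then show ?thesis using same_position_self[OF H(1)] by force
  next
    case False
    then obtain a b c d where g: "gap H a b c d" "a < y" "y < c"
      using gap_exists[OF H(1-3) y] by blast
    have "b < d" using g(1) order_matchingD(1)[OF H(1), of a b c d] by (auto simp: gap_def)
    then show ?thesis using same_position_gap[OF H(1) g] dense by blast
  qed
  then obtain z where z: "same_position H y z" by blast
  have "- B' \<le> z" "z \<le> B'"
    using same_positionD(2)[OF z H(2)] same_positionD(1)[OF z H(3)] y by auto
  then show ?thesis using matchesD[OF H(4)] y z by (intro exI[of _ z]) auto
qed

end

text \<open>The finite set \<open>F\<close> is chosen before the morphisms and the point. Its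
  elements belong to the coefficient ring, so the hypothesis on \<open>F\<close> is a problem of the
  same kind with one variable fewer.\<close>

theorem sign_transfer:
  fixes P :: "'a::comm_ring_1 poly set"
  assumes "finite P"
  shows "\<exists>F. finite F \<and> (\<forall>(\<phi>::'a \<Rightarrow> 'b::real_closed) (\<psi>::'a \<Rightarrow> 'c::real_closed) y.
    ring_morphism \<phi> \<longrightarrow> ring_morphism \<psi> \<longrightarrow> (\<forall>c\<in>F. sign_eq (\<phi> c) (\<psi> c))
    \<longrightarrow> (\<exists>z. \<forall>p\<in>P. sign_eq (poly (map_poly \<phi> p) y) (poly (map_poly \<psi> p) z)))"
proof -
  obtain G where G: "finite G" "P \<subseteq> G" "sign_closed G"
    using sign_closed_superset[OF assms] .
  \<comment> \<open>The element \<open>0\<close> stands for the coefficients beyond the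
    degree.\<close>
  define F where "F = (\<Union>p\<in>G. (coeff p) ` {..degree p}) \<union> {0}"
  have "\<exists>z. \<forall>p\<in>P. sign_eq (poly (map_poly \<phi> p) y) (poly (map_poly \<psi> p) z)"
    if hom: "ring_morphism \<phi>" "ring_morphism \<psi>" and F: "\<forall>c\<in>F. sign_eq (\<phi> c) (\<psi> c)"
    for \<phi> :: "'a \<Rightarrow> 'b" and \<psi> :: "'a \<Rightarrow> 'c" and y
  proof -
    have "coeff p i \<in> F" if "p \<in> G" for p i
      using that by (cases "i \<le> degree p") (auto simp: F_def coeff_eq_0)
    then have "sign_equivalence \<phi> \<psi> G"
      using hom G F by (simp add: sign_equivalence_def sign_equivalence_axioms_def)
    from sign_equivalence.transfer_point[OF this] show ?thesis using G(2) by blast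
  qed
  moreover have "finite F" using G(1) by (simp add: F_def)
  ultimately show ?thesis by blast
qed

section \<open>Evaluation of polynomials in several variables\<close>

definition rconst :: "real \<Rightarrow> 'n rpoly" where
  "rconst c = Poly_Mapping.single 0 c"

lemma ring_morphism_rconst: "ring_morphism rconst"
  by standard (simp_all add: rconst_def single_add mult_single)

definition reval_in :: "(real \<Rightarrow> 'b::comm_ring_1) \<Rightarrow> ('n::finite \<Rightarrow> 'b) \<Rightarrow> 'n rpoly \<Rightarrow> 'b" where
  "reval_in \<iota> y p = (\<Sum>\<alpha>\<in>Poly_Mapping.keys p.
     \<iota> (Poly_Mapping.lookup p \<alpha>) * (\<Prod>i\<in>UNIV. y i ^ Poly_Mapping.lookup \<alpha> i))"

lemma reval_eq_reval_in: "reval p x = reval_in id (($) x) p"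
  by (simp add: reval_def reval_in_def)

lemma rpoly_sum_monomials:
  "p = (\<Sum>\<alpha>\<in>Poly_Mapping.keys p. Poly_Mapping.single \<alpha> (Poly_Mapping.lookup p \<alpha>))"
proof (rule poly_mapping_eqI)
  fix \<beta>
  have "(\<Sum>\<alpha>\<in>Poly_Mapping.keys p. Poly_Mapping.lookup (Poly_Mapping.single \<alpha> (Poly_Mapping.lookup p \<alpha>)) \<beta>)
      = (\<Sum>\<alpha>\<in>Poly_Mapping.keys p. if \<alpha> = \<beta> then Poly_Mapping.lookup p \<alpha> else 0)"
    by (intro sum.cong) (auto simp: lookup_single when_def)
  also have "\<dots> = Poly_Mapping.lookup p \<beta>"
    by (simp add: in_keys_iff)
  finally show "Poly_Mapping.lookup p \<beta> = Poly_Mapping.lookup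
      (\<Sum>\<alpha>\<in>Poly_Mapping.keys p. Poly_Mapping.single \<alpha> (Poly_Mapping.lookup p \<alpha>)) \<beta>"
    by (simp add: lookup_sum)
qed

lemma rvar_power: "rvar i ^ k = Poly_Mapping.single (Poly_Mapping.single i k) 1"
  by (induction k) (simp_all add: rvar_def mult_single flip: single_add)

lemma single_eq_rconst_times_rvars:
  fixes \<alpha> :: "'n::finite \<Rightarrow>\<^sub>0 nat"
  shows "Poly_Mapping.single \<alpha> c = rconst c * (\<Prod>i\<in>UNIV. rvar i ^ Poly_Mapping.lookup \<alpha> i)"
proof -
  have "(\<Prod>i\<in>A. rvar i ^ Poly_Mapping.lookup \<alpha> i :: 'n rpoly)
      = Poly_Mapping.single (\<Sum>i\<in>A. Poly_Mapping.single i (Poly_Mapping.lookup \<alpha> i)) 1" if "finite A" for A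
    using that by (induction A rule: finite_induct) (simp_all add: rvar_power mult_single)
  moreover have "(\<Sum>i\<in>UNIV. Poly_Mapping.single i (Poly_Mapping.lookup \<alpha> i)) = \<alpha>"
    by (rule poly_mapping_eqI) (simp add: lookup_sum lookup_single when_def)
  ultimately show ?thesis by (simp add: rconst_def mult_single)
qed

text \<open>The universal property of the polynomial ring: it turns an abstractly constructed
  morphism into evaluation at a point.\<close>

lemma reval_in_unique:
  fixes h :: "'n::finite rpoly \<Rightarrow> 'b::comm_ring_1"
  assumes "ring_morphism h"
  shows "h p = reval_in (h \<circ> rconst) (h \<circ> rvar) p"
proof -
  interpret ring_morphism h by fact
  have "h p = h (\<Sum>\<alpha>\<in>Poly_Mapping.keys p. Poly_Mapping.single \<alpha> (Poly_Mapping.lookup p \<alpha>))"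
    using rpoly_sum_monomials[of p] by simp
  then show ?thesis
    by (simp add: sum single_eq_rconst_times_rvars mult prod power reval_in_def)
qed

context
  fixes \<iota> :: "real \<Rightarrow> 'b::comm_ring_1" and y :: "'n::finite \<Rightarrow> 'b"
  assumes \<iota>: "ring_morphism \<iota>"
begin

interpretation \<iota>: ring_morphism \<iota> by (fact \<iota>)

lemma reval_in_superset:
  assumes "finite S" "Poly_Mapping.keys p \<subseteq> S"
  shows "reval_in \<iota> y p = (\<Sum>\<alpha>\<in>S. \<iota> (Poly_Mapping.lookup p \<alpha>) * (\<Prod>i\<in>UNIV. y i ^ Poly_Mapping.lookup \<alpha> i))"
  unfolding reval_in_def using assms
  by (intro sum.mono_neutral_left) (auto simp: in_keys_iff \<iota>.zero)

lemma reval_in_single: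
  "reval_in \<iota> y (Poly_Mapping.single \<alpha> c) = \<iota> c * (\<Prod>i\<in>UNIV. y i ^ Poly_Mapping.lookup \<alpha> i)"
  by (subst reval_in_superset[of "{\<alpha>}"]) (auto simp: keys_single)

lemma reval_in_add: "reval_in \<iota> y (p + q) = reval_in \<iota> y p + reval_in \<iota> y q"
proof -
  let ?S = "Poly_Mapping.keys p \<union> Poly_Mapping.keys q"
  have "Poly_Mapping.keys (p + q) \<subseteq> ?S" by (rule keys_add)
  then show ?thesis
    by (simp add: reval_in_superset[of ?S] lookup_add \<iota>.add distrib_right sum.distrib)
qed

lemma reval_in_zero: "reval_in \<iota> y 0 = 0"
  by (simp add: reval_in_def)

lemma reval_in_sum: "reval_in \<iota> y (\<Sum>i\<in>A. f i) = (\<Sum>i\<in>A. reval_in \<iota> y (f i))"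
  by (induction A rule: infinite_finite_induct) (simp_all add: reval_in_add reval_in_zero)

lemma reval_in_mult: "reval_in \<iota> y (p * q) = reval_in \<iota> y p * reval_in \<iota> y q"
proof -
  let ?m = "\<lambda>p \<alpha>. Poly_Mapping.single \<alpha> (Poly_Mapping.lookup p \<alpha>)"
  have mono: "reval_in \<iota> y (?m p \<alpha> * ?m q \<beta>) = reval_in \<iota> y (?m p \<alpha>) * reval_in \<iota> y (?m q \<beta>)" for \<alpha> \<beta>
    by (simp add: mult_single reval_in_single \<iota>.mult lookup_add power_add prod.distrib algebra_simps)
  have "reval_in \<iota> y (p * q)
      = reval_in \<iota> y ((\<Sum>\<alpha>\<in>Poly_Mapping.keys p. ?m p \<alpha>) * (\<Sum>\<beta>\<in>Poly_Mapping.keys q. ?m q \<beta>))"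
    by (simp flip: rpoly_sum_monomials)
  also have "\<dots> = (\<Sum>\<alpha>\<in>Poly_Mapping.keys p. reval_in \<iota> y (?m p \<alpha>)) * (\<Sum>\<beta>\<in>Poly_Mapping.keys q. reval_in \<iota> y (?m q \<beta>))"
    unfolding sum_product reval_in_sum mono ..
  also have "\<dots> = reval_in \<iota> y p * reval_in \<iota> y q"
    by (simp add: reval_in_single) (simp add: reval_in_def)
  finally show ?thesis .
qed

lemma ring_morphism_reval_in: "ring_morphism (reval_in \<iota> y)"
  by standard (simp_all add: reval_in_add reval_in_mult \<iota>.one reval_in_single flip: single_one)

lemma reval_in_rconst: "reval_in \<iota> y (rconst c) = \<iota> c"
  by (simp add: rconst_def reval_in_single)

lemma reval_in_rvar: "reval_in \<iota> y (rvar i) = y i"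
proof -
  have "(\<Prod>j\<in>UNIV. y j ^ Poly_Mapping.lookup (Poly_Mapping.single i 1) j) = (\<Prod>j\<in>UNIV. if j = i then y j else 1)"
    by (intro prod.cong) (auto simp: lookup_single when_def)
  then show ?thesis by (simp add: rvar_def reval_in_single \<iota>.one)
qed

end

section \<open>Evaluation with one variable singled out\<close>

lemma ring_morphism_compose: "ring_morphism f \<Longrightarrow> ring_morphism g \<Longrightarrow> ring_morphism (f \<circ> g)"
  by (simp add: ring_morphism_def)

lemma ring_morphism_id: "ring_morphism id"
  by (simp add: ring_morphism_def)

lemma ring_morphism_const_poly: "ring_morphism (\<lambda>c. [:c:])"
  by (simp add: ring_morphism_def)

lemma ring_morphism_poly: "ring_morphism (\<lambda>p. poly p x)"
  by (simp add: ring_morphism_def)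

lemma ring_morphism_reval: "ring_morphism (\<lambda>p. reval p x)"
  unfolding reval_eq_reval_in by (rule ring_morphism_reval_in[OF ring_morphism_id])

text \<open>The coefficients are free of the variable \<open>v\<close> but keep the type of
  polynomials in all variables, so that the elimination can be iterated within one type.\<close>

definition as_poly :: "'n::finite \<Rightarrow> 'n rpoly \<Rightarrow> 'n rpoly poly" where
  "as_poly v = reval_in ((\<lambda>c. [:c:]) \<circ> rconst) (\<lambda>i. if i = v then [:0, 1:] else [:rvar i:])"

text \<open>As the coefficients do not contain the variable \<open>v\<close>, the coordinate
  \<open>c\<close> at which they are evaluated is arbitrary. Both sides are morphisms in
  \<open>p\<close>, so constants and variables suffice as tests.\<close>

lemma reval_in_as_poly:
  assumes \<iota>: "ring_morphism \<iota>"
  shows "reval_in \<iota> y p = poly (map_poly (reval_in \<iota> (y(v := c))) (as_poly v p)) (y v)"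
proof -
  note c = ring_morphism_compose[OF ring_morphism_const_poly ring_morphism_rconst]
  interpret e: ring_morphism "reval_in \<iota> (y(v := c))"
    by (rule ring_morphism_reval_in[OF \<iota>])
  define h where "h = (\<lambda>q. poly q (y v)) \<circ> (map_poly (reval_in \<iota> (y(v := c))) \<circ> as_poly v)"
  have ap: "ring_morphism (as_poly v)"
    unfolding as_poly_def by (rule ring_morphism_reval_in[OF c])
  have h: "ring_morphism h"
    unfolding h_def by (intro ring_morphism_compose ring_morphism_poly e.map_poly ap)
  have "h (rconst r) = \<iota> r" for r
    by (simp add: h_def as_poly_def reval_in_rconst[OF c] map_poly_pCons e.zero reval_in_rconst[OF \<iota>])
  moreover have "h (rvar i) = y i" for i
    by (simp add: h_def as_poly_def reval_in_rvar[OF c] map_poly_pCons e.zero e.one reval_in_rvar[OF \<iota>])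
  ultimately have "h \<circ> rconst = \<iota>" "h \<circ> rvar = y" by auto
  then have "h p = reval_in \<iota> y p" using reval_in_unique[OF h, of p] by simp
  then show ?thesis by (simp add: h_def)
qed

text \<open>Elimination of the variables one at a time; the coordinates outside \<open>V\<close> are pinned to
  \<open>0\<close> so that no bookkeeping of occurring variables is needed.\<close>

lemma sign_transfer_variables:
  fixes \<iota> :: "real \<Rightarrow> 'k::real_closed" and V :: "'n::finite set"
  assumes \<iota>: "ring_morphism \<iota>" "\<And>c. sign_eq (\<iota> c) c"
    and "finite V" "finite P" "\<And>i. i \<notin> V \<Longrightarrow> y i = 0"
  shows "\<exists>z. (\<forall>i. i \<notin> V \<longrightarrow> z i = 0) \<and> (\<forall>p\<in>P. sign_eq (reval_in \<iota> y p) (reval_in id z p))"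
  using assms(3-)
proof (induction V arbitrary: P y rule: finite_induct)
  case empty
  \<comment> \<open>Without variables, evaluation over the abstract field is \<open>\<iota>\<close>
    after real evaluation at the origin, and \<open>\<iota>\<close> preserves signs.\<close>
  have h: "ring_morphism (\<iota> \<circ> reval_in id (\<lambda>_::'n. 0))"
    by (intro ring_morphism_compose \<iota> ring_morphism_reval_in ring_morphism_id)
  interpret \<iota>: ring_morphism \<iota> by (fact \<iota>)
  have y: "y = (\<lambda>_. 0)" using empty by auto
  have "\<iota> (reval_in id (\<lambda>_. 0) p) = reval_in \<iota> y p" for p :: "'n rpoly"
    using reval_in_unique[OF h, of p]
    by (simp add: comp_def reval_in_rconst[OF ring_morphism_id, simplified id_def]
        reval_in_rvar[OF ring_morphism_id, simplified id_def] id_def \<iota>.zero y)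
  then show ?case using \<iota>(2) by (metis (no_types))
next
  case (insert v V)
  obtain F :: "'n rpoly set" where F: "finite F" "\<And>(\<phi>::'n rpoly \<Rightarrow> 'k) (\<psi>::'n rpoly \<Rightarrow> real) y.
    ring_morphism \<phi> \<Longrightarrow> ring_morphism \<psi> \<Longrightarrow> \<forall>c\<in>F. sign_eq (\<phi> c) (\<psi> c)
    \<Longrightarrow> \<exists>z. \<forall>p\<in>as_poly v ` P. sign_eq (poly (map_poly \<phi> p) y) (poly (map_poly \<psi> p) z)"
    using sign_transfer[of "as_poly v ` P"] insert.prems(1) by (metis finite_imageI)
  let ?y = "y(v := 0)"
  obtain z where z: "\<And>i. i \<notin> V \<Longrightarrow> z i = 0" "\<forall>c\<in>F. sign_eq (reval_in \<iota> ?y c) (reval_in id z c)"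
  proof -
    have "?y i = 0" if "i \<notin> V" for i using insert.prems(2) that by auto
    then show ?thesis using insert.IH[OF F(1), of ?y] that by blast
  qed
  obtain t where t: "\<forall>p\<in>as_poly v ` P.
      sign_eq (poly (map_poly (reval_in \<iota> ?y) p) (y v)) (poly (map_poly (reval_in id z) p) t)"
    using F(2)[OF ring_morphism_reval_in[OF \<iota>(1)] ring_morphism_reval_in[OF ring_morphism_id] z(2)]
    by blast
  have "sign_eq (reval_in \<iota> y p) (reval_in id (z(v := t)) p)" if "p \<in> P" for p
  proof -
    have "(z(v := t))(v := z v) = z" by simp
    then show ?thesis
      using t that reval_in_as_poly[OF \<iota>(1), of y p v 0]
        reval_in_as_poly[OF ring_morphism_id, of "z(v := t)" p v "z v"] by simp
  qed
  then have "\<forall>p\<in>P. sign_eq (reval_in \<iota> y p) (reval_in id (z(v := t)) p)" by blast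
  moreover have "\<forall>i. i \<notin> insert v V \<longrightarrow> (z(v := t)) i = 0" using z(1) by simp
  ultimately show ?case by blast
qed

section \<open>The real closure of an ordered field\<close>

text \<open>An ordered subfield of a field is encoded by its cone of nonnegative elements; cones of
  preorderings, whose differences still form a subfield, are admitted as well. A cone that is maximal among
  all of these is total on its subfield and cannot be extended to a larger subfield.\<close>

definition differences :: "'a::ab_group_add set \<Rightarrow> 'a set" where
  "differences P = {x - y | x y. x \<in> P \<and> y \<in> P}"

definition is_field_cone :: "'a::field set \<Rightarrow> bool" where
  "is_field_cone P \<longleftrightarrow> 1 \<in> P \<and> - 1 \<notin> P \<and> (\<forall>x\<in>P. \<forall>y\<in>P. x + y \<in> P \<and> x * y \<in> P)
     \<and> (\<forall>x\<in>differences P. x ^ 2 \<in> P \<and> inverse x \<in> differences P)"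

lemma differencesI: "x \<in> P \<Longrightarrow> y \<in> P \<Longrightarrow> x - y \<in> differences P"
  by (auto simp: differences_def)

lemma differencesE:
  assumes "z \<in> differences P"
  obtains x y where "x \<in> P" "y \<in> P" "z = x - y"
  using assms by (auto simp: differences_def)

lemma differences_mono: "P \<subseteq> Q \<Longrightarrow> differences P \<subseteq> differences Q"
  by (auto simp: differences_def)

locale field_cone =
  fixes P :: "'a::field set"
  assumes cone: "is_field_cone P"
begin

lemma one: "1 \<in> P" and minus_one: "- 1 \<notin> P"
  and add: "x \<in> P \<Longrightarrow> y \<in> P \<Longrightarrow> x + y \<in> P"
  and mult: "x \<in> P \<Longrightarrow> y \<in> P \<Longrightarrow> x * y \<in> P"
  and square: "x \<in> differences P \<Longrightarrow> x ^ 2 \<in> P"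
  and inverse_diff: "x \<in> differences P \<Longrightarrow> inverse x \<in> differences P"
  using cone by (auto simp: is_field_cone_def)

lemma zero: "0 \<in> P"
  using square[OF differencesI[OF one one]] by simp

lemma subset_differences: "x \<in> P \<Longrightarrow> x \<in> differences P"
  using differencesI[OF _ zero] by simp

lemma diff_add:
  assumes "x \<in> differences P" "y \<in> differences P"
  shows "x + y \<in> differences P"
proof -
  obtain a b c d where ab: "a \<in> P" "b \<in> P" "c \<in> P" "d \<in> P" "x = a - b" "y = c - d"
    using assms by (elim differencesE)
  have "x + y = (a + c) - (b + d)" unfolding ab(5,6) by simp
  then show ?thesis using differencesI[of "a + c" P "b + d"] add ab(1-4) by simp
qed

lemma diff_uminus:
  assumes "x \<in> differences P"
  shows "- x \<in> differences P"
  using assms by (metis differencesE differencesI minus_diff_eq)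

lemma diff_mult:
  assumes "x \<in> differences P" "y \<in> differences P"
  shows "x * y \<in> differences P"
proof -
  obtain a b c d where ab: "a \<in> P" "b \<in> P" "c \<in> P" "d \<in> P" "x = a - b" "y = c - d"
    using assms by (elim differencesE)
  have "x * y = (a * c + b * d) - (a * d + b * c)" unfolding ab(5,6) by (simp add: algebra_simps)
  then show ?thesis
    using differencesI[of "a * c + b * d" P "a * d + b * c"] add mult ab(1-4) by simp
qed

lemma inverse_mem: "x \<in> P \<Longrightarrow> inverse x \<in> P"
proof -
  assume x: "x \<in> P"
  then have "x * (inverse x) ^ 2 \<in> P" by (intro mult square inverse_diff subset_differences)
  moreover have "x * (inverse x) ^ 2 = inverse x"
    by (cases "x = 0") (simp_all add: power2_eq_square flip: mult.assoc)
  ultimately show ?thesis by simp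
qed

lemma antisym: "x \<in> P \<Longrightarrow> - x \<in> P \<Longrightarrow> x = 0"
proof (rule ccontr)
  assume x: "x \<in> P" "- x \<in> P" and "x \<noteq> 0"
  then have "- x * inverse x = - 1" by simp
  then show False using mult[OF x(2) inverse_mem[OF x(1)]] minus_one by simp
qed

end

section \<open>Maximal cones\<close>

locale maximal_field_cone = field_cone +
  assumes maximal: "is_field_cone Q \<Longrightarrow> P \<subseteq> Q \<Longrightarrow> Q = P"
begin

text \<open>If \<open>- x\<close> is missing from \<open>P\<close>, then \<open>P + x P\<close> is a
  cone over the same field: from \<open>- 1 = p + x * q\<close> one would get
  \<open>- x = (1 + p) / q\<close> in \<open>P\<close>. Maximality then puts \<open>x\<close> into
  \<open>P\<close>.\<close>

lemma total:
  assumes x: "x \<in> differences P"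
  shows "x \<in> P \<or> - x \<in> P"
proof (rule disjCI)
  assume nx: "- x \<notin> P"
  define Q where "Q = {p + x * q | p q. p \<in> P \<and> q \<in> P}"
  have sub: "P \<subseteq> Q"
  proof
    fix p assume "p \<in> P"
    then show "p \<in> Q" using zero unfolding Q_def by force
  qed
  have Q: "Q \<subseteq> differences P"
    using diff_add diff_mult subset_differences x by (auto simp: Q_def)
  have dQ: "differences Q \<subseteq> differences P"
  proof
    fix z assume "z \<in> differences Q"
    then obtain u v where uv: "u \<in> Q" "v \<in> Q" "z = u - v" by (rule differencesE)
    then have "u + - v \<in> differences P" using Q diff_add diff_uminus by blast
    then show "z \<in> differences P" by (simp add: uv(3))
  qed
  have "is_field_cone Q"
    unfolding is_field_cone_def
  proof (intro conjI ballI)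
    show "1 \<in> Q" using one sub by blast
    show "- 1 \<notin> Q"
    proof
      assume "- 1 \<in> Q"
      then obtain p q where pq: "p \<in> P" "q \<in> P" "- 1 = p + x * q" by (auto simp: Q_def)
      have "x * q = - 1 - p" unfolding pq(3) by simp
      then have eq: "- x * q = 1 + p" by simp
      have "q \<noteq> 0" using pq minus_one by auto
      then have "- x = (1 + p) * inverse q" by (simp add: eq[symmetric])
      then show False using nx pq(1,2) add mult inverse_mem one by metis
    qed
    fix a b assume "a \<in> Q" "b \<in> Q"
    then obtain p q p' q' where ab: "p \<in> P" "q \<in> P" "p' \<in> P" "q' \<in> P" "a = p + x * q" "b = p' + x * q'"
      unfolding Q_def by blast
    have "a + b = (p + p') + x * (q + q')" using ab by (simp add: algebra_simps)
    then show "a + b \<in> Q" using ab add unfolding Q_def by blast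
    have "a * b = (p * p' + x ^ 2 * (q * q')) + x * (p * q' + q * p')"
      using ab by (simp add: algebra_simps power2_eq_square)
    moreover have "p * p' + x ^ 2 * (q * q') \<in> P" "p * q' + q * p' \<in> P"
      using ab by (simp_all add: add mult square x)
    ultimately show "a * b \<in> Q" unfolding Q_def by blast
  next
    fix a assume "a \<in> differences Q"
    then have a: "a \<in> differences P" using dQ by blast
    show "a ^ 2 \<in> Q" using square[OF a] sub by blast
    show "inverse a \<in> differences Q" using inverse_diff[OF a] differences_mono[OF sub] by blast
  qed
  then have "Q = P" using maximal sub by blast
  moreover have "x \<in> Q" using zero one unfolding Q_def by force
  ultimately show "x \<in> P" by simp
qed

end

text \<open>Zorn's lemma in the form shared by field cones, precones and quadratic modules. Each of
  their closure conditions concerns at most two elements, so directedness is all that is kept of a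
  chain.\<close>

lemma maximal_subset_exists:
  assumes "R A" and "\<And>\<C>. \<C> \<noteq> {} \<Longrightarrow> (\<And>M. M \<in> \<C> \<Longrightarrow> R M) \<Longrightarrow>
      (\<And>x y. x \<in> \<Union>\<C> \<Longrightarrow> y \<in> \<Union>\<C> \<Longrightarrow> \<exists>M\<in>\<C>. x \<in> M \<and> y \<in> M) \<Longrightarrow> R (\<Union>\<C>)"
  shows "\<exists>M. A \<subseteq> M \<and> R M \<and> (\<forall>N. R N \<longrightarrow> M \<subseteq> N \<longrightarrow> N = M)"
proof -
  have "\<exists>M\<in>{M. A \<subseteq> M \<and> R M}. \<forall>N\<in>{M. A \<subseteq> M \<and> R M}. M \<subseteq> N \<longrightarrow> N = M"
  proof (rule subset_Zorn_nonempty)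
    show "{M. A \<subseteq> M \<and> R M} \<noteq> {}" using assms(1) by auto
    fix \<C> assume ne: "\<C> \<noteq> {}" and ch: "subset.chain {M. A \<subseteq> M \<and> R M} \<C>"
    have "\<exists>M\<in>\<C>. x \<in> M \<and> y \<in> M" if xy: "x \<in> \<Union>\<C>" "y \<in> \<Union>\<C>" for x y
    proof -
      obtain M N where MN: "M \<in> \<C>" "x \<in> M" "N \<in> \<C>" "y \<in> N" using xy by blast
      then have "M \<subseteq> N \<or> N \<subseteq> M" using ch unfolding subset_chain_def by blast
      then show ?thesis using MN by blast
    qed
    moreover have "A \<subseteq> M" "R M" if "M \<in> \<C>" for M
      using ch that by (auto simp: subset.chain_def)
    ultimately show "\<Union>\<C> \<in> {M. A \<subseteq> M \<and> R M}" using ne assms(2)[of \<C>] by blast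
  qed
  then show ?thesis by (smt (verit, best) mem_Collect_eq subset_trans)
qed

lemma maximal_field_cone_exists:
  assumes "is_field_cone P0"
  shows "\<exists>P. P0 \<subseteq> P \<and> maximal_field_cone P"
proof -
  have "\<exists>P. P0 \<subseteq> P \<and> is_field_cone P \<and> (\<forall>N. is_field_cone N \<longrightarrow> P \<subseteq> N \<longrightarrow> N = P)"
  proof (rule maximal_subset_exists[where R = is_field_cone, OF assms])
    fix \<C> :: "'a set set"
    assume ne: "\<C> \<noteq> {}" and C: "\<And>P. P \<in> \<C> \<Longrightarrow> is_field_cone P"
      and two: "\<And>x y. x \<in> \<Union>\<C> \<Longrightarrow> y \<in> \<Union>\<C> \<Longrightarrow> \<exists>P\<in>\<C>. x \<in> P \<and> y \<in> P"
    have d: "\<exists>P\<in>\<C>. x \<in> differences P" if "x \<in> differences (\<Union>\<C>)" for x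
      using that two unfolding differences_def by blast
    show "is_field_cone (\<Union>\<C>)"
      unfolding is_field_cone_def
    proof (intro conjI ballI)
      show "1 \<in> \<Union>\<C>" using ne C by (auto simp: is_field_cone_def)
      show "- 1 \<notin> \<Union>\<C>" using C by (auto simp: is_field_cone_def)
      show "x + y \<in> \<Union>\<C>" "x * y \<in> \<Union>\<C>" if "x \<in> \<Union>\<C>" "y \<in> \<Union>\<C>" for x y
        using two[OF that] C unfolding is_field_cone_def by blast+
      show "x ^ 2 \<in> \<Union>\<C>" "inverse x \<in> differences (\<Union>\<C>)" if x: "x \<in> differences (\<Union>\<C>)" for x
      proof -
        obtain P where P: "P \<in> \<C>" "x \<in> differences P" using d[OF x] by blast
        then show "x ^ 2 \<in> \<Union>\<C>" using C[OF P(1)] unfolding is_field_cone_def by blast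
        have "inverse x \<in> differences P" using C[OF P(1)] P(2) unfolding is_field_cone_def by blast
        then show "inverse x \<in> differences (\<Union>\<C>)" using differences_mono[of P "\<Union>\<C>"] P(1) by blast
      qed
    qed
  qed
  then obtain P where "P0 \<subseteq> P" "is_field_cone P" "\<forall>N. is_field_cone N \<longrightarrow> P \<subseteq> N \<longrightarrow> N = P" by blast
  then have "maximal_field_cone P"
    by (auto simp: maximal_field_cone_def field_cone.intro maximal_field_cone_axioms_def)
  then show ?thesis using \<open>P0 \<subseteq> P\<close> by blast
qed

section \<open>The real closure as an ordered field\<close>

lemma differences_nonneg:
  "differences (to_ac ` {x :: 'a::linordered_field. 0 \<le> x}) = range to_ac"
proof (intro equalityI subsetI)
  fix x assume "x \<in> differences (to_ac ` {x :: 'a. 0 \<le> x})"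
  then obtain a b :: 'a where "x = to_ac (a - b)" by (auto simp: differences_def)
  then show "x \<in> range to_ac" by blast
next
  fix x :: "'a alg_closure" assume "x \<in> range to_ac"
  then obtain a :: 'a where a: "x = to_ac a" by blast
  have "to_ac (max a 0) - to_ac (max (- a) 0) \<in> differences (to_ac ` {x :: 'a. 0 \<le> x})"
    by (intro differencesI imageI) auto
  also have "to_ac (max a 0) - to_ac (max (- a) 0) = to_ac (max a 0 - max (- a) 0)" by simp
  also have "max a 0 - max (- a) 0 = a" by (simp add: max_def)
  finally show "x \<in> differences (to_ac ` {x :: 'a. 0 \<le> x})" by (simp add: a)
qed

lemma field_cone_nonneg: "is_field_cone (to_ac ` {x :: 'a::linordered_field. 0 \<le> x})"
  unfolding is_field_cone_def differences_nonneg
proof (intro conjI ballI)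
  let ?P = "to_ac ` {x :: 'a. 0 \<le> x}"
  show "1 \<in> ?P" by (metis (mono_tags) imageI mem_Collect_eq to_ac_1 zero_le_one)
  show "- 1 \<notin> ?P"
  proof
    assume "- 1 \<in> ?P"
    then obtain x :: 'a where "0 \<le> x" "to_ac (- 1) = to_ac x" by auto
    then show False unfolding to_ac_eq_iff by auto
  qed
  show "x + y \<in> ?P" "x * y \<in> ?P" if "x \<in> ?P" "y \<in> ?P" for x y
  proof -
    obtain a b :: 'a where "x = to_ac a" "y = to_ac b" "0 \<le> a" "0 \<le> b" using \<open>x \<in> ?P\<close> \<open>y \<in> ?P\<close> by blast
    then have "x + y = to_ac (a + b)" "x * y = to_ac (a * b)" "0 \<le> a + b" "0 \<le> a * b" by simp_all
    then show "x + y \<in> ?P" "x * y \<in> ?P" by blast+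
  qed
  show "x ^ 2 \<in> ?P" "inverse x \<in> range to_ac" if x: "x \<in> range to_ac" for x :: "'a alg_closure"
  proof -
    obtain a :: 'a where a: "x = to_ac a" using x by blast
    show "x ^ 2 \<in> ?P" unfolding a by (intro image_eqI[of _ _ "a ^ 2"]) simp_all
    show "inverse x \<in> range to_ac" unfolding a by (simp flip: to_ac_inverse)
  qed
qed

text \<open>The algebraic closure contains every root that an ordered algebraic extension could
  adjoin, so maximality among its cones excludes such extensions. The choice is made once, since the
  carrier type rests on it.\<close>

definition real_closure_cone :: "'a::linordered_field alg_closure set" where
  "real_closure_cone = (SOME P. to_ac ` {x. 0 \<le> x} \<subseteq> P \<and> maximal_field_cone P)"

lemma real_closure_cone:
  "to_ac ` {x :: 'a::linordered_field. 0 \<le> x} \<subseteq> real_closure_cone"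
  "maximal_field_cone (real_closure_cone :: 'a alg_closure set)"
  using someI_ex[OF maximal_field_cone_exists[OF field_cone_nonneg[where 'a = 'a]]]
  unfolding real_closure_cone_def by auto

interpretation rc: maximal_field_cone "real_closure_cone :: 'a::linordered_field alg_closure set"
  by (rule real_closure_cone(2))

typedef (overloaded) 'a real_closure = "differences (real_closure_cone :: 'a::linordered_field alg_closure set)"
  using rc.subset_differences[OF rc.zero] by blast

lifting_forget alg_closure.lifting
setup_lifting type_definition_real_closure

instantiation real_closure :: (linordered_field) linordered_field
begin

lift_definition zero_real_closure :: "'a real_closure" is 0
  by (rule rc.subset_differences[OF rc.zero])
lift_definition one_real_closure :: "'a real_closure" is 1
  by (rule rc.subset_differences[OF rc.one])
lift_definition plus_real_closure :: "'a real_closure \<Rightarrow> 'a real_closure \<Rightarrow> 'a real_closure" is "(+)"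
  by (rule rc.diff_add)
lift_definition uminus_real_closure :: "'a real_closure \<Rightarrow> 'a real_closure" is uminus
  by (rule rc.diff_uminus)
lift_definition times_real_closure :: "'a real_closure \<Rightarrow> 'a real_closure \<Rightarrow> 'a real_closure" is "(*)"
  by (rule rc.diff_mult)
lift_definition inverse_real_closure :: "'a real_closure \<Rightarrow> 'a real_closure" is inverse
  by (rule rc.inverse_diff)
lift_definition less_eq_real_closure :: "'a real_closure \<Rightarrow> 'a real_closure \<Rightarrow> bool"
  is "\<lambda>x y. y - x \<in> real_closure_cone" .

definition minus_real_closure :: "'a real_closure \<Rightarrow> 'a real_closure \<Rightarrow> 'a real_closure" where
  "x - y = x + - (y :: 'a real_closure)"
definition divide_real_closure :: "'a real_closure \<Rightarrow> 'a real_closure \<Rightarrow> 'a real_closure" where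
  "x div y = x * inverse (y :: 'a real_closure)"
definition less_real_closure :: "'a real_closure \<Rightarrow> 'a real_closure \<Rightarrow> bool" where
  "x < y \<longleftrightarrow> x \<le> y \<and> x \<noteq> (y :: 'a real_closure)"
definition abs_real_closure :: "'a real_closure \<Rightarrow> 'a real_closure" where
  "\<bar>x\<bar> = (if x < 0 then - x else (x :: 'a real_closure))"
definition sgn_real_closure :: "'a real_closure \<Rightarrow> 'a real_closure" where
  "sgn x = (if x = 0 then 0 else if 0 < x then 1 else - (1 :: 'a real_closure))"

instance
proof
  fix x y z :: "'a real_closure"
  show "x + y + z = x + (y + z)" "x + y = y + x" "0 + x = x" "- x + x = 0" "x - y = x + - y"
    "x * y * z = x * (y * z)" "x * y = y * x" "1 * x = x" "(x + y) * z = x * z + y * z"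
    "x div y = x * inverse y" "inverse (0 :: 'a real_closure) = 0" "x \<noteq> 0 \<Longrightarrow> inverse x * x = 1"
    "(0 :: 'a real_closure) \<noteq> 1" "x + y - x = y" "x - y - z = x - (y + z)" "0 * x = 0" "x * 0 = 0"
    unfolding minus_real_closure_def divide_real_closure_def
    by (transfer; simp add: algebra_simps)+
  show refl: "x \<le> x" by transfer (simp add: rc.zero)
  show trans: "x \<le> y \<Longrightarrow> y \<le> z \<Longrightarrow> x \<le> z" for x y z :: "'a real_closure"
    by transfer (metis rc.add add_diff_eq diff_add_cancel)
  show antisym: "x \<le> y \<Longrightarrow> y \<le> x \<Longrightarrow> x = y" for x y :: "'a real_closure"
    by transfer (metis eq_iff_diff_eq_0 minus_diff_eq rc.antisym)
  show "x < y \<longleftrightarrow> x \<le> y \<and> \<not> y \<le> x"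
    using antisym refl by (auto simp: less_real_closure_def)
  show linear: "x \<le> y \<or> y \<le> x"
    by transfer (metis rc.total rc.diff_add rc.diff_uminus diff_conv_add_uminus minus_diff_eq)
  show "x \<le> y \<Longrightarrow> z + x \<le> z + y"
    by transfer simp
  have mult_pos: "0 \<le> a \<Longrightarrow> 0 \<le> b \<Longrightarrow> 0 \<le> a * b" for a b :: "'a real_closure"
    by transfer (simp add: rc.mult)
  have mult_nz: "a * b = 0 \<Longrightarrow> a = 0 \<or> b = 0" for a b :: "'a real_closure"
    by transfer simp
  have diff: "a \<le> b \<longleftrightarrow> 0 \<le> b + - a" for a b :: "'a real_closure"
    by transfer simp
  have dist: "z * y + - (z * x) = z * (y + - x)" and eq: "y + - x = 0 \<longleftrightarrow> y = x"
    by (transfer; auto simp: algebra_simps)+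
  assume xy: "x < y" and z: "0 < z"
  then have "0 \<le> z * (y + - x)"
    using mult_pos diff unfolding less_real_closure_def by blast
  then have "z * x \<le> z * y" unfolding diff[of "z * x"] dist .
  moreover have "z * x \<noteq> z * y"
  proof
    assume "z * x = z * y"
    then have "z * (y + - x) = 0" unfolding dist[symmetric] by transfer auto
    then show False using mult_nz eq xy z unfolding less_real_closure_def by blast
  qed
  ultimately show "z * x < z * y" unfolding less_real_closure_def by blast
qed (auto simp: abs_real_closure_def sgn_real_closure_def)

end

lift_definition of_real_closure :: "'a::linordered_field real_closure \<Rightarrow> 'a alg_closure" is "\<lambda>x. x" .

lemma ring_morphism_of_real_closure: "ring_morphism of_real_closure"
  by (rule ring_morphism.intro) (simp_all add: of_real_closure.rep_eq one_real_closure.rep_eq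
      plus_real_closure.rep_eq times_real_closure.rep_eq)

lemma of_real_closure_eq_0_iff: "of_real_closure x = 0 \<longleftrightarrow> x = 0"
  by (simp add: of_real_closure.rep_eq zero_real_closure.rep_eq flip: Rep_real_closure_inject)

lemma range_of_real_closure: "range of_real_closure = differences real_closure_cone"
  using type_definition.Rep_range[OF type_definition_real_closure]
  by (simp add: of_real_closure.rep_eq)

lemma nonneg_iff_of_real_closure: "0 \<le> x \<longleftrightarrow> of_real_closure x \<in> real_closure_cone"
  by (simp add: of_real_closure.rep_eq zero_real_closure.rep_eq less_eq_real_closure.rep_eq)

lift_definition to_real_closure :: "'a::linordered_field \<Rightarrow> 'a real_closure" is to_ac
  using differences_mono[OF real_closure_cone(1)] differences_nonneg by blast

lemma ring_morphism_to_real_closure: "ring_morphism to_real_closure"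
  by (rule ring_morphism.intro) (simp_all add: to_real_closure.rep_eq one_real_closure.rep_eq
      plus_real_closure.rep_eq times_real_closure.rep_eq flip: Rep_real_closure_inject)

lemma sign_eq_to_real_closure: "sign_eq (to_real_closure x) x"
proof -
  interpret ring_morphism "to_real_closure :: 'a \<Rightarrow> 'a real_closure"
    by (rule ring_morphism_to_real_closure)
  have nonneg: "0 \<le> to_real_closure x" if "0 \<le> x" for x :: 'a
    using that real_closure_cone(1)
    by (auto simp: to_real_closure.rep_eq less_eq_real_closure.rep_eq zero_real_closure.rep_eq)
  have nz: "to_real_closure x \<noteq> 0" if "x \<noteq> 0" for x :: 'a
    using that
    by (simp add: to_real_closure.rep_eq zero_real_closure.rep_eq flip: Rep_real_closure_inject)
  have pos: "0 < to_real_closure x" if "0 < x" for x :: 'a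
    using nonneg[of x] nz[of x] that by simp
  show ?thesis
    using pos[of x] pos[of "- x"] zero uminus[of x]
    by (cases x "0::'a" rule: linorder_cases) (auto simp: sign_eq_def)
qed

section \<open>Sums of squares in simple extensions and the intermediate value property\<close>

inductive_set square_sums :: "'a::linordered_field poly set" where
  square: "0 \<le> c \<Longrightarrow> smult c (g ^ 2) \<in> square_sums"
| add: "h \<in> square_sums \<Longrightarrow> k \<in> square_sums \<Longrightarrow> h + k \<in> square_sums"

lemma square_sums_mult:
  assumes "h \<in> square_sums" "k \<in> square_sums"
  shows "h * k \<in> square_sums"
  using assms
proof (induction h)
  case (square c g)
  from square(2,1) show ?case
  proof (induction k)
    case (square d g')
    have "smult c (g ^ 2) * smult d (g' ^ 2) = smult (c * d) ((g * g') ^ 2)"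
      by (simp add: power_mult_distrib mult.commute)
    then show ?case using square by (metis square_sums.square mult_nonneg_nonneg)
  qed (simp add: distrib_left square_sums.add)
qed (simp add: distrib_right square_sums.add)

lemma square_sums_nonneg: "h \<in> square_sums \<Longrightarrow> 0 \<le> poly h x"
  by (induction rule: square_sums.induct) auto

text \<open>Each \<open>g\<close> may be replaced by its remainder modulo \<open>f\<close>. The
  degree bound ensures that a cofactor of \<open>f\<close> in \<open>1 + k\<close> has smaller
  degree than \<open>f\<close>, on which the induction in \<open>real_closure_IVT\<close>
  rests.\<close>

lemma square_sums_reduce:
  fixes f :: "'a::linordered_field poly"
  assumes "h \<in> square_sums" "0 < degree f"
  shows "\<exists>k\<in>square_sums. degree k \<le> 2 * (degree f - 1) \<and> f dvd h - k"
  using assms(1)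
proof induction
  case (square c g)
  have "f \<noteq> 0" using assms(2) by auto
  have "degree (g mod f) < degree f"
    using degree_mod_less[OF \<open>f \<noteq> 0\<close>, of g] assms(2) by auto
  then have "degree (g mod f) \<le> degree f - 1" by simp
  then have "degree (smult c ((g mod f) ^ 2)) \<le> 2 * (degree f - 1)"
    using degree_smult_le[of c "(g mod f) ^ 2"] degree_power_le[of "g mod f" 2] by linarith
  moreover have "f dvd smult c (g ^ 2) - smult c ((g mod f) ^ 2)"
  proof -
    have "smult c (g ^ 2) - smult c ((g mod f) ^ 2) = (g - g mod f) * smult c (g + g mod f)"
      by (simp add: power2_eq_square algebra_simps smult_add_right smult_diff_right)
    then show ?thesis by (metis dvd_minus_mod dvd_mult2)
  qed
  ultimately show ?case using square_sums.square[OF square] by blast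
next
  case (add h k)
  then obtain h' k' where hk: "h' \<in> square_sums" "degree h' \<le> 2 * (degree f - 1)" "f dvd h - h'"
    "k' \<in> square_sums" "degree k' \<le> 2 * (degree f - 1)" "f dvd k - k'" by blast
  have "f dvd (h + k) - (h' + k')"
    using dvd_add[OF hk(3,6)] by (simp add: algebra_simps)
  then show ?case using hk by (intro bexI[of _ "h' + k'"]) (auto intro: degree_add_le square_sums.add)
qed

text \<open>Consequently the differences of evaluated square sums fill the whole extension generated
  by the root.\<close>

lemma square_diff_square_sums:
  "g = smult (1 / 4) ((g + 1) ^ 2) - smult (1 / 4) ((g - 1) ^ 2 :: 'a::linordered_field poly)"
proof -
  have "(g + 1) ^ 2 - (g - 1) ^ 2 = smult 4 g"
    by (simp add: power2_eq_square algebra_simps numeral_poly)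
  then show ?thesis by (simp flip: smult_diff_right)
qed

context
  fixes f :: "'a::linordered_field real_closure poly" and \<alpha> :: "'a alg_closure"
  assumes degree: "0 < degree f"
    and root: "poly (map_poly of_real_closure f) \<alpha> = 0"
    and minimal: "\<And>g. g \<noteq> 0 \<Longrightarrow> poly (map_poly of_real_closure g) \<alpha> = 0 \<Longrightarrow> degree f \<le> degree g"
begin

private abbreviation (input) "ev \<equiv> \<lambda>g. poly (map_poly of_real_closure g) \<alpha>"

interpretation ev: ring_morphism ev
proof -
  interpret e: ring_morphism "of_real_closure :: 'a real_closure \<Rightarrow> _" by (rule ring_morphism_of_real_closure)
  show "ring_morphism ev"
    using ring_morphism_compose[OF ring_morphism_poly e.map_poly] by (simp add: comp_def)
qed

lemma ev_const: "ev [:c:] = of_real_closure c"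
proof -
  interpret e: ring_morphism "of_real_closure :: 'a real_closure \<Rightarrow> _" by (rule ring_morphism_of_real_closure)
  show ?thesis by (simp add: map_poly_pCons e.zero)
qed

lemma ev_smult: "ev (smult c g) = of_real_closure c * ev g"
  using ev.mult[of "[:c:]" g] ev_const by simp

lemma ev_eq_0_iff: "ev g = 0 \<longleftrightarrow> f dvd g"
proof
  assume "ev g = 0"
  have "f \<noteq> 0" using degree by auto
  have "ev g = ev (g div f * f + g mod f)" by simp
  also have "\<dots> = ev (g mod f)" unfolding ev.add ev.mult root by simp
  finally have "ev (g mod f) = 0" using \<open>ev g = 0\<close> by simp
  then have "g mod f = 0"
    using minimal[of "g mod f"] degree_mod_less[OF \<open>f \<noteq> 0\<close>, of g] by fastforce
  then show "f dvd g" by (simp add: mod_eq_0_iff_dvd)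
next
  assume "f dvd g"
  then show "ev g = 0" using ev.mult root by (auto elim!: dvdE)
qed

text \<open>Euclidean descent: with \<open>f = g * (f div g) + r\<close> an inverse for
  \<open>r\<close> yields one for \<open>g\<close>. The remainder is nonzero, as otherwise one of
  two proper factors of \<open>f\<close> would vanish at the root, against the minimality of its
  degree.\<close>

lemma ev_inverse:
  assumes "ev g \<noteq> 0"
  shows "\<exists>w. ev (g * w) = 1"
proof -
  have *: "\<exists>w. ev (g * w) = 1" if "g \<noteq> 0" "degree g < degree f" for g
    using that
  proof (induction "degree g" arbitrary: g rule: less_induct)
    case less
    show ?case
    proof (cases "degree g = 0")
      case True
      then obtain c where c: "g = [:c:]" by (metis degree_eq_zeroE)
      then have "g * [:inverse c:] = 1" using less.prems by (simp add: pCons_one)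
      then show ?thesis using ev.one by metis
    next
      case False
      define r where "r = f mod g"
      have r: "degree r < degree g \<or> r = 0"
        using degree_mod_less[OF less.prems(1), of f] unfolding r_def by auto
      have f: "f = g * (f div g) + r" by (simp add: r_def)
      have "r \<noteq> 0"
      proof
        assume "r = 0"
        then have f: "f = g * (f div g)" using f by simp
        have "f div g \<noteq> 0" using f degree by auto
        then have "degree f = degree g + degree (f div g)"
          using f less.prems(1) degree_mult_eq by metis
        then have "degree (f div g) < degree f" using False by simp
        moreover have "ev g * ev (f div g) = 0" using f root ev.mult by metis
        ultimately show False
          using minimal[OF less.prems(1)] minimal[OF \<open>f div g \<noteq> 0\<close>] less.prems(2) by fastforce
      qed
      then obtain w where w: "ev (r * w) = 1" using less.hyps[of r] r less.prems by fastforce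
      have "ev g * ev (f div g) + ev r = 0" using f root ev.add ev.mult by metis
      then have "ev r = - (ev g * ev (f div g))" by (simp add: eq_neg_iff_add_eq_0 add.commute)
      then have "ev (g * (- (f div g) * w)) = 1"
        using w by (simp only: ev.mult ev.uminus) (simp add: mult.assoc)
      then show ?thesis by blast
    qed
  qed
  have "f \<noteq> 0" using degree by auto
  have eq: "ev g = ev (g mod f)"
    using ev_eq_0_iff[of "g - g mod f"] by (simp add: ev.diff dvd_minus_mod)
  then have "g mod f \<noteq> 0" using assms ev.zero by metis
  moreover have "degree (g mod f) < degree f"
    using degree_mod_less[OF \<open>f \<noteq> 0\<close>, of g] calculation by blast
  ultimately obtain w where "ev ((g mod f) * w) = 1" using * by blast
  then show ?thesis using eq ev.mult by metis
qed

text \<open>If \<open>- 1\<close> is not among them, the values of the square sums form a field cone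
  on the extension by \<open>\<alpha>\<close>. It contains \<open>real_closure_cone\<close>, so by
  maximality the extension is trivial and \<open>\<alpha>\<close> lies in the base field.\<close>

lemma minimal_poly_linear:
  assumes "- 1 \<notin> ev ` square_sums"
  shows "degree f = 1"
proof -
  interpret rc: maximal_field_cone "real_closure_cone :: 'a alg_closure set" by (rule real_closure_cone(2))
  interpret e: ring_morphism "of_real_closure :: 'a real_closure \<Rightarrow> _" by (rule ring_morphism_of_real_closure)
  define Q where "Q = ev ` square_sums"
  have PQ: "real_closure_cone \<subseteq> Q"
  proof
    fix p :: "'a alg_closure" assume p: "p \<in> real_closure_cone"
    then obtain c where c: "p = of_real_closure c"
      using rc.subset_differences range_of_real_closure by blast
    have "0 \<le> c" using p by (simp add: nonneg_iff_of_real_closure c)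
    then have "smult c (1 ^ 2) \<in> square_sums" by (rule square_sums.square)
    moreover have "ev (smult c (1 ^ 2)) = p" by (simp only: ev_smult power_one ev.one c mult_1_right)
    ultimately show "p \<in> Q" unfolding Q_def by blast
  qed
  have sq: "ev g ^ 2 \<in> Q" for g
  proof -
    have "smult 1 (g ^ 2) \<in> square_sums" by (rule square_sums.square) simp
    moreover have "ev (smult 1 (g ^ 2)) = ev g ^ 2" by (simp add: ev.power)
    ultimately show ?thesis unfolding Q_def by (metis image_eqI)
  qed
  have diff: "differences Q = range ev"
  proof (intro equalityI subsetI)
    fix x assume "x \<in> differences Q"
    then obtain h k where "x = ev h - ev k" unfolding Q_def by (auto elim: differencesE)
    then have "x = ev (h - k)" by (simp only: ev.diff)
    then show "x \<in> range ev" by blast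
  next
    fix x assume "x \<in> range ev"
    then obtain g where x: "x = ev g" by blast
    have "smult (1 / 4) ((g + 1) ^ 2) \<in> square_sums" "smult (1 / 4) ((g - 1) ^ 2) \<in> square_sums"
      by (rule square_sums.square, simp)+
    then have "ev (smult (1 / 4) ((g + 1) ^ 2)) - ev (smult (1 / 4) ((g - 1) ^ 2)) \<in> differences Q"
      unfolding Q_def by (intro differencesI imageI)
    then show "x \<in> differences Q" unfolding x ev.diff[symmetric] square_diff_square_sums[of g, symmetric] .
  qed
  have "is_field_cone Q"
    unfolding is_field_cone_def
  proof (intro conjI ballI)
    show "1 \<in> Q" using PQ rc.one by blast
    show "- 1 \<notin> Q" using assms by (simp add: Q_def)
    show "x + y \<in> Q" "x * y \<in> Q" if xy: "x \<in> Q" "y \<in> Q" for x y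
    proof -
      obtain h k where hk: "h \<in> square_sums" "x = ev h" "k \<in> square_sums" "y = ev k"
        using xy unfolding Q_def by blast
      then have "x + y = ev (h + k)" "x * y = ev (h * k)" by (simp_all only: ev.add ev.mult)
      then show "x + y \<in> Q" "x * y \<in> Q"
        using square_sums.add[OF hk(1,3)] square_sums_mult[OF hk(1,3)] unfolding Q_def by blast+
    qed
    show "x ^ 2 \<in> Q" if "x \<in> differences Q" for x using sq that unfolding diff by blast
    show "inverse x \<in> differences Q" if x: "x \<in> differences Q" for x
    proof (cases "x = 0")
      case True
      then show ?thesis using x by simp
    next
      case False
      obtain g where g: "x = ev g" using x unfolding diff by blast
      then obtain w where "ev (g * w) = 1" using ev_inverse False by blast
      then have "inverse x = ev w" unfolding ev.mult g by (rule inverse_unique)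
      then show ?thesis unfolding diff by blast
    qed
  qed
  then have "Q = real_closure_cone" using rc.maximal PQ by blast
  moreover have "ev [:0, 1:] = \<alpha>" by (simp add: map_poly_pCons e.zero e.one)
  ultimately have "\<alpha> \<in> differences real_closure_cone" using diff by (metis rangeI)
  then obtain c where c: "\<alpha> = of_real_closure c" using range_of_real_closure by blast
  have "ev [:- c, 1:] = 0" by (simp add: map_poly_pCons e.zero e.one e.uminus c)
  then have "degree f \<le> 1" using minimal[of "[:- c, 1:]"] by simp
  then show ?thesis using degree by simp
qed

end

text \<open>Induction on the degree. If \<open>f\<close> splits, one factor changes sign. If
  \<open>f\<close> is minimal for a root \<open>\<alpha>\<close>, then either the order extends to
  the field of \<open>\<alpha>\<close> and \<open>f\<close> is linear, or
  \<open>1 + h' = f * u\<close> with a sum of squares \<open>h'\<close>. In the latter case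
  \<open>u\<close> changes sign along with \<open>f\<close>, and its zero, which exists by
  induction, contradicts the positivity of \<open>f * u\<close>.\<close>

lemma real_closure_IVT:
  fixes f :: "'a::linordered_field real_closure poly"
  assumes "a < b" "poly f a * poly f b < 0"
  shows "\<exists>x. a < x \<and> x < b \<and> poly f x = 0"
  using assms(2)
proof (induction "degree f" arbitrary: f rule: less_induct)
  case less
  interpret e: ring_morphism "of_real_closure :: 'a real_closure \<Rightarrow> _" by (rule ring_morphism_of_real_closure)
  interpret E: ring_morphism "map_poly of_real_closure :: 'a real_closure poly \<Rightarrow> _" by (rule e.map_poly)
  have deg: "degree (map_poly of_real_closure g) = degree g" for g :: "'a real_closure poly"
    by (rule degree_map_poly) (simp add: of_real_closure_eq_0_iff)
  have "f \<noteq> 0" using less.prems by auto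
  have df: "0 < degree f"
  proof (rule ccontr)
    assume "\<not> 0 < degree f"
    then obtain c where "f = [:c:]" by (metis degree_eq_zeroE neq0_conv)
    then show False using less.prems by (simp add: mult_less_0_iff)
  qed
  then obtain \<alpha> where \<alpha>: "poly (map_poly of_real_closure f) \<alpha> = 0"
    using alg_closed_imp_poly_has_root[of "map_poly of_real_closure f"] deg by auto
  define R where "R = (\<lambda>g. g \<noteq> 0 \<and> poly (map_poly of_real_closure g) \<alpha> = 0)"
  obtain m where m: "R m" "\<And>g. R g \<Longrightarrow> degree m \<le> degree g"
    using ex_has_least_nat[of R f degree] \<open>f \<noteq> 0\<close> \<alpha> unfolding R_def by blast
  have dm: "0 < degree m"
  proof (rule ccontr)
    assume "\<not> 0 < degree m"
    then obtain c where "m = [:c:]" by (metis degree_eq_zeroE neq0_conv)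
    then show False using m(1) by (simp add: R_def map_poly_pCons e.zero of_real_closure_eq_0_iff)
  qed
  note M = dm m(1)[unfolded R_def, THEN conjunct2] m(2)[unfolded R_def, OF conjI]
  have "m dvd f" using ev_eq_0_iff[OF M] \<alpha> by blast
  then obtain k where k: "f = m * k" by blast
  have "k \<noteq> 0" "m \<noteq> 0" using k \<open>f \<noteq> 0\<close> by auto
  then have dk: "degree f = degree m + degree k" using k degree_mult_eq by blast
  show ?case
  proof (cases "degree k = 0")
    case False
    have "(poly m a * poly m b) * (poly k a * poly k b) < 0"
      using less.prems by (simp add: k mult_ac)
    then have "poly m a * poly m b < 0 \<or> poly k a * poly k b < 0"
      by (auto simp: mult_less_0_iff)
    then show ?thesis
      using less.hyps[of m] less.hyps[of k] dk dm False unfolding k by auto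
  next
    case True
    have F: "0 < degree f" "poly (map_poly of_real_closure f) \<alpha> = 0"
      "\<And>g. g \<noteq> 0 \<Longrightarrow> poly (map_poly of_real_closure g) \<alpha> = 0 \<Longrightarrow> degree f \<le> degree g"
      using df \<alpha> M(3) dk True by auto
    show ?thesis
    proof (cases "- 1 \<in> (\<lambda>g. poly (map_poly of_real_closure g) \<alpha>) ` square_sums")
      case True
      then obtain h where h: "h \<in> square_sums" "poly (map_poly of_real_closure h) \<alpha> = - 1" by auto
      obtain h' where h': "h' \<in> square_sums" "degree h' \<le> 2 * (degree f - 1)" "f dvd h - h'"
        using square_sums_reduce[OF h(1) df] by blast
      have "poly (map_poly of_real_closure (h - h')) \<alpha> = 0" using ev_eq_0_iff[OF F] h'(3) by blast
      then have "poly (map_poly of_real_closure h') \<alpha> = - 1"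
        using h(2) by (simp add: E.diff)
      then have "poly (map_poly of_real_closure (1 + h')) \<alpha> = 0"
        by (simp add: E.add E.one)
      then have "f dvd 1 + h'" using ev_eq_0_iff[OF F] by blast
      then obtain u where u: "1 + h' = f * u" by blast
      have pos: "0 < poly f x * poly u x" for x
        using square_sums_nonneg[OF h'(1), of x] u by (metis add_pos_nonneg poly_1 poly_add poly_mult zero_less_one)
      then have "u \<noteq> 0" by fastforce
      then have "degree f + degree u = degree (1 + h')" using u degree_mult_eq \<open>f \<noteq> 0\<close> by metis
      also have "\<dots> \<le> 2 * (degree f - 1)" using h'(2) by (intro degree_add_le) auto
      finally have "degree u < degree f" using df by linarith
      moreover have "poly u a * poly u b < 0"
      proof -
        have "0 < (poly f a * poly f b) * (poly u a * poly u b)"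
          using mult_pos_pos[OF pos[of a] pos[of b]] by (simp add: mult_ac)
        then show ?thesis
          using less.prems by (metis zero_less_mult_iff order_less_asym)
      qed
      ultimately obtain x where "poly u x = 0" using less.hyps by blast
      then show ?thesis using pos[of x] by simp
    next
      case False
      then have "degree f = 1" using minimal_poly_linear[OF F] by blast
      then obtain c d where f: "f = [:c, d:]" "d \<noteq> 0"
        by (cases f) (auto split: if_splits elim!: degree_eq_zeroE)
      define r where "r = - c / d"
      have fr: "poly f x = d * (x - r)" for x using f by (simp add: r_def field_simps)
      have "d * d * ((a - r) * (b - r)) < 0" using less.prems by (simp add: fr mult_ac)
      moreover have "0 < d * d" using f(2) by (auto simp: zero_less_mult_iff linorder_neq_iff)
      ultimately have "(a - r) * (b - r) < 0" by (simp add: mult_less_0_iff)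
      then have "a < r" "r < b" using assms(1) by (auto simp: mult_less_0_iff)
      then show ?thesis using fr by (intro exI[of _ r]) simp
    qed
  qed
qed

instance real_closure :: (linordered_field) real_closed
proof
  fix a b :: "'a real_closure" and n :: nat and f :: "nat \<Rightarrow> 'a real_closure"
  define p where "p = (\<Sum>k\<le>n. monom (f k) k)"
  have p: "poly p x = (\<Sum>k\<le>n. f k * x ^ k)" for x by (simp add: p_def poly_sum poly_monom)
  assume "a < b" "(\<Sum>k\<le>n. f k * a ^ k) < 0" "0 < (\<Sum>k\<le>n. f k * b ^ k)"
  then show "\<exists>x. a < x \<and> x < b \<and> (\<Sum>k\<le>n. f k * x ^ k) = 0"
    using real_closure_IVT[of a b p] unfolding p by (simp add: mult_neg_pos)
qed

section \<open>Prime cones are realised by points\<close>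

definition prime_cone :: "'a::comm_ring_1 set \<Rightarrow> bool" where
  "prime_cone T \<longleftrightarrow> (\<forall>x\<in>T. \<forall>y\<in>T. x + y \<in> T \<and> x * y \<in> T) \<and> (\<forall>x. x \<in> T \<or> - x \<in> T) \<and> - 1 \<notin> T
     \<and> (\<forall>x y. x * y \<in> T \<longrightarrow> - (x * y) \<in> T \<longrightarrow> x \<in> T \<and> - x \<in> T \<or> y \<in> T \<and> - y \<in> T)"

text \<open>Only finitely many conditions at a time: a prime cone such as that of the polynomials in
  one variable that are eventually nonnegative belongs to no single real point.\<close>

definition realized :: "'n::finite rpoly set \<Rightarrow> bool" where
  "realized T \<longleftrightarrow> (\<forall>P. finite P \<longrightarrow> (\<exists>x. \<forall>p\<in>P. p \<in> T \<longleftrightarrow> 0 \<le> reval p x))"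

text \<open>A quotient type cannot depend on a cone given in a proof. Hence we fix one prime cone that is a
  counterexample to the claim, if there is one, and refute this possibility for its quotient.\<close>

definition test_cone :: "'n::finite rpoly set" where
  "test_cone = (if \<exists>T::'n rpoly set. prime_cone T \<and> \<not> realized T
     then SOME T. prime_cone T \<and> \<not> realized T else {p. 0 \<le> reval p 0})"

lemma prime_cone_test_cone: "prime_cone (test_cone :: 'n::finite rpoly set)"
proof (cases "\<exists>T::'n rpoly set. prime_cone T \<and> \<not> realized T")
  case True
  then show ?thesis unfolding test_cone_def if_P[OF True] using someI_ex[OF True] by blast
next
  case False
  interpret ring_morphism "\<lambda>p::'n rpoly. reval p 0" by (rule ring_morphism_reval)
  \<comment> \<open>The default must be a prime cone as well, because the quotient type is formed in
    either case.\<close>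
  have "prime_cone {p::'n rpoly. 0 \<le> reval p 0}"
    unfolding prime_cone_def
    by (auto simp: add mult uminus one mult_le_0_iff zero_le_mult_iff)
  then show ?thesis unfolding test_cone_def if_not_P[OF False] .
qed

lemma realized_if_test_cone:
  assumes "realized (test_cone :: 'n::finite rpoly set)" "prime_cone (T :: 'n rpoly set)"
  shows "realized T"
proof (rule ccontr)
  assume "\<not> realized T"
  then have ex: "\<exists>T::'n rpoly set. prime_cone T \<and> \<not> realized T" using assms(2) by blast
  then have "\<not> realized (test_cone :: 'n rpoly set)"
    unfolding test_cone_def if_P[OF ex] using someI_ex[OF ex] by blast
  then show False using assms(1) by blast
qed

section \<open>The residue ring of a prime cone\<close>

locale prime_cone_ring =
  fixes T :: "'a::comm_ring_1 set"
  assumes cone: "prime_cone T"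
begin

lemma add: "x \<in> T \<Longrightarrow> y \<in> T \<Longrightarrow> x + y \<in> T"
  and mult: "x \<in> T \<Longrightarrow> y \<in> T \<Longrightarrow> x * y \<in> T"
  and total: "x \<in> T \<or> - x \<in> T"
  and minus_one: "- 1 \<notin> T"
  and prime: "x * y \<in> T \<Longrightarrow> - (x * y) \<in> T \<Longrightarrow> x \<in> T \<and> - x \<in> T \<or> y \<in> T \<and> - y \<in> T"
  using cone unfolding prime_cone_def by auto

lemma trans: "y - x \<in> T \<Longrightarrow> z - y \<in> T \<Longrightarrow> z - x \<in> T"
  using add[of "y - x" "z - y"] by simp

lemma linear: "y - x \<in> T \<or> x - y \<in> T"
  using total[of "y - x"] by simp

lemma one: "1 \<in> T"
  using total minus_one by blast

lemma zero: "0 \<in> T"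
  using total[of 0] by simp

definition support :: "'a set" where "support = {x. x \<in> T \<and> - x \<in> T}"

lemma support_zero: "0 \<in> support"
  by (simp add: support_def zero)

lemma support_eq: "x = y \<Longrightarrow> x - y \<in> support"
  by (simp add: support_zero)

lemma support_add: "x \<in> support \<Longrightarrow> y \<in> support \<Longrightarrow> x + y \<in> support"
  using add[of x y] add[of "- x" "- y"] by (simp add: support_def)

lemma support_uminus: "- x \<in> support \<longleftrightarrow> x \<in> support"
  by (auto simp: support_def)

lemma support_mult: "x \<in> support \<Longrightarrow> x * y \<in> support"
proof -
  assume x: "x \<in> support"
  from total[of y] show ?thesis
    using x mult[of x y] mult[of "- x" y] mult[of x "- y"] mult[of "- x" "- y"]
    by (auto simp: support_def)
qed

lemma cone_cong: "x - y \<in> support \<Longrightarrow> x \<in> T \<longleftrightarrow> y \<in> T"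
  using add[of y "x - y"] add[of x "- (x - y)"] by (auto simp: support_def)

lemma support_prime: "x * y \<in> support \<Longrightarrow> x \<in> support \<or> y \<in> support"
  using prime by (auto simp: support_def)

lemma one_notin_support: "1 \<notin> support"
  using minus_one by (simp add: support_def)

end

interpretation tc: prime_cone_ring "test_cone :: 'n::finite rpoly set"
  by standard (rule prime_cone_test_cone)

lifting_forget poly_mapping.lifting

quotient_type (overloaded) 'n cone_quotient = "'n::finite rpoly" /
  "\<lambda>p q. p - q \<in> prime_cone_ring.support (test_cone :: 'n rpoly set)"
proof (rule equivpI)
  show "reflp (\<lambda>p q. p - q \<in> prime_cone_ring.support (test_cone :: 'n rpoly set))"
    by (rule reflpI) (simp add: tc.support_zero)
  show "symp (\<lambda>p q. p - q \<in> prime_cone_ring.support (test_cone :: 'n rpoly set))"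
    by (rule sympI) (subst minus_diff_eq[symmetric], simp only: tc.support_uminus)
  show "transp (\<lambda>p q. p - q \<in> prime_cone_ring.support (test_cone :: 'n rpoly set))"
    by (rule transpI) (auto dest: tc.support_add)
qed

instantiation cone_quotient :: (finite) linordered_idom
begin

lift_definition zero_cone_quotient :: "'a cone_quotient" is 0 .
lift_definition one_cone_quotient :: "'a cone_quotient" is 1 .
lift_definition plus_cone_quotient :: "'a cone_quotient \<Rightarrow> 'a cone_quotient \<Rightarrow> 'a cone_quotient" is "(+)"
proof -
  fix p q p' q' :: "'a rpoly"
  assume "p - q \<in> tc.support" "p' - q' \<in> tc.support"
  then have "(p - q) + (p' - q') \<in> tc.support" by (rule tc.support_add)
  then show "(p + p') - (q + q') \<in> tc.support" by (simp add: algebra_simps)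
qed
lift_definition uminus_cone_quotient :: "'a cone_quotient \<Rightarrow> 'a cone_quotient" is uminus
  by (subst minus_diff_minus) (simp only: tc.support_uminus)
lift_definition times_cone_quotient :: "'a cone_quotient \<Rightarrow> 'a cone_quotient \<Rightarrow> 'a cone_quotient" is "(*)"
proof -
  fix p q p' q' :: "'a rpoly"
  assume "p - q \<in> tc.support" "p' - q' \<in> tc.support"
  then have "(p - q) * p' + (p' - q') * q \<in> tc.support"
    by (intro tc.support_add tc.support_mult)
  then show "p * p' - q * q' \<in> tc.support" by (simp add: algebra_simps)
qed
lift_definition less_eq_cone_quotient :: "'a cone_quotient \<Rightarrow> 'a cone_quotient \<Rightarrow> bool"
  is "\<lambda>p q. q - p \<in> test_cone"
proof -
  fix p q p' q' :: "'a rpoly"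
  assume "p - q \<in> tc.support" "p' - q' \<in> tc.support"
  then have "(p' - q') + - (p - q) \<in> tc.support"
    by (intro tc.support_add) (simp_all only: tc.support_uminus)
  then have "(p' - p) - (q' - q) \<in> tc.support" by (simp add: algebra_simps)
  then show "p' - p \<in> test_cone \<longleftrightarrow> q' - q \<in> test_cone" by (rule tc.cone_cong)
qed

definition minus_cone_quotient :: "'a cone_quotient \<Rightarrow> 'a cone_quotient \<Rightarrow> 'a cone_quotient" where
  "x - y = x + - (y :: 'a cone_quotient)"
definition less_cone_quotient :: "'a cone_quotient \<Rightarrow> 'a cone_quotient \<Rightarrow> bool" where
  "x < y \<longleftrightarrow> x \<le> y \<and> x \<noteq> (y :: 'a cone_quotient)"
definition abs_value_cone_quotient_def:
  "\<bar>x\<bar> = (if x < 0 then - x else (x :: 'a cone_quotient))"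
definition sgn_cone_quotient :: "'a cone_quotient \<Rightarrow> 'a cone_quotient" where
  "sgn x = (if x = 0 then 0 else if 0 < x then 1 else - (1 :: 'a cone_quotient))"

instance
proof
  fix x y z :: "'a cone_quotient"
  show "x + y + z = x + (y + z)" "x + y = y + x" "0 + x = x" "- x + x = 0" "x - y = x + - y"
    "x * y * z = x * (y * z)" "x * y = y * x" "1 * x = x" "(x + y) * z = x * z + y * z"
    "x + y - x = y" "x - y - z = x - (y + z)" "0 * x = 0" "x * 0 = 0"
    unfolding minus_cone_quotient_def
    by (transfer, rule tc.support_eq, simp add: algebra_simps)+
  show "(0 :: 'a cone_quotient) \<noteq> 1"
    by transfer (simp add: tc.one_notin_support tc.support_uminus)
  show refl: "x \<le> x" by transfer (simp add: tc.zero)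
  show trans: "x \<le> y \<Longrightarrow> y \<le> z \<Longrightarrow> x \<le> z" for x y z :: "'a cone_quotient"
    by transfer (rule tc.trans)
  show antisym: "x \<le> y \<Longrightarrow> y \<le> x \<Longrightarrow> x = y" for x y :: "'a cone_quotient"
    by transfer (simp add: tc.support_def)
  show "x < y \<longleftrightarrow> x \<le> y \<and> \<not> y \<le> x"
    using antisym refl by (auto simp: less_cone_quotient_def)
  show linear: "x \<le> y \<or> y \<le> x"
    by transfer (rule tc.linear)
  show "x \<le> y \<Longrightarrow> z + x \<le> z + y"
    by transfer simp
  have mult_pos: "0 \<le> a \<Longrightarrow> 0 \<le> b \<Longrightarrow> 0 \<le> a * b" for a b :: "'a cone_quotient"
    by transfer (simp add: tc.mult)
  have mult_nz: "a * b = 0 \<Longrightarrow> a = 0 \<or> b = 0" for a b :: "'a cone_quotient"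
    by transfer (simp only: diff_zero tc.support_prime)
  have diff: "a \<le> b \<longleftrightarrow> 0 \<le> b + - a" for a b :: "'a cone_quotient"
    by transfer simp
  have dist: "z * y + - (z * x) = z * (y + - x)"
    by (transfer, rule tc.support_eq, simp add: algebra_simps)
  have eq: "b + - a = 0 \<longleftrightarrow> b = a" for a b :: "'a cone_quotient"
    by transfer simp
  assume xy: "x < y" and z: "0 < z"
  then have "0 \<le> z * (y + - x)"
    using mult_pos diff unfolding less_cone_quotient_def by blast
  then have "z * x \<le> z * y" using diff[of "z * x" "z * y"] dist by simp
  moreover have "z * x \<noteq> z * y"
  proof
    assume "z * x = z * y"
    then have "z * (y + - x) = 0" unfolding dist[symmetric] eq by simp
    then show False using mult_nz[of z "y + - x"] eq[of y x] xy z unfolding less_cone_quotient_def by blast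
  qed
  ultimately show "z * x < z * y" unfolding less_cone_quotient_def by blast
qed (auto simp: abs_value_cone_quotient_def sgn_cone_quotient_def)

end

lift_definition to_quotient :: "'n::finite rpoly \<Rightarrow> 'n cone_quotient" is "\<lambda>p. p" .

lemma ring_morphism_to_quotient: "ring_morphism to_quotient"
proof (rule ring_morphism.intro)
  show "to_quotient 1 = 1" by transfer (simp add: tc.support_zero)
  show "to_quotient (x + y) = to_quotient x + to_quotient y" for x y :: "'a rpoly"
    by transfer (simp add: tc.support_zero)
  show "to_quotient (x * y) = to_quotient x * to_quotient y" for x y :: "'a rpoly"
    by transfer (simp add: tc.support_zero)
qed

lemma to_quotient_nonneg: "0 \<le> to_quotient p \<longleftrightarrow> p \<in> test_cone"
  by transfer simp

lemma ring_morphism_Fract: "ring_morphism (\<lambda>x. Fract x 1)"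
  by (rule ring_morphism.intro) (simp_all add: One_fract_def)

lemma sign_eq_nonneg: "sign_eq x y \<Longrightarrow> 0 \<le> x \<longleftrightarrow> 0 \<le> y"
  by (simp add: sign_eq_def flip: not_less)

lemma prime_cone_realized:
  fixes T :: "'n::finite rpoly set"
  assumes "prime_cone T"
  shows "realized T"
proof (rule realized_if_test_cone[OF _ assms])
  define h :: "'n rpoly \<Rightarrow> 'n cone_quotient fract real_closure" where
    "h = to_real_closure \<circ> ((\<lambda>x. Fract x 1) \<circ> to_quotient)"
  have hom: "ring_morphism h"
    unfolding h_def by (intro ring_morphism_compose ring_morphism_to_real_closure
        ring_morphism_Fract ring_morphism_to_quotient)
  then interpret h: ring_morphism h .
  have nonneg: "0 \<le> h p \<longleftrightarrow> p \<in> test_cone" for p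
  proof -
    have "0 \<le> h p \<longleftrightarrow> 0 \<le> Fract (to_quotient p) 1"
      using sign_eq_nonneg[OF sign_eq_to_real_closure] by (simp add: h_def)
    also have "\<dots> \<longleftrightarrow> p \<in> test_cone"
      by (simp add: zero_le_Fract_iff to_quotient_nonneg)
    finally show ?thesis .
  qed
  have \<iota>: "ring_morphism (h \<circ> rconst)"
    by (intro ring_morphism_compose hom ring_morphism_rconst)
  then interpret \<iota>: ring_morphism "h \<circ> rconst" .
  \<comment> \<open>A positive real is a square and a unit, so its image is a nonzero square; this
    fixes the order on the constants.\<close>
  have pos: "0 < (h \<circ> rconst) c" if "0 < c" for c
  proof -
    have "(h \<circ> rconst) c = (h \<circ> rconst) (sqrt c) ^ 2"
      using that unfolding \<iota>.power[symmetric] by simp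
    moreover have "(h \<circ> rconst) c * (h \<circ> rconst) (inverse c) = 1"
      using that \<iota>.mult[of c "inverse c"] \<iota>.one by simp
    ultimately show ?thesis by (cases "(h \<circ> rconst) (sqrt c) = 0") simp_all
  qed
  have "sign_eq ((h \<circ> rconst) c) c" for c
    using pos[of c] pos[of "- c"] \<iota>.zero \<iota>.uminus[of c]
    by (cases c "0::real" rule: linorder_cases) (auto simp: sign_eq_def)
  note tr = sign_transfer_variables[OF \<iota> this, of UNIV]
  show "realized (test_cone :: 'n rpoly set)"
    unfolding realized_def
  proof (intro allI impI)
    fix P :: "'n rpoly set"
    assume P: "finite P"
    obtain z where z: "\<forall>p\<in>P. sign_eq (reval_in (h \<circ> rconst) (h \<circ> rvar) p) (reval_in id z p)"
      using tr[OF finite P, of "h \<circ> rvar"] by blast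
    have z_eq: "vec_nth (vec_lambda z) = z" by (simp add: fun_eq_iff)
    have "p \<in> test_cone \<longleftrightarrow> 0 \<le> reval p (vec_lambda z)" if "p \<in> P" for p
      using sign_eq_nonneg[OF bspec[OF z that]] nonneg[of p] reval_in_unique[OF hom, of p]
      by (simp add: reval_eq_reval_in z_eq)
    then show "\<exists>x. \<forall>p\<in>P. p \<in> test_cone \<longleftrightarrow> 0 \<le> reval p x" by blast
  qed
qed

section \<open>The Positivstellensatz\<close>

text \<open>The elements of \<open>S\<close> are to be strictly positive with respect to the cone:
  each \<open>s\<close> belongs to it and \<open>- s\<close> does not.\<close>

definition precone_avoiding :: "'a::comm_ring_1 set \<Rightarrow> 'a set \<Rightarrow> bool" where
  "precone_avoiding S T \<longleftrightarrow> (\<forall>x\<in>T. \<forall>y\<in>T. x + y \<in> T \<and> x * y \<in> T) \<and> (\<forall>x. x * x \<in> T)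
     \<and> S \<subseteq> T \<and> (\<forall>s\<in>S. - s \<notin> T)"

text \<open>By Zorn: a precone that is maximal among those disjoint from \<open>- S\<close> is a prime cone.\<close>

lemma prime_cone_exists:
  fixes S T0 :: "'a::comm_ring_1 set"
  assumes T0: "precone_avoiding S T0" and S: "1 \<in> S" "\<And>s t. s \<in> S \<Longrightarrow> t \<in> S \<Longrightarrow> s * t \<in> S"
  shows "\<exists>T. T0 \<subseteq> T \<and> prime_cone T \<and> (\<forall>s\<in>S. - s \<notin> T)"
proof -
  have "\<exists>T. T0 \<subseteq> T \<and> precone_avoiding S T \<and> (\<forall>N. precone_avoiding S N \<longrightarrow> T \<subseteq> N \<longrightarrow> N = T)"
  proof (rule maximal_subset_exists[where R = "precone_avoiding S", OF T0])
    fix \<C> :: "'a set set"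
    assume ne: "\<C> \<noteq> {}" and pc: "\<And>M. M \<in> \<C> \<Longrightarrow> precone_avoiding S M"
      and two: "\<And>x y. x \<in> \<Union>\<C> \<Longrightarrow> y \<in> \<Union>\<C> \<Longrightarrow> \<exists>M\<in>\<C>. x \<in> M \<and> y \<in> M"
    have "x + y \<in> \<Union>\<C>" "x * y \<in> \<Union>\<C>" if xy: "x \<in> \<Union>\<C>" "y \<in> \<Union>\<C>" for x y
    proof -
      obtain M where M: "M \<in> \<C>" "x \<in> M" "y \<in> M" using two[OF xy] by blast
      then have "x + y \<in> M" "x * y \<in> M" using pc[OF M(1)] unfolding precone_avoiding_def by blast+
      then show "x + y \<in> \<Union>\<C>" "x * y \<in> \<Union>\<C>" using M(1) by blast+
    qed
    moreover obtain M where M: "M \<in> \<C>" using ne by blast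
    have "x * x \<in> \<Union>\<C>" for x using pc[OF M] M unfolding precone_avoiding_def by blast
    moreover have "S \<subseteq> \<Union>\<C>" using pc[OF M] M unfolding precone_avoiding_def by blast
    moreover have "\<forall>s\<in>S. - s \<notin> \<Union>\<C>" using pc unfolding precone_avoiding_def by blast
    ultimately show "precone_avoiding S (\<Union>\<C>)" unfolding precone_avoiding_def by simp
  qed
  then obtain T where T: "T0 \<subseteq> T" "precone_avoiding S T"
    and max: "\<And>N. precone_avoiding S N \<Longrightarrow> T \<subseteq> N \<Longrightarrow> N = T" by blast
  have add: "x + y \<in> T" and mult: "x * y \<in> T" if "x \<in> T" "y \<in> T" for x y
    using T(2) that by (auto simp: precone_avoiding_def)
  have sq: "x * x \<in> T" for x using T(2) by (auto simp: precone_avoiding_def)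
  have ST: "S \<subseteq> T" and avoid: "- s \<notin> T" if "s \<in> S" for s
    using T(2) that by (auto simp: precone_avoiding_def)
  have zero: "0 \<in> T" and one: "1 \<in> T" using sq[of 0] sq[of 1] by auto
  have extend: "\<exists>s\<in>S. \<exists>t\<in>T. \<exists>u\<in>T. - s = t + a * u" if a: "a \<notin> T" for a
  proof (rule ccontr)
    assume none: "\<not> ?thesis"
    define N where "N = {t + a * u | t u. t \<in> T \<and> u \<in> T}"
    have TN: "T \<subseteq> N"
    proof
      fix t assume "t \<in> T"
      then have "t + a * 0 \<in> N" using zero unfolding N_def by blast
      then show "t \<in> N" by simp
    qed
    have "x + y \<in> N \<and> x * y \<in> N" if xy: "x \<in> N" "y \<in> N" for x y
    proof -
      obtain t u t' u' where tu: "t \<in> T" "u \<in> T" "t' \<in> T" "u' \<in> T" "x = t + a * u" "y = t' + a * u'"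
        using xy unfolding N_def by blast
      have "x + y = (t + t') + a * (u + u')" unfolding tu(5,6) by (simp add: algebra_simps)
      moreover have "x * y = (t * t' + a * a * (u * u')) + a * (t * u' + u * t')"
        unfolding tu(5,6) by (simp add: algebra_simps)
      moreover have "t + t' \<in> T" "u + u' \<in> T" "t * t' + a * a * (u * u') \<in> T" "t * u' + u * t' \<in> T"
        using tu(1-4) by (auto intro!: add mult sq)
      ultimately show ?thesis unfolding N_def by blast
    qed
    moreover have "- s \<notin> N" if "s \<in> S" for s using none that unfolding N_def by blast
    ultimately have "precone_avoiding S N"
      using TN ST sq unfolding precone_avoiding_def by blast
    then have "N = T" using max TN by blast
    moreover have "0 + a * 1 \<in> N" using zero one unfolding N_def by blast
    ultimately show False using a by simp
  qed
  have total: "a \<in> T \<or> - a \<in> T" for a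
  proof (rule ccontr)
    assume "\<not> ?thesis"
    then obtain s t u s' t' u' where st: "s \<in> S" "t \<in> T" "u \<in> T" "- s = t + a * u"
      "s' \<in> S" "t' \<in> T" "u' \<in> T" "- s' = t' + - a * u'" using extend by meson
    have "s = - (t + a * u)" "s' = - (t' + - a * u')"
      unfolding st(4,8)[symmetric] by simp_all
    then have e: "s + t = - a * u" "s' + t' = a * u'" by simp_all
    \<comment> \<open>Multiplying the two relations replaces \<open>a\<close> by its square, which
      exhibits \<open>- (s * s')\<close> as an element of \<open>T\<close>.\<close>
    have "s * t' + t * s' + t * t' = (s + t) * (s' + t') - s * s'" by (simp add: algebra_simps)
    also have "(s + t) * (s' + t') = - (a * a * (u * u'))" unfolding e by (simp add: algebra_simps)
    finally have "- (s * s') = s * t' + t * s' + t * t' + a * a * (u * u')" by simp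
    moreover have "s * t' + t * s' + t * t' + a * a * (u * u') \<in> T"
      using st ST by (auto intro!: add mult sq)
    ultimately show False using avoid S(2) st(1,5) by metis
  qed
  have ideal: "x * y \<in> T \<and> - (x * y) \<in> T" if "x \<in> T" "- x \<in> T" for x y
    using total[of y] mult[of x y] mult[of "- x" y] mult[of x "- y"] mult[of "- x" "- y"] that by auto
  \<comment> \<open>For primality a multiple of \<open>x\<close> suffices, so the sign of
    \<open>x\<close> is absorbed into \<open>u\<close>, which may be any ring element.\<close>
  have outside: "\<exists>s\<in>S. \<exists>t\<in>T. \<exists>u. s + t = x * u" if "\<not> (x \<in> T \<and> - x \<in> T)" for x
  proof -
    have "x \<notin> T \<or> - x \<notin> T" using that by blast
    then consider s t u where "s \<in> S" "t \<in> T" "- s = t + x * u" | s t u where "s \<in> S" "t \<in> T" "- s = t + - x * u"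
      using extend by meson
    then show ?thesis
    proof cases
      case 1
      have "s = - (t + x * u)" unfolding 1(3)[symmetric] by simp
      then have "s + t = x * - u" by simp
      then show ?thesis using 1 by blast
    next
      case 2
      have "s = - (t + - x * u)" unfolding 2(3)[symmetric] by simp
      then have "s + t = x * u" by simp
      then show ?thesis using 2 by blast
    qed
  qed
  have prime: "x \<in> T \<and> - x \<in> T \<or> y \<in> T \<and> - y \<in> T" if xy: "x * y \<in> T" "- (x * y) \<in> T" for x y
  proof (rule ccontr)
    assume "\<not> ?thesis"
    then obtain s t u s' t' u' where st: "s \<in> S" "t \<in> T" "s + t = x * u"
      "s' \<in> S" "t' \<in> T" "s' + t' = y * u'" using outside by meson
    \<comment> \<open>The product is a multiple of \<open>x * y\<close>, so its negative is in
      \<open>T\<close>; adding the mixed terms leaves \<open>- (s * s')\<close>.\<close>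
    have "(s + t) * (s' + t') = x * y * (u * u')" unfolding st by (simp add: algebra_simps)
    then have "- ((s + t) * (s' + t')) \<in> T" using ideal[OF xy] by metis
    moreover have "s * t' + t * s' + t * t' \<in> T" using st ST by (auto intro!: add mult)
    ultimately have "- ((s + t) * (s' + t')) + (s * t' + t * s' + t * t') \<in> T" by (rule add)
    moreover have "- ((s + t) * (s' + t')) + (s * t' + t * s' + t * t') = - (s * s')"
      by (simp add: algebra_simps)
    ultimately show False using avoid S(2) st(1,4) by metis
  qed
  have "prime_cone T" unfolding prime_cone_def
    using add mult total avoid[OF S(1)] prime by blast
  then show ?thesis using T(1) avoid by (intro exI[of _ T]) simp
qed

section \<open>Sums of squares and the certificate for an ideal\<close>

lemma sos_zero: "0 \<in> sos"
  unfolding sos_def by (auto intro: exI[of _ "[]"])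

lemma sos_square: "p ^ 2 \<in> sos"
  unfolding sos_def by (auto intro: exI[of _ "[p]"])

lemma sos_add: "p \<in> sos \<Longrightarrow> q \<in> sos \<Longrightarrow> p + q \<in> sos"
  unfolding sos_def by (force intro: exI[of _ "_ @ _"])

lemma sos_induct [consumes 1, case_names zero add]:
  assumes "p \<in> sos" "P 0" "\<And>p q. q \<in> sos \<Longrightarrow> P q \<Longrightarrow> P (p ^ 2 + q)"
  shows "P p"
proof -
  have "P (\<Sum>q\<leftarrow>qs. q ^ 2)" for qs
  proof (induction qs)
    case (Cons q qs)
    have "(\<Sum>q\<leftarrow>qs. q ^ 2) \<in> sos" unfolding sos_def by blast
    then show ?case using assms(3)[OF _ Cons] by simp
  qed (simp add: assms(2))
  then show ?thesis using assms(1) unfolding sos_def by auto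
qed

lemma sos_square_mult: "q \<in> sos \<Longrightarrow> p ^ 2 * q \<in> sos"
proof (induction q rule: sos_induct)
  case (add r q)
  have "p ^ 2 * (r ^ 2 + q) = (p * r) ^ 2 + p ^ 2 * q" by (simp add: algebra_simps power2_eq_square)
  then show ?case using add sos_add sos_square by metis
qed (simp add: sos_zero)

lemma sos_mult: "p \<in> sos \<Longrightarrow> q \<in> sos \<Longrightarrow> p * q \<in> sos"
proof (induction p rule: sos_induct)
  case (add r p)
  then show ?case by (simp add: distrib_right sos_add sos_square_mult)
qed (simp add: sos_zero)

lemma sos_nonneg: "p \<in> sos \<Longrightarrow> 0 \<le> reval p x"
proof (induction p rule: sos_induct)
  case zero
  then show ?case by (simp add: reval_def)
next
  case (add r p)
  interpret ring_morphism "\<lambda>p. reval p x" by (rule ring_morphism_reval)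
  show ?case using add.IH by (simp add: add power)
qed

text \<open>Without a certificate the cone \<open>T0\<close> generated by the sums of squares, the
  ideal \<open>I\<close> and \<open>- q\<close> avoids the negated even powers of \<open>q\<close>.
  Modulo a prime cone above it, \<open>I\<close> vanishes and \<open>q\<close> is strictly negative.
  A point realises finitely many conditions only, so vanishing is tested on the finite set
  \<open>E\<close>.\<close>

theorem positivstellensatz:
  fixes q :: "'n::finite rpoly" and I E :: "'n rpoly set"
  assumes E: "finite E" "E \<subseteq> I"
    and I: "0 \<in> I" "\<And>x y. x \<in> I \<Longrightarrow> y \<in> I \<Longrightarrow> x + y \<in> I" "\<And>x y. x \<in> I \<Longrightarrow> x * y \<in> I"
    and empty: "\<And>x. (\<And>e. e \<in> E \<Longrightarrow> reval e x = 0) \<Longrightarrow> 0 \<le> reval q x"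
  shows "\<exists>a. \<exists>s\<in>sos. \<exists>t\<in>sos. \<exists>e\<in>I. t * q - (s + e) - q ^ (2 * a) = 0"
proof (rule ccontr)
  assume none: "\<not> ?thesis"
  define T0 where "T0 = {s - t * q + e | s t e. s \<in> sos \<and> t \<in> sos \<and> e \<in> I}"
  define S where "S = range (\<lambda>a. q ^ (2 * a))"
  have sosT: "s \<in> T0" if "s \<in> sos" for s
  proof -
    have "s - 0 * q + 0 \<in> T0" using that sos_zero I(1) unfolding T0_def by blast
    then show ?thesis by simp
  qed
  have IT: "e \<in> T0" if "e \<in> I" for e
  proof -
    have "0 - 0 * q + e \<in> T0" using that sos_zero unfolding T0_def by blast
    then show ?thesis by simp
  qed
  have qT: "- q \<in> T0"
  proof -
    have "0 - 1 ^ 2 * q + 0 \<in> T0" using sos_zero sos_square I(1) unfolding T0_def by blast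
    then show ?thesis by simp
  qed
  have closed: "x + y \<in> T0 \<and> x * y \<in> T0" if xy: "x \<in> T0" "y \<in> T0" for x y
  proof -
    obtain s t e s' t' e' where x: "s \<in> sos" "t \<in> sos" "e \<in> I" "x = s - t * q + e"
      and y: "s' \<in> sos" "t' \<in> sos" "e' \<in> I" "y = s' - t' * q + e'"
      using xy unfolding T0_def by blast
    have "x + y = (s + s') - (t + t') * q + (e + e')"
      unfolding x y by (simp add: algebra_simps)
    moreover have "x * y = (s * s' + q ^ 2 * (t * t')) - (s * t' + t * s') * q
        + (e * (s' - t' * q + e') + e' * (s - t * q))"
      unfolding x y by (simp add: algebra_simps power2_eq_square)
    moreover have "s + s' \<in> sos" "t + t' \<in> sos" "e + e' \<in> I" "s * s' + q ^ 2 * (t * t') \<in> sos"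
      "s * t' + t * s' \<in> sos" "e * (s' - t' * q + e') + e' * (s - t * q) \<in> I"
      using x y by (auto intro!: sos_add sos_mult sos_square_mult I(2,3))
    ultimately show ?thesis unfolding T0_def by blast
  qed
  have Ssos: "S \<subseteq> sos"
  proof
    fix s assume "s \<in> S"
    then obtain a where "s = q ^ (2 * a)" unfolding S_def by blast
    then have "s = (q ^ a) ^ 2" by (simp flip: power_mult add: mult.commute)
    then show "s \<in> sos" using sos_square by simp
  qed
  have "- s \<notin> T0" if s: "s \<in> S" for s
  proof
    assume "- s \<in> T0"
    then obtain u t e a where *: "u \<in> sos" "t \<in> sos" "e \<in> I" "- s = u - t * q + e" "s = q ^ (2 * a)"
      using s unfolding T0_def S_def by blast
    have "s = - (u - t * q + e)" unfolding *(4)[symmetric] by simp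
    then have "t * q - (u + e) - q ^ (2 * a) = 0" unfolding *(5)[symmetric] by simp
    then show False using none *(1-3) by blast
  qed
  moreover have "x * x \<in> T0" for x using sosT[OF sos_square[of x]] by (simp add: power2_eq_square)
  ultimately have pc: "precone_avoiding S T0"
    using closed sosT Ssos unfolding precone_avoiding_def by blast
  have S1: "1 \<in> S" unfolding S_def by (rule image_eqI[of _ _ 0]) simp_all
  have Smult: "s * t \<in> S" if st: "s \<in> S" "t \<in> S" for s t
  proof -
    obtain a c where "s = q ^ (2 * a)" "t = q ^ (2 * c)" using st unfolding S_def by blast
    then have "s * t = q ^ (2 * (a + c))" by (simp add: power_add distrib_left)
    then show ?thesis unfolding S_def by blast
  qed
  obtain T where T: "T0 \<subseteq> T" "prime_cone T" "\<forall>s\<in>S. - s \<notin> T"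
    using prime_cone_exists[OF pc S1 Smult] by auto
  interpret T: prime_cone_ring T by standard (rule T(2))
  have "q \<notin> T"
  proof
    assume "q \<in> T"
    then have "q * - q \<in> T" using qT T(1) by (intro T.mult) auto
    then have "- (q ^ (2 * 1)) \<in> T" by (simp add: power2_eq_square)
    then show False using T(3) unfolding S_def by blast
  qed
  obtain x where x: "\<forall>p\<in>insert q (E \<union> uminus ` E). p \<in> T \<longleftrightarrow> 0 \<le> reval p x"
    using prime_cone_realized[OF T(2)] E(1) unfolding realized_def by (meson finite_UnI finite_imageI finite_insert)
  interpret ring_morphism "\<lambda>p. reval p x" by (rule ring_morphism_reval)
  have "reval e x = 0" if e: "e \<in> E" for e
  proof -
    have "e * - 1 \<in> I" using E(2) e I(3) by blast
    then have "e \<in> T" "- e \<in> T" using IT[of e] IT[of "- e"] E(2) e T(1) by auto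
    then have "0 \<le> reval e x" "0 \<le> reval (- e) x" using x e by auto
    then show ?thesis by (simp add: uminus)
  qed
  then have "0 \<le> reval q x" by (rule empty)
  then show False using x \<open>q \<notin> T\<close> by blast
qed

section \<open>Archimedean quadratic modules\<close>

definition proper_module :: "'n::finite rpoly set \<Rightarrow> bool" where
  "proper_module Q \<longleftrightarrow> 1 \<in> Q \<and> - 1 \<notin> Q \<and> (\<forall>x\<in>Q. \<forall>y\<in>Q. x + y \<in> Q) \<and> (\<forall>p. \<forall>x\<in>Q. p ^ 2 * x \<in> Q)"

locale maximal_module =
  fixes Q :: "'n::finite rpoly set"
  assumes proper: "proper_module Q"
    and maximal: "\<And>N. proper_module N \<Longrightarrow> Q \<subseteq> N \<Longrightarrow> N = Q"
begin

lemma one: "1 \<in> Q" and minus_one: "- 1 \<notin> Q"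
  and add: "x \<in> Q \<Longrightarrow> y \<in> Q \<Longrightarrow> x + y \<in> Q"
  and square_mult: "x \<in> Q \<Longrightarrow> p ^ 2 * x \<in> Q"
  using proper by (auto simp: proper_module_def)

sublocale rconst: ring_morphism "rconst :: real \<Rightarrow> 'n rpoly"
  by (rule ring_morphism_rconst)

lemma square: "p ^ 2 \<in> Q"
  using square_mult[OF one, of p] by simp

lemma zero: "0 \<in> Q"
  using square[of 0] by simp

lemma sos_mult_mem: "s \<in> sos \<Longrightarrow> x \<in> Q \<Longrightarrow> s * x \<in> Q"
  by (induction s rule: sos_induct) (simp_all add: zero distrib_right add square_mult)

lemma sos_mem: "s \<in> sos \<Longrightarrow> s \<in> Q"
  using sos_mult_mem[OF _ one] by simp

lemma rconst_mult_mem: "0 \<le> c \<Longrightarrow> x \<in> Q \<Longrightarrow> rconst c * x \<in> Q"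
  using square_mult[of x "rconst (sqrt c)"] by (simp flip: rconst.power)

lemma rconst_mem_iff: "rconst c \<in> Q \<longleftrightarrow> 0 \<le> c"
proof
  assume c: "rconst c \<in> Q"
  show "0 \<le> c"
  proof (rule ccontr)
    assume "\<not> 0 \<le> c"
    then have "rconst (- inverse c) * rconst c \<in> Q" using c by (intro rconst_mult_mem) auto
    moreover have "rconst (- inverse c) * rconst c = (- 1 :: 'n rpoly)"
      using \<open>\<not> 0 \<le> c\<close> by (simp add: rconst.one rconst.uminus flip: rconst.mult)
    ultimately show False using minus_one by simp
  qed
next
  assume "0 \<le> c"
  then show "rconst c \<in> Q" using rconst_mult_mem[OF _ one, of c] by simp
qed

text \<open>A quadratic module is closed under multiplication by squares, and every \<open>p\<close>
  is the difference of the squares of \<open>(p + 1) / 2\<close> and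
  \<open>(p - 1) / 2\<close>.\<close>

lemma ideal: "x \<in> Q \<Longrightarrow> - x \<in> Q \<Longrightarrow> p * x \<in> Q"
proof -
  assume x: "x \<in> Q" "- x \<in> Q"
  let ?h = "rconst (1 / 2) :: 'n rpoly"
  have two: "?h + ?h = 1" by (simp add: rconst.one flip: rconst.add)
  define A where "A = ?h * (p + 1)"
  define B where "B = ?h * (p - 1)"
  have "p = (?h + ?h) * (?h + ?h) * p" using two by simp
  also have "\<dots> = A ^ 2 - B ^ 2"
    by (simp add: A_def B_def algebra_simps power2_eq_square)
  finally have "p * x = (A ^ 2 - B ^ 2) * x" by (rule arg_cong)
  also have "\<dots> = A ^ 2 * x + B ^ 2 * (- x)" by (simp add: left_diff_distrib)
  finally show ?thesis using add[OF square_mult[OF x(1)] square_mult[OF x(2)]] by simp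
qed

lemma extend:
  assumes "a \<notin> Q"
  shows "\<exists>m\<in>Q. \<exists>s\<in>sos. - 1 = m + s * a"
proof (rule ccontr)
  assume none: "\<not> ?thesis"
  define N where "N = {m + s * a | m s. m \<in> Q \<and> s \<in> sos}"
  have QN: "Q \<subseteq> N"
  proof
    fix m assume "m \<in> Q"
    then have "m + 0 * a \<in> N" using sos_zero unfolding N_def by blast
    then show "m \<in> N" by simp
  qed
  have "x + y \<in> N" if xy: "x \<in> N" "y \<in> N" for x y
  proof -
    obtain m s m' s' where ms: "m \<in> Q" "s \<in> sos" "m' \<in> Q" "s' \<in> sos" "x = m + s * a" "y = m' + s' * a"
      using xy unfolding N_def by blast
    have "x + y = (m + m') + (s + s') * a" unfolding ms by (simp add: algebra_simps)
    then show ?thesis using add[OF ms(1,3)] sos_add[OF ms(2,4)] unfolding N_def by blast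
  qed
  moreover have "p ^ 2 * x \<in> N" if x: "x \<in> N" for p x
  proof -
    obtain m s where ms: "m \<in> Q" "s \<in> sos" "x = m + s * a" using x unfolding N_def by blast
    have "p ^ 2 * x = p ^ 2 * m + (p ^ 2 * s) * a" unfolding ms by (simp add: algebra_simps)
    then show ?thesis using square_mult[OF ms(1)] sos_square_mult[OF ms(2)] unfolding N_def by blast
  qed
  moreover have "- 1 \<notin> N" using none unfolding N_def by blast
  ultimately have "proper_module N" using one QN unfolding proper_module_def by blast
  then have "N = Q" using maximal QN by blast
  moreover have "0 + 1 ^ 2 * a \<in> N" using zero sos_square unfolding N_def by blast
  ultimately show False using assms by simp
qed

text \<open>Products of elements of \<open>Q\<close> are not at hand, so the relations
  \<open>- 1 = m + s * a\<close> and \<open>- 1 = m' - s' * a\<close> are weighted by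
  \<open>s'\<close> and \<open>s\<close>; this cancels \<open>a\<close> and gives \<open>- s\<close>
  in \<open>Q\<close>. Then \<open>s\<close>, and with it \<open>s * a\<close>, lies in the ideal of
  those elements of \<open>Q\<close> whose negatives are in \<open>Q\<close>, so that
  \<open>- 1 = m + s * a\<close> would be in \<open>Q\<close>.\<close>

lemma total: "a \<in> Q \<or> - a \<in> Q"
proof (rule ccontr)
  assume "\<not> ?thesis"
  then obtain m s m' s' where ms: "m \<in> Q" "s \<in> sos" "- 1 = m + s * a"
    "m' \<in> Q" "s' \<in> sos" "- 1 = m' + s' * - a" using extend[of a] extend[of "- a"] by blast
  have "s' * (- 1) + s * (- 1) = s' * (m + s * a) + s * (m' + s' * - a)"
    using ms(3,6) by simp
  then have eq: "- s' - s = s' * m + s * m'" by (simp add: algebra_simps)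
  have "- s = s' + (s' * m + s * m')" unfolding eq[symmetric] by simp
  also have "\<dots> \<in> Q"
    using add[OF sos_mem[OF ms(5)] add[OF sos_mult_mem[OF ms(5,1)] sos_mult_mem[OF ms(2,4)]]] .
  finally have "- s \<in> Q" .
  then have "a * s \<in> Q" using ideal sos_mem ms(2) by blast
  moreover have "- (a * s) \<in> Q"
    using ideal[of "- s" a] \<open>- s \<in> Q\<close> sos_mem[OF ms(2)] by simp
  ultimately have "m + s * a \<in> Q" using add ms(1) by (simp add: mult.commute)
  then show False using minus_one ms(3) by simp
qed

section \<open>Bounded elements\<close>

definition bounded_elements :: "'n rpoly set" where
  "bounded_elements = {p. \<exists>N. rconst N - p \<in> Q \<and> rconst N + p \<in> Q}"

lemma bounded_rconst: "rconst c \<in> bounded_elements"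
  unfolding bounded_elements_def
  by (auto intro!: exI[of _ "\<bar>c\<bar>"] simp: rconst_mem_iff simp flip: rconst.diff rconst.add)

lemma bounded_add:
  assumes "p \<in> bounded_elements" "q \<in> bounded_elements"
  shows "p + q \<in> bounded_elements"
proof -
  obtain M N where "rconst M - p \<in> Q" "rconst M + p \<in> Q" "rconst N - q \<in> Q" "rconst N + q \<in> Q"
    using assms unfolding bounded_elements_def by blast
  then have "rconst (M + N) - (p + q) \<in> Q" "rconst (M + N) + (p + q) \<in> Q"
    using add[of "rconst M - p" "rconst N - q"] add[of "rconst M + p" "rconst N + q"]
    by (simp_all add: rconst.add algebra_simps)
  then show ?thesis unfolding bounded_elements_def by blast
qed

lemma bounded_uminus: "p \<in> bounded_elements \<Longrightarrow> - p \<in> bounded_elements"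
  unfolding bounded_elements_def by auto

text \<open>\<open>2 N (N\<^sup>2 - p\<^sup>2) = (N + p)\<^sup>2 (N - p) + (N - p)\<^sup>2 (N + p)\<close>.\<close>

lemma square_bound:
  assumes N: "rconst N - p \<in> Q" "rconst N + p \<in> Q" "0 < N"
  shows "rconst (N ^ 2) - p ^ 2 \<in> Q"
proof -
  have "(rconst N + p) ^ 2 * (rconst N - p) + (rconst N - p) ^ 2 * (rconst N + p) \<in> Q"
    by (rule add[OF square_mult[OF N(1)] square_mult[OF N(2)]])
  also have "(rconst N + p) ^ 2 * (rconst N - p) + (rconst N - p) ^ 2 * (rconst N + p)
      = (rconst N + rconst N) * (rconst N ^ 2 - p ^ 2)"
    by (simp add: algebra_simps power2_eq_square)
  finally have "rconst (inverse (N + N)) * ((rconst N + rconst N) * (rconst N ^ 2 - p ^ 2)) \<in> Q"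
    using N(3) by (intro rconst_mult_mem) auto
  moreover have "rconst (inverse (N + N)) * (rconst N + rconst N) = (1 :: 'n rpoly)"
    using N(3) by (simp add: rconst.one flip: rconst.mult rconst.add)
  ultimately show ?thesis by (simp add: rconst.power flip: mult.assoc)
qed

lemma bounded_square:
  assumes "p \<in> bounded_elements"
  shows "p ^ 2 \<in> bounded_elements"
proof -
  obtain N where N: "rconst N - p \<in> Q" "rconst N + p \<in> Q"
    using assms unfolding bounded_elements_def by blast
  \<comment> \<open>\<open>square_bound\<close> requires a positive bound, which \<open>N\<close>
    need not be.\<close>
  define K where "K = \<bar>N\<bar> + 1"
  have "rconst (K - N) \<in> Q" by (simp add: rconst_mem_iff K_def)
  then have "rconst K - p \<in> Q" "rconst K + p \<in> Q"
    using add[of "rconst (K - N)" "rconst N - p"] add[of "rconst (K - N)" "rconst N + p"] N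
    by (simp_all add: rconst.diff)
  then have "rconst (K ^ 2) - p ^ 2 \<in> Q" by (rule square_bound) (simp add: K_def)
  moreover have "rconst (K ^ 2) + p ^ 2 \<in> Q" by (intro add square) (simp add: rconst_mem_iff)
  ultimately show ?thesis unfolding bounded_elements_def by blast
qed

lemma bounded_scale:
  assumes "p \<in> bounded_elements" "0 \<le> c"
  shows "rconst c * p \<in> bounded_elements"
proof -
  obtain N where "rconst N - p \<in> Q" "rconst N + p \<in> Q"
    using assms unfolding bounded_elements_def by blast
  then have "rconst c * (rconst N - p) \<in> Q" "rconst c * (rconst N + p) \<in> Q"
    using rconst_mult_mem assms(2) by blast+
  then have "rconst (c * N) - rconst c * p \<in> Q" "rconst (c * N) + rconst c * p \<in> Q"
    by (simp_all add: rconst.mult algebra_simps)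
  then show ?thesis unfolding bounded_elements_def by blast
qed

text \<open>Reduces products to squares, which a quadratic module controls. In the form
  \<open>+ -\<close> the closure rules for sums and negation apply directly.\<close>

lemma polarization:
  fixes p q :: "'n rpoly"
  shows "p * q = rconst (1 / 4) * ((p + q) ^ 2 + - ((p + - q) ^ 2))"
proof -
  have eq: "(p + q) ^ 2 + - ((p + - q) ^ 2) = 4 * (p * q)"
    by (simp add: algebra_simps power2_eq_square)
  have quarter: "rconst (1 / 4) * 4 = (1 :: 'n rpoly)"
  proof -
    have "rconst (1 / 4) * rconst 4 = (1 :: 'n rpoly)" by (simp add: rconst.one flip: rconst.mult)
    moreover have "rconst 4 = (4 :: 'n rpoly)" using rconst.of_nat[of 4] by simp
    ultimately show ?thesis by simp
  qed
  have "rconst (1 / 4) * ((p + q) ^ 2 + - ((p + - q) ^ 2)) = (rconst (1 / 4) * 4) * (p * q)"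
    unfolding eq by (simp only: mult.assoc)
  then show ?thesis by (simp only: quarter mult_1_left)
qed

lemma bounded_mult:
  assumes "p \<in> bounded_elements" "q \<in> bounded_elements"
  shows "p * q \<in> bounded_elements"
  unfolding polarization[of p q] using assms
  by (intro bounded_scale bounded_add bounded_uminus bounded_square) auto

text \<open>The bounded elements form a ring that contains the constants, so bounds on the variables
  suffice.\<close>

lemma bounded_all:
  assumes rvar: "\<And>i. rvar i \<in> bounded_elements"
  shows "p \<in> bounded_elements"
proof -
  have one: "1 \<in> bounded_elements" using bounded_rconst[of 1] by (simp add: rconst.one)
  have zero: "0 \<in> bounded_elements" using bounded_rconst[of 0] by (simp add: rconst.zero)
  have pow: "rvar i ^ k \<in> bounded_elements" for i k
    by (induction k) (simp_all add: one bounded_mult rvar)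
  have prod: "(\<Prod>i\<in>A. rvar i ^ k i) \<in> bounded_elements" for A and k :: "'n \<Rightarrow> nat"
    by (induction A rule: infinite_finite_induct) (simp_all add: one bounded_mult pow)
  have sum: "(\<Sum>\<alpha>\<in>A. f \<alpha>) \<in> bounded_elements" if "\<And>\<alpha>. f \<alpha> \<in> bounded_elements"
    for A and f :: "('n \<Rightarrow>\<^sub>0 nat) \<Rightarrow> 'n rpoly"
    by (induction A rule: infinite_finite_induct) (simp_all add: zero bounded_add that)
  have "(\<Sum>\<alpha>\<in>Poly_Mapping.keys p. Poly_Mapping.single \<alpha> (Poly_Mapping.lookup p \<alpha>)) \<in> bounded_elements"
    by (intro sum) (simp add: single_eq_rconst_times_rvars bounded_mult bounded_rconst prod)
  then show ?thesis by (simp flip: rpoly_sum_monomials)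
qed

text \<open>A Dedekind cut modulo \<open>Q\<close>; the slack \<open>\<epsilon>\<close> avoids the
  question whether the bounds are attained.\<close>

definition has_value :: "'n rpoly \<Rightarrow> real \<Rightarrow> bool" where
  "has_value p t \<longleftrightarrow> (\<forall>\<epsilon>>0. rconst (t + \<epsilon>) - p \<in> Q \<and> p - rconst (t - \<epsilon>) \<in> Q)"

lemma has_value_le:
  assumes "has_value p t" "has_value q u" "q - p \<in> Q"
  shows "t \<le> u"
proof (rule ccontr)
  assume "\<not> t \<le> u"
  \<comment> \<open>With a third of the gap, the two slacks still leave the negative constant
    \<open>u - t + 2 * \<epsilon> = - \<epsilon>\<close>.\<close>
  define \<epsilon> where "\<epsilon> = (t - u) / 3"
  have \<epsilon>: "\<epsilon> > 0" using \<open>\<not> t \<le> u\<close> by (simp add: \<epsilon>_def)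
  have "(p - rconst (t - \<epsilon>)) + (q - p) + (rconst (u + \<epsilon>) - q) \<in> Q"
    using assms \<epsilon> by (intro add) (auto simp: has_value_def)
  also have "(p - rconst (t - \<epsilon>)) + (q - p) + (rconst (u + \<epsilon>) - q) = rconst (u + \<epsilon>) - rconst (t - \<epsilon>)"
    by simp
  also have "\<dots> = rconst (u + \<epsilon> - (t - \<epsilon>))" by (simp only: rconst.diff)
  finally have "0 \<le> u + \<epsilon> - (t - \<epsilon>)" by (simp only: rconst_mem_iff)
  then show False using \<epsilon> by (simp add: \<epsilon>_def field_simps)
qed

lemma has_value_unique: "has_value p t \<Longrightarrow> has_value p u \<Longrightarrow> t = u"
  using has_value_le[of p t p u] has_value_le[of p u p t] zero by simp

lemma has_value_rconst: "has_value (rconst c) c"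
  unfolding has_value_def by (simp add: rconst_mem_iff flip: rconst.diff)

lemma has_value_add:
  assumes "has_value p t" "has_value q u"
  shows "has_value (p + q) (t + u)"
  unfolding has_value_def
proof (intro allI impI)
  fix \<epsilon> :: real assume "0 < \<epsilon>"
  then have "rconst (t + \<epsilon> / 2) - p \<in> Q" "p - rconst (t - \<epsilon> / 2) \<in> Q"
    "rconst (u + \<epsilon> / 2) - q \<in> Q" "q - rconst (u - \<epsilon> / 2) \<in> Q"
    using assms by (auto simp: has_value_def)
  then have "(rconst (t + \<epsilon> / 2) - p) + (rconst (u + \<epsilon> / 2) - q) \<in> Q"
    "(p - rconst (t - \<epsilon> / 2)) + (q - rconst (u - \<epsilon> / 2)) \<in> Q" by (auto intro: add)
  moreover have eq: "rconst (t + u + \<epsilon>) = rconst (t + \<epsilon> / 2) + (rconst (u + \<epsilon> / 2) :: 'n rpoly)"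
    "rconst (t + u - \<epsilon>) = rconst (t - \<epsilon> / 2) + (rconst (u - \<epsilon> / 2) :: 'n rpoly)"
    by (simp_all add: algebra_simps flip: rconst.add)
  ultimately show "rconst (t + u + \<epsilon>) - (p + q) \<in> Q \<and> p + q - rconst (t + u - \<epsilon>) \<in> Q"
    by (simp only: eq add_diff_add)
qed

lemma has_value_uminus:
  assumes "has_value p t"
  shows "has_value (- p) (- t)"
  unfolding has_value_def
proof (intro allI impI)
  fix \<epsilon> :: real assume "0 < \<epsilon>"
  then have "rconst (t + \<epsilon>) - p \<in> Q" "p - rconst (t - \<epsilon>) \<in> Q"
    using assms by (auto simp: has_value_def)
  moreover have eq: "rconst (- t + \<epsilon>) - - p = p - rconst (t - \<epsilon>)" "- p - rconst (- t - \<epsilon>) = rconst (t + \<epsilon>) - p"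
    by (simp_all add: rconst.add rconst.diff rconst.uminus)
  ultimately show "rconst (- t + \<epsilon>) - - p \<in> Q \<and> - p - rconst (- t - \<epsilon>) \<in> Q"
    unfolding eq by blast
qed

lemma has_value_scale:
  assumes "has_value p t" "0 < c"
  shows "has_value (rconst c * p) (c * t)"
  unfolding has_value_def
proof (intro allI impI)
  fix \<epsilon> :: real assume "0 < \<epsilon>"
  then have "rconst (t + \<epsilon> / c) - p \<in> Q" "p - rconst (t - \<epsilon> / c) \<in> Q"
    using assms by (auto simp: has_value_def)
  then have "rconst c * (rconst (t + \<epsilon> / c) - p) \<in> Q" "rconst c * (p - rconst (t - \<epsilon> / c)) \<in> Q"
    using rconst_mult_mem[OF less_imp_le[OF assms(2)]] by blast+
  moreover have "rconst c * (rconst (t + \<epsilon> / c) - p) = rconst (c * t + \<epsilon>) - rconst c * p"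
    "rconst c * (p - rconst (t - \<epsilon> / c)) = rconst c * p - rconst (c * t - \<epsilon>)"
  proof -
    have e: "c * t + \<epsilon> = c * (t + \<epsilon> / c)" "c * t - \<epsilon> = c * (t - \<epsilon> / c)"
      using assms(2) by (simp_all add: distrib_left right_diff_distrib)
    show "rconst c * (rconst (t + \<epsilon> / c) - p) = rconst (c * t + \<epsilon>) - rconst c * p"
      "rconst c * (p - rconst (t - \<epsilon> / c)) = rconst c * p - rconst (c * t - \<epsilon>)"
      unfolding e by (simp_all only: rconst.mult right_diff_distrib[of "rconst c :: 'n rpoly"])
  qed
  ultimately show "rconst (c * t + \<epsilon>) - rconst c * p \<in> Q \<and> rconst c * p - rconst (c * t - \<epsilon>) \<in> Q"
    by simp
qed

text \<open>The bound \<open>sqrt \<epsilon>\<close> for \<open>p\<close> becomes the bound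
  \<open>\<epsilon>\<close> for the square by \<open>square_bound\<close>.\<close>

lemma has_value_square_zero:
  assumes "has_value p 0"
  shows "has_value (p ^ 2) 0"
  unfolding has_value_def
proof (intro allI impI)
  fix \<epsilon> :: real assume \<epsilon>: "0 < \<epsilon>"
  then have "0 < sqrt \<epsilon>" by simp
  then have "rconst (0 + sqrt \<epsilon>) - p \<in> Q \<and> p - rconst (0 - sqrt \<epsilon>) \<in> Q"
    using assms unfolding has_value_def by blast
  then have "rconst (sqrt \<epsilon>) - p \<in> Q" "rconst (sqrt \<epsilon>) + p \<in> Q"
    using add.commute[of p] by (simp_all add: rconst.uminus)
  then have "rconst (sqrt \<epsilon> ^ 2) - p ^ 2 \<in> Q" using \<epsilon> by (intro square_bound) auto
  moreover have "p ^ 2 + rconst \<epsilon> \<in> Q" using \<epsilon> by (intro add square) (simp add: rconst_mem_iff)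
  ultimately show "rconst (0 + \<epsilon>) - p ^ 2 \<in> Q \<and> p ^ 2 - rconst (0 - \<epsilon>) \<in> Q"
    using \<epsilon> by (simp add: rconst.uminus)
qed

end

section \<open>The point of an Archimedean module\<close>

locale archimedean_module = maximal_module +
  assumes bounded: "p \<in> bounded_elements"
begin

text \<open>The value is the supremum of the constants below \<open>p\<close>. A larger constant is
  not below \<open>p\<close>, and totality of \<open>Q\<close> then puts it above
  \<open>p\<close>.\<close>

lemma has_value_exists: "\<exists>t. has_value p t"
proof -
  obtain N where N: "rconst N - p \<in> Q" "rconst N + p \<in> Q"
    using bounded unfolding bounded_elements_def by blast
  define L where "L = {r. p - rconst r \<in> Q}"
  have "- N \<in> L" using N(2) by (simp add: L_def rconst.uminus add.commute)
  then have ne: "L \<noteq> {}" by blast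
  have ub: "r \<le> N" if "r \<in> L" for r
  proof -
    have "(p - rconst r) + (rconst N - p) \<in> Q" using that N by (intro add) (auto simp: L_def)
    then have "rconst (N - r) \<in> Q" by (simp add: rconst.diff)
    then show ?thesis by (simp add: rconst_mem_iff)
  qed
  then have bdd: "bdd_above L" by (intro bdd_aboveI[of _ N])
  have "has_value p (Sup L)"
    unfolding has_value_def
  proof (intro allI impI conjI)
    fix \<epsilon> :: real assume \<epsilon>: "0 < \<epsilon>"
    have "Sup L + \<epsilon> \<notin> L" using cSup_upper[OF _ bdd, of "Sup L + \<epsilon>"] \<epsilon> by auto
    then show "rconst (Sup L + \<epsilon>) - p \<in> Q" using total[of "p - rconst (Sup L + \<epsilon>)"] by (simp add: L_def)
    obtain r where r: "r \<in> L" "Sup L - \<epsilon> < r" using less_cSupD[OF ne, of "Sup L - \<epsilon>"] \<epsilon> by auto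
    have "(p - rconst r) + rconst (r - (Sup L - \<epsilon>)) \<in> Q"
      using r by (intro add) (auto simp: L_def rconst_mem_iff)
    also have "(p - rconst r) + rconst (r - (Sup L - \<epsilon>)) = p - rconst (Sup L - \<epsilon>)"
      unfolding rconst.diff[of r "Sup L - \<epsilon>"] by simp
    finally show "p - rconst (Sup L - \<epsilon>) \<in> Q" .
  qed
  then show ?thesis by blast
qed

definition val :: "'a rpoly \<Rightarrow> real" where
  "val p = (THE t. has_value p t)"

lemma has_value_val: "has_value p (val p)"
proof -
  have "\<exists>!t. has_value p t" using has_value_exists[of p] has_value_unique[of p] by blast
  then show ?thesis unfolding val_def by (rule theI')
qed

lemma val_eqI: "has_value p t \<Longrightarrow> val p = t"
  using has_value_unique has_value_val by blast

text \<open>A shift reduces to the value \<open>0\<close>: with \<open>q = p - t\<close> one has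
  \<open>p^2 = q^2 + 2 * t * p - t^2\<close>, where everything but \<open>q^2\<close> is linear in
  \<open>p\<close>.\<close>

lemma val_square: "val (p ^ 2) = val p ^ 2"
proof -
  define t where "t = val p"
  have p: "has_value p t" by (simp add: t_def has_value_val)
  define q where "q = p + rconst (- t)"
  have "has_value q (t + - t)" unfolding q_def by (intro has_value_add p has_value_rconst)
  then have "has_value (q ^ 2) 0" by (intro has_value_square_zero) simp
  moreover have "has_value (rconst t * p) (t * t)"
  proof -
    consider "t > 0" | "t = 0" | "- t > 0" by linarith
    then show ?thesis
    proof cases
      case 2
      then show ?thesis using has_value_rconst[of 0] by (simp add: rconst.zero)
    next
      case 3
      have "has_value (- (rconst (- t) * p)) (- (- t * t))"
        by (intro has_value_uminus has_value_scale p 3)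
      then show ?thesis by (simp add: rconst.uminus)
    qed (intro has_value_scale p)
  qed
  ultimately have "has_value (q ^ 2 + (rconst t * p + rconst t * p) + rconst (- (t * t))) (0 + (t * t + t * t) + - (t * t))"
    by (intro has_value_add has_value_rconst)
  moreover have "q ^ 2 + (rconst t * p + rconst t * p) + rconst (- (t * t)) = p ^ 2"
    by (simp add: q_def power2_eq_square rconst.uminus rconst.mult algebra_simps)
  ultimately show ?thesis using val_eqI[of "p ^ 2" "t * t"] by (simp add: t_def power2_eq_square)
qed

lemma ring_morphism_val: "ring_morphism val"
proof (rule ring_morphism.intro)
  show "val 1 = 1" using val_eqI[OF has_value_rconst[of 1]] by (simp add: rconst.one)
  show add: "val (p + q) = val p + val q" for p q
    by (intro val_eqI has_value_add has_value_val)
  have um: "val (- p) = - val p" for p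
    by (intro val_eqI has_value_uminus has_value_val)
  have sc: "val (rconst (1 / 4) * p) = 1 / 4 * val p" for p
    by (intro val_eqI has_value_scale has_value_val) simp
  show "val (p * q) = val p * val q" for p q
    unfolding polarization[of p q] sc add um val_square by (simp add: power2_eq_square algebra_simps)
qed

lemma nonneg_point: "\<exists>x. \<forall>p\<in>Q. 0 \<le> reval p x"
proof -
  have rc: "val \<circ> rconst = id" by (rule ext) (simp add: val_eqI has_value_rconst)
  have v: "vec_nth (vec_lambda (val \<circ> rvar)) = val \<circ> rvar" by (simp add: fun_eq_iff)
  have "val p = reval p (vec_lambda (val \<circ> rvar))" for p
    using reval_in_unique[OF ring_morphism_val, of p] unfolding rc reval_eq_reval_in v .
  moreover have "0 \<le> val p" if "p \<in> Q" for p
    using has_value_le[of 0 0 p "val p"] has_value_rconst[of 0] has_value_val that by (simp add: rconst.zero)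
  ultimately have "\<forall>p\<in>Q. 0 \<le> reval p (vec_lambda (val \<circ> rvar))" by simp
  then show ?thesis by blast
qed

end

lemma safe_set_nonempty:
  fixes b :: "nat \<Rightarrow> 'n::finite rpoly"
  assumes arch: "archimedean (quad_module L b)" and proper: "- 1 \<notin> quad_module L b"
  shows "safe_set L b \<noteq> {}"
proof -
  let ?M = "quad_module L b"
  have memI: "s 0 + (\<Sum>i=1..L. s i * b i) \<in> ?M" if "\<And>i. s i \<in> sos" for s
    using that unfolding quad_module_def by blast
  have sosM: "s \<in> ?M" if "s \<in> sos" for s
  proof -
    have "(\<Sum>i=1..L. (if i = 0 then s else 0) * b i) = 0" by (intro sum.neutral) auto
    moreover have "(if i = 0 then s else 0) \<in> sos" for i :: nat using that by (simp add: sos_zero)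
    ultimately show ?thesis using memI[of "\<lambda>i. if i = 0 then s else 0"] by simp
  qed
  have bM: "b j \<in> ?M" if "j \<in> {1..L}" for j
  proof -
    have "(\<Sum>i=1..L. (if i = j then 1 else 0) * b i) = (\<Sum>i=1..L. if i = j then b i else 0)"
      by (intro sum.cong) auto
    also have "\<dots> = b j" using that by (subst sum.delta) auto
    finally have "(\<Sum>i=1..L. (if i = j then 1 else 0) * b i) = b j" .
    moreover have "(if i = j then 1 else 0 :: 'n rpoly) \<in> sos" for i using sos_square[of "1 :: 'n rpoly"] by (simp add: sos_zero)
    ultimately show ?thesis using memI[of "\<lambda>i. if i = j then 1 else 0"] that by simp
  qed
  have "proper_module ?M"
    unfolding proper_module_def
  proof (intro conjI allI ballI proper)
    show "1 \<in> ?M" using sosM[OF sos_square[of 1]] by simp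
    show "x + y \<in> ?M" if xy: "x \<in> ?M" "y \<in> ?M" for x y
    proof -
      obtain s t where st: "x = s 0 + (\<Sum>i=1..L. s i * b i)" "\<forall>i\<le>L. s i \<in> sos"
        "y = t 0 + (\<Sum>i=1..L. t i * b i)" "\<forall>i\<le>L. t i \<in> sos"
        using xy unfolding quad_module_def by blast
      have "x + y = (s 0 + t 0) + (\<Sum>i=1..L. (s i + t i) * b i)"
        unfolding st(1,3) by (simp add: distrib_right sum.distrib algebra_simps)
      moreover have "\<forall>i\<le>L. s i + t i \<in> sos" using st(2,4) sos_add by blast
      ultimately show ?thesis unfolding quad_module_def
        by (intro CollectI exI[of _ "\<lambda>i. s i + t i"] conjI)
    qed
    show "p ^ 2 * x \<in> ?M" if x: "x \<in> ?M" for p x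
    proof -
      obtain s where s: "x = s 0 + (\<Sum>i=1..L. s i * b i)" "\<forall>i\<le>L. s i \<in> sos"
        using x unfolding quad_module_def by blast
      have "p ^ 2 * x = p ^ 2 * s 0 + (\<Sum>i=1..L. (p ^ 2 * s i) * b i)"
        unfolding s(1) by (simp add: distrib_left sum_distrib_left mult.assoc)
      moreover have "\<forall>i\<le>L. p ^ 2 * s i \<in> sos" using s(2) sos_square_mult by blast
      ultimately show ?thesis unfolding quad_module_def
        by (intro CollectI exI[of _ "\<lambda>i. p ^ 2 * s i"] conjI)
    qed
  qed
  then have "\<exists>Q. ?M \<subseteq> Q \<and> proper_module Q \<and> (\<forall>N. proper_module N \<longrightarrow> Q \<subseteq> N \<longrightarrow> N = Q)"
  proof (rule maximal_subset_exists[where R = proper_module])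
    fix \<C> :: "'n rpoly set set"
    assume ne: "\<C> \<noteq> {}" and pm: "\<And>M. M \<in> \<C> \<Longrightarrow> proper_module M"
      and two: "\<And>x y. x \<in> \<Union>\<C> \<Longrightarrow> y \<in> \<Union>\<C> \<Longrightarrow> \<exists>M\<in>\<C>. x \<in> M \<and> y \<in> M"
    have "x + y \<in> \<Union>\<C>" if xy: "x \<in> \<Union>\<C>" "y \<in> \<Union>\<C>" for x y
    proof -
      obtain M where M: "M \<in> \<C>" "x \<in> M" "y \<in> M" using two[OF xy] by blast
      then have "x + y \<in> M" using pm[OF M(1)] unfolding proper_module_def by blast
      then show ?thesis using M(1) by blast
    qed
    moreover have "p ^ 2 * x \<in> \<Union>\<C>" if "x \<in> \<Union>\<C>" for p x
      using that pm unfolding proper_module_def by blast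
    moreover have "1 \<in> \<Union>\<C>" using ne pm unfolding proper_module_def by blast
    moreover have "- 1 \<notin> \<Union>\<C>" using pm unfolding proper_module_def by blast
    ultimately show "proper_module (\<Union>\<C>)" unfolding proper_module_def by simp
  qed
  then obtain Q where Q: "?M \<subseteq> Q" "proper_module Q" "\<And>N. proper_module N \<Longrightarrow> Q \<subseteq> N \<Longrightarrow> N = Q" by blast
  interpret maximal_module Q by standard (rule Q(2), rule Q(3))
  obtain C where C: "of_nat C - (\<Sum>i\<in>UNIV. rvar i ^ 2) \<in> Q"
    using arch Q(1) unfolding archimedean_def by blast
  have "rvar i \<in> bounded_elements" for i
  proof -
    let ?c = "rconst (real C) :: 'n rpoly" and ?h = "rconst (1 / 2) :: 'n rpoly"
    \<comment> \<open>The squares of the other variables lie in \<open>Q\<close>; adding them to the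
      Archimedean element leaves \<open>C - x_i^2\<close>.\<close>
    have "(\<Sum>j\<in>UNIV. rvar j ^ 2) = rvar i ^ 2 + (\<Sum>j\<in>UNIV - {i}. rvar j ^ 2 :: 'n rpoly)"
      by (simp add: sum.remove)
    moreover have "(\<Sum>j\<in>A. rvar j ^ 2) \<in> Q" for A
      by (induction A rule: infinite_finite_induct) (simp_all add: zero add square)
    ultimately have "?c - rvar i ^ 2 \<in> Q"
      using add[OF C, of "\<Sum>j\<in>UNIV - {i}. rvar j ^ 2"] by (simp add: rconst.of_nat)
    \<comment> \<open>Half of \<open>(x_i - 1)^2 + (C - x_i^2)\<close> is
      \<open>(C + 1) / 2 - x_i\<close>, and likewise with the other sign; this is the origin of the
      bound \<open>(C + 1) / 2\<close>.\<close>
    then have "?h * ((rvar i - 1) ^ 2 + (?c - rvar i ^ 2)) \<in> Q" "?h * ((rvar i + 1) ^ 2 + (?c - rvar i ^ 2)) \<in> Q"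
      using add[OF square] by (simp_all add: rconst_mult_mem)
    moreover have two: "?h + ?h = 1" by (simp add: rconst.one flip: rconst.add)
    have "?h * ((rvar i - 1) ^ 2 + (?c - rvar i ^ 2)) = ?h * ?c + ?h - (?h + ?h) * rvar i"
      "?h * ((rvar i + 1) ^ 2 + (?c - rvar i ^ 2)) = ?h * ?c + ?h + (?h + ?h) * rvar i"
      by (simp_all add: algebra_simps power2_eq_square)
    moreover have "?h * ?c + ?h = rconst (real C / 2 + 1 / 2)"
      by (simp flip: rconst.mult rconst.add)
    ultimately show ?thesis unfolding bounded_elements_def two mult_1_left
      by (intro CollectI exI[of _ "real C / 2 + 1 / 2"]) simp
  qed
  then interpret archimedean_module Q by unfold_locales (rule bounded_all)
  obtain x where "\<forall>p\<in>Q. 0 \<le> reval p x" using nonneg_point by blast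
  then have "x \<in> safe_set L b" using bM Q(1) unfolding safe_set_def by blast
  then show ?thesis by blast
qed

section \<open>The certificate\<close>

text \<open>At a point where \<open>c\<close> and \<open>L_g c\<close> vanish, \<open>h_j\<close>
  takes the nonnegative value of \<open>s_j\<close>, so for negative \<open>L_f c\<close> the left
  side of the identity would be negative. For the converse the Positivstellensatz is applied to
  \<open>q = L_f c\<close> and the ideal generated by \<open>c\<close> and the entries of
  \<open>L_g c\<close>.\<close>

lemma is_cbf_iff_certificate:
  fixes f :: "'n::finite rpoly ^ 'n" and g :: "'n rpoly ^ 'm::finite ^ 'n"
  shows "is_cbf f g c \<longleftrightarrow>
    (\<exists>(a::nat) s1 s2 p10 p20 (p1 :: 'n rpoly ^ 'm) (p2 :: 'n rpoly ^ 'm).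
       s1 \<in> sos \<and> s2 \<in> sos \<and>
       (let h1 = s1 + c * p10 + rowmult (Lie_g g c) p1;
            h2 = s2 + c * p20 + rowmult (Lie_g g c) p2
        in h1 * Lie_f f c - h2 - Lie_f f c ^ (2 * a) = 0))" (is "_ \<longleftrightarrow> ?cert")
proof
  let ?v = "Lie_g g c" and ?q = "Lie_f f c"
  define I where "I = {c * p + rowmult ?v w | p w. True}"
  define E where "E = insert c (range (($) ?v))"
  assume cbf: "is_cbf f g c"
  have row0: "rowmult ?v 0 = 0" by (simp add: rowmult_def)
  have rowa: "rowmult ?v w + rowmult ?v w' = rowmult ?v (w + w')" for w w'
    by (simp add: rowmult_def distrib_left sum.distrib)
  have rowm: "rowmult ?v w * p = rowmult ?v (\<chi> k. w $ k * p)" for w p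
    by (simp add: rowmult_def sum_distrib_right mult.assoc)
  have "E \<subseteq> I"
  proof
    fix e assume "e \<in> E"
    then consider "e = c" | k where "e = ?v $ k" unfolding E_def by blast
    then show "e \<in> I"
    proof cases
      case 1
      have "c * 1 + rowmult ?v 0 \<in> I" unfolding I_def by blast
      then show ?thesis by (simp add: 1 row0)
    next
      case 2
      have "rowmult ?v (axis k 1) = (\<Sum>j\<in>UNIV. if j = k then ?v $ j else 0)"
        unfolding rowmult_def by (intro sum.cong) (auto simp: axis_def)
      then have "rowmult ?v (axis k 1) = ?v $ k" by simp
      moreover have "c * 0 + rowmult ?v (axis k 1) \<in> I" unfolding I_def by blast
      ultimately show ?thesis by (simp add: 2)
    qed
  qed
  moreover have "0 \<in> I" unfolding I_def using row0 by (auto intro!: exI[of _ 0])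
  moreover have "x + y \<in> I" if xy: "x \<in> I" "y \<in> I" for x y
  proof -
    obtain p w p' w' where "x = c * p + rowmult ?v w" "y = c * p' + rowmult ?v w'"
      using xy unfolding I_def by blast
    then have "x + y = c * (p + p') + rowmult ?v (w + w')" by (simp add: distrib_left flip: rowa)
    then show ?thesis unfolding I_def by blast
  qed
  moreover have "x * y \<in> I" if x: "x \<in> I" for x y
  proof -
    obtain p w where "x = c * p + rowmult ?v w" using x unfolding I_def by blast
    then have "x * y = c * (p * y) + rowmult ?v (\<chi> k. w $ k * y)"
      by (simp add: distrib_right rowm mult.assoc)
    then show ?thesis unfolding I_def by blast
  qed
  moreover have "0 \<le> reval ?q x" if x: "\<And>e. e \<in> E \<Longrightarrow> reval e x = 0" for x
  proof -
    have "reval c x = 0" "reval_vec ?v x = 0"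
      using x by (auto simp: E_def reval_vec_def vec_eq_iff)
    then have "\<not> reval ?q x < 0" using cbf unfolding is_cbf_def by blast
    then show ?thesis by simp
  qed
  ultimately obtain a s t e where cert: "s \<in> sos" "t \<in> sos" "e \<in> I" "t * ?q - (s + e) - ?q ^ (2 * a) = 0"
    using positivstellensatz[of E I ?q] by (auto simp: E_def)
  obtain p w where e: "e = c * p + rowmult ?v w" using cert(3) unfolding I_def by blast
  \<comment> \<open>The ideal element of the certificate goes into \<open>h2\<close> as a whole,
    hence the zero polynomials in \<open>h1\<close>.\<close>
  have "(let h1 = t + c * 0 + rowmult ?v 0; h2 = s + c * p + rowmult ?v w
      in h1 * ?q - h2 - ?q ^ (2 * a) = 0)"
    using cert(4) by (simp add: Let_def row0 e add.assoc)
  then show ?cert using cert(1,2) by blast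
next
  let ?v = "Lie_g g c" and ?q = "Lie_f f c"
  assume ?cert
  then obtain a s1 s2 p10 p20 and p1 p2 :: "'n rpoly ^ 'm" where s: "s1 \<in> sos" "s2 \<in> sos"
    and eq: "(s1 + c * p10 + rowmult ?v p1) * ?q - (s2 + c * p20 + rowmult ?v p2) - ?q ^ (2 * a) = 0"
    unfolding Let_def by blast
  show "is_cbf f g c"
    unfolding is_cbf_def
  proof (intro notI, elim exE conjE)
    fix x assume x: "reval c x = 0" "reval_vec ?v x = 0" "reval ?q x < 0"
    interpret ring_morphism "\<lambda>p. reval p x" by (rule ring_morphism_reval)
    have "reval (?v $ k) x = 0" for k using x(2) by (simp add: reval_vec_def vec_eq_iff)
    then have row: "reval (rowmult ?v w) x = 0" for w by (simp add: rowmult_def sum mult)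
    have "reval ((s1 + c * p10 + rowmult ?v p1) * ?q - (s2 + c * p20 + rowmult ?v p2) - ?q ^ (2 * a)) x = 0"
      unfolding eq by (rule zero)
    then have "reval s1 x * reval ?q x - reval s2 x - reval ?q x ^ (2 * a) = 0"
      by (simp add: diff add mult power row x(1))
    moreover have "reval s1 x * reval ?q x \<le> 0" using sos_nonneg[OF s(1)] x(3) by (simp add: mult_nonneg_nonpos)
    moreover have "0 < reval ?q x ^ (2 * a)" using x(3) by (simp add: zero_less_power_eq)
    ultimately show False using sos_nonneg[OF s(2), of x] by linarith
  qed
qed

theorem theorem2:
  fixes f :: "'n::finite rpoly ^ 'n"
    and g :: "'n rpoly ^ 'm::finite ^ 'n"
    and L :: nat
    and b :: "nat \<Rightarrow> 'n rpoly"
  assumes "archimedean (quad_module L b)"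
  shows "((\<forall>i\<in>{1..L}. is_cbf f g (b i)) \<and> safe_set L b \<noteq> {}) \<longleftrightarrow>
    (\<forall>i\<in>{1..L}. \<exists>(a::nat) s1 s2 p10 p20 (p1 :: 'n rpoly ^ 'm) (p2 :: 'n rpoly ^ 'm).
       s1 \<in> sos \<and> s2 \<in> sos \<and>
       (let h1 = s1 + b i * p10 + rowmult (Lie_g g (b i)) p1;
            h2 = s2 + b i * p20 + rowmult (Lie_g g (b i)) p2
        in h1 * Lie_f f (b i) - h2 - Lie_f f (b i) ^ (2 * a) = 0))
    \<and> \<not> (\<exists>s :: nat \<Rightarrow> 'n rpoly. (\<forall>i\<le>L. s i \<in> sos) \<and>
          1 + s 0 + (\<Sum>i=1..L. s i * b i) = 0)"
proof -
  \<comment> \<open>Each conjunct matches one condition. The Archimedean assumption enters in the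
    passage from (2) to a point of the safe set; in the other direction the identity is evaluated at
    such a point.\<close>
  have "safe_set L b \<noteq> {} \<longleftrightarrow>
    \<not> (\<exists>s :: nat \<Rightarrow> 'n rpoly. (\<forall>i\<le>L. s i \<in> sos) \<and> 1 + s 0 + (\<Sum>i=1..L. s i * b i) = 0)"
    (is "_ \<longleftrightarrow> \<not> ?ref")
  proof
    assume "safe_set L b \<noteq> {}"
    then obtain x where "x \<in> safe_set L b" by blast
    then have x: "0 \<le> reval (b i) x" if "i \<in> {1..L}" for i using that unfolding safe_set_def by blast
    interpret ring_morphism "\<lambda>p. reval p x" by (rule ring_morphism_reval)
    show "\<not> ?ref"
    proof
      assume ?ref
      then obtain s where s: "\<forall>i\<le>L. s i \<in> sos" "1 + s 0 + (\<Sum>i=1..L. s i * b i) = 0" by blast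
      have "reval (1 + s 0 + (\<Sum>i=1..L. s i * b i)) x = 0" unfolding s(2) by (rule zero)
      then have "1 + reval (s 0) x + (\<Sum>i=1..L. reval (s i) x * reval (b i) x) = 0"
        by (simp add: add one mult sum)
      moreover have "0 \<le> (\<Sum>i=1..L. reval (s i) x * reval (b i) x)"
        by (intro sum_nonneg mult_nonneg_nonneg) (use s(1) x sos_nonneg in auto)
      moreover have "0 \<le> reval (s 0) x" using s(1) by (intro sos_nonneg) auto
      ultimately show False by linarith
    qed
  next
    assume nref: "\<not> ?ref"
    have "- 1 \<notin> quad_module L b"
    proof
      assume "- 1 \<in> quad_module L b"
      then obtain s where s: "- 1 = s 0 + (\<Sum>i=1..L. s i * b i)" "\<forall>i\<le>L. s i \<in> sos"
        unfolding quad_module_def by blast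
      have "1 + s 0 + (\<Sum>i=1..L. s i * b i) = 1 + (s 0 + (\<Sum>i=1..L. s i * b i))" by (rule add.assoc)
      also have "\<dots> = 0" unfolding s(1)[symmetric] by simp
      finally show False using nref s(2) by blast
    qed
    then show "safe_set L b \<noteq> {}" by (rule safe_set_nonempty[OF assms])
  qed
  then show ?thesis by (simp only: is_cbf_iff_certificate)
qed

end
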